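(* Let $i,j,k,l,m$ be integers such that $1\le k\le mr+l$, $0\le l\le r-1$, $1\le i,j\le r$, $m\ge 0$. (1) Suppose $j\le i$. 1) If $k+i\ge r+j$, then $$X_{E_i[k]}X_{E_j[mr+l]}=X_{E_i[(m+1)r+l+j-i]}X_{E_j[k+i-r-j]}+X_{E_i[r+j-i-1]}X_{E_{k+i+1}[(m+1)r+l+j-k-i-1]}.$$ 2) If $k+i<r+j$ and $i\le l+j\le k+i-1$, then $$X_{E_i[k]}X_{E_j[mr+l]}=X_{E_j[mr+k+i-j]}X_{E_i[l+j-i]}+X_{E_j[mr+i-j-1]}X_{E_{l+j+1}[k+i-l-j-1]}.$$ 3) In all other cases, i.e. when there are no extensions between $E_i[k]$ and $E_j[mr+l]$ (in either direction), $X_{E_i[k]}X_{E_j[mr+l]}=X_{E_i[k]\oplus E_j[mr+l]}$. (2) Suppose $j>i$. 1) If $k\ge j-i$, then $$X_{E_i[k]}X_{E_j[mr+l]}=X_{E_i[j-i-1]}X_{E_{k+i+1}[mr+l+j-k-i-1]}+X_{E_i[mr+l+j-i]}X_{E_j[k+i-j]}.$$ 2) If $k<j-i$ and $i\le l+j-r\le k+i-1$, then $$X_{E_i[k]}X_{E_j[mr+l]}=X_{E_j[(m+1)r+k+i-j]}X_{E_i[l+j-r-i]}+X_{E_j[(m+1)r+i-j-1]}X_{E_{l+j+1}[k+r+i-l-j-1]}.$$ 3) In all other cases, i.e. when there are no extensions between $E_i[k]$ and $E_j[mr+l]$ (in either direction), $X_{E_i[k]}X_{E_j[mr+l]}=X_{E_i[k]\oplus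 E_j[mr+l]}$.
   Context: Let $r\ge 1$ and let $Q=\widetilde{A}_r$ be the cyclic quiver with vertices $1,\dots,r$ and exactly one arrow $i\to i-1$ for $2\le i\le r$ and one arrow $1\to r$ (a loop if $r=1$). $\mathrm{mod}\,\mathbb{C}Q$ is the category of finite-dimensional nilpotent representations of $Q$ over $\mathbb{C}$. $E_i$ is the simple module at vertex $i$, with dimension vector $s_i$; indices are read modulo $r$ ($E_{i+r}=E_i$). $E_i[n]$ is the unique (up to isomorphism) nilpotent indecomposable representation with socle $E_i$ and length $n$, and $E_i[0]=0$. The Euler form is $\langle\underline{\dim}M,\underline{\dim}N\rangle=\dim\mathrm{Hom}(M,N)-\dim\mathrm{Ext}^1(M,N)$, which depends only on dimension vectors. For $M\in\mathrm{mod}\,\mathbb{C}Q$, $$X_M=\sum_{\underline e}\chi(\mathrm{Gr}_{\underline e}(M))\prod_{i=1}^r x_i^{-\langle \underline e,s_i\rangle-\langle s_i,\underline{\dim}M-\underline e\rangle}\in\mathbb{Z}[x_1^{\pm1},\dots,x_r^{\pm1}],$$ where $\mathrm{Gr}_{\underline e}(M)$ is the variety of submodules of $M$ of dimension vector $\underline e$, $\chi$ is the Euler characteristic, and $X_0=1$. *)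

theory Defs
  imports
    "HOL-Homology.Homology"
    "HOL-Library.Function_Algebras"
    "HOL-Library.Poly_Mapping"
begin

section \<open>Complex vector spaces of functions\<close>

text \<open>All vector spaces are finite-dimensional complex subspaces of a function space
  \<open>'b \<Rightarrow> complex\<close> with pointwise operations.\<close>

type_synonym 'b cvec = "'b \<Rightarrow> complex"

definition cscale :: "complex \<Rightarrow> 'b cvec \<Rightarrow> 'b cvec"
  where "cscale c x = (\<lambda>b. c * x b)"

global_interpretation cvec: vector_space cscale
  by unfold_locales (auto simp: cscale_def fun_eq_iff algebra_simps)

definition lin_on :: "'b cvec set \<Rightarrow> 'c cvec set \<Rightarrow> ('b cvec \<Rightarrow> 'c cvec) \<Rightarrow> bool"
  where "lin_on V W f \<longleftrightarrow>
    (\<forall>x\<in>V. f x \<in> W) \<and>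
    (\<forall>x\<in>V. \<forall>y\<in>V. f (x + y) = f x + f y) \<and>
    (\<forall>c. \<forall>x\<in>V. f (cscale c x) = cscale c (f x))"

section \<open>Representations of the cyclic quiver\<close>

text \<open>The vertices are \<open>{1..r}\<close>; \<open>wrap r v\<close> is the vertex congruent to \<open>v\<close> modulo \<open>r\<close>.
  The arrow starting at \<open>v\<close> ends at \<open>wrap r (v - 1)\<close>, and \<open>Mp M v\<close> is the map attached to it.
  Only the values of \<open>Sp M\<close> at vertices, and of \<open>Mp M v\<close> on \<open>Sp M v\<close>, are meaningful.\<close>

definition wrap :: "int \<Rightarrow> int \<Rightarrow> int"
  where "wrap r v = (v - 1) mod r + 1"

record 'b rep =
  Sp :: "int \<Rightarrow> 'b cvec set"
  Mp :: "int \<Rightarrow> 'b cvec \<Rightarrow> 'b cvec"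

definition is_rep :: "int \<Rightarrow> 'b rep \<Rightarrow> bool"
  where "is_rep r M \<longleftrightarrow>
    (\<forall>v\<in>{1..r}. (\<exists>B. finite B \<and> Sp M v = cvec.span B) \<and>
                lin_on (Sp M v) (Sp M (wrap r (v - 1))) (Mp M v))"

fun path_map :: "int \<Rightarrow> 'b rep \<Rightarrow> nat \<Rightarrow> int \<Rightarrow> 'b cvec \<Rightarrow> 'b cvec"
  where
    "path_map r M 0 v x = x"
  | "path_map r M (Suc n) v x = path_map r M n (wrap r (v - 1)) (Mp M v x)"

definition nilpotent_rep :: "int \<Rightarrow> 'b rep \<Rightarrow> bool"
  where "nilpotent_rep r M \<longleftrightarrow>
    is_rep r M \<and> (\<exists>n. \<forall>v\<in>{1..r}. \<forall>x\<in>Sp M v. path_map r M n v x = 0)"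

definition dimv :: "int \<Rightarrow> 'b rep \<Rightarrow> int \<Rightarrow> nat"
  where "dimv r M = (\<lambda>v. if v \<in> {1..r} then cvec.dim (Sp M v) else 0)"

definition rep_iso :: "int \<Rightarrow> 'b rep \<Rightarrow> 'c rep \<Rightarrow> bool"
  where "rep_iso r M N \<longleftrightarrow>
    (\<exists>\<phi>. \<forall>v\<in>{1..r}.
       lin_on (Sp M v) (Sp N v) (\<phi> v) \<and> bij_betw (\<phi> v) (Sp M v) (Sp N v) \<and>
       (\<forall>x\<in>Sp M v. \<phi> (wrap r (v - 1)) (Mp M v x) = Mp N v (\<phi> v x)))"

definition zero_rep :: "'b rep"
  where "zero_rep = \<lparr>Sp = (\<lambda>_. {0}), Mp = (\<lambda>_ _. 0)\<rparr>"

definition rep_dsum :: "'b rep \<Rightarrow> 'c rep \<Rightarrow> ('b + 'c) rep"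
  where "rep_dsum M N =
    \<lparr>Sp = (\<lambda>v. {case_sum x y | x y. x \<in> Sp M v \<and> y \<in> Sp N v}),
     Mp = (\<lambda>v z. case_sum (Mp M v (z \<circ> Inl)) (Mp N v (z \<circ> Inr)))\<rparr>"

subsection \<open>Submodules\<close>

text \<open>A submodule is a family of subspaces indexed by the vertices, extensional so that
  submodules are equal iff they agree at all vertices.\<close>

definition submodule :: "int \<Rightarrow> 'b rep \<Rightarrow> (int \<Rightarrow> 'b cvec set) \<Rightarrow> bool"
  where "submodule r M U \<longleftrightarrow>
    U \<in> extensional {1..r} \<and>
    (\<forall>v\<in>{1..r}. cvec.subspace (U v) \<and> U v \<subseteq> Sp M v \<and> Mp M v ` U v \<subseteq> U (wrap r (v - 1)))"

definition zero_sub :: "int \<Rightarrow> int \<Rightarrow> 'b cvec set"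
  where "zero_sub r = (\<lambda>v\<in>{1..r}. {0})"

definition full_sub :: "int \<Rightarrow> 'b rep \<Rightarrow> int \<Rightarrow> 'b cvec set"
  where "full_sub r M = (\<lambda>v\<in>{1..r}. Sp M v)"

definition subrep :: "'b rep \<Rightarrow> (int \<Rightarrow> 'b cvec set) \<Rightarrow> 'b rep"
  where "subrep M U = M\<lparr>Sp := U\<rparr>"

definition is_simple :: "int \<Rightarrow> 'b rep \<Rightarrow> bool"
  where "is_simple r M \<longleftrightarrow>
    is_rep r M \<and> full_sub r M \<noteq> zero_sub r \<and>
    (\<forall>U. submodule r M U \<longrightarrow> U = zero_sub r \<or> U = full_sub r M)"

definition socle :: "int \<Rightarrow> 'b rep \<Rightarrow> int \<Rightarrow> 'b cvec set"
  where "socle r M =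
    (\<lambda>v\<in>{1..r}. cvec.span (\<Union>{U v | U. submodule r M U \<and> is_simple r (subrep M U)}))"

definition indecomposable :: "int \<Rightarrow> 'b rep \<Rightarrow> bool"
  where "indecomposable r M \<longleftrightarrow>
    is_rep r M \<and> full_sub r M \<noteq> zero_sub r \<and>
    (\<forall>U W. submodule r M U \<longrightarrow> submodule r M W \<longrightarrow>
       (\<forall>v\<in>{1..r}. U v \<inter> W v = {0} \<and> Sp M v = {u + w | u w. u \<in> U v \<and> w \<in> W v}) \<longrightarrow>
       U = zero_sub r \<or> W = zero_sub r)"

text \<open>\<open>M\<close> has a composition series with \<open>n\<close> factors.\<close>

definition has_length :: "int \<Rightarrow> 'b rep \<Rightarrow> nat \<Rightarrow> bool"
  where "has_length r M n \<longleftrightarrow>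
    (\<exists>U. U 0 = zero_sub r \<and> U n = full_sub r M \<and>
         (\<forall>t\<le>n. submodule r M (U t)) \<and>
         (\<forall>t<n. U t < U (Suc t) \<and>
            (\<forall>W. submodule r M W \<and> U t \<le> W \<and> W \<le> U (Suc t) \<longrightarrow> W = U t \<or> W = U (Suc t))))"

subsection \<open>The modules \<open>E\<^sub>i\<close> and \<open>E\<^sub>i[n]\<close>\<close>

definition simple_rep :: "int \<Rightarrow> int \<Rightarrow> nat rep"
  where "simple_rep r i =
    \<lparr>Sp = (\<lambda>v. if v = wrap r i then {x. \<forall>b>0. x b = 0} else {0}), Mp = (\<lambda>_ _. 0)\<rparr>"

text \<open>The index \<open>i\<close> is an arbitrary integer, read modulo \<open>r\<close>. The length \<open>n\<close> is taken to be an
  integer so that no truncated subtraction occurs; it is only meaningful for \<open>n \<ge> 0\<close>.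
  The module is determined up to isomorphism only, and one representative is chosen.\<close>

definition indec :: "int \<Rightarrow> int \<Rightarrow> int \<Rightarrow> nat rep"
  where "indec r i n =
    (if n = 0 then zero_rep
     else SOME M. nilpotent_rep r M \<and> indecomposable r M \<and>
            rep_iso r (subrep M (socle r M)) (simple_rep r i) \<and> has_length r M (nat n))"

section \<open>Hom, Ext and the Euler form\<close>

text \<open>\<open>fam r s M N\<close> is the vector space of families of linear maps
  \<open>Sp M v \<rightarrow> Sp N (v - s)\<close>, normalised to be zero where they are not meaningful.
  The kernel of \<open>bdry\<close> on \<open>fam r 0 M N\<close> is \<open>Hom(M, N)\<close>. A member \<open>\<xi>\<close> of \<open>fam r 1 M N\<close> gives an
  extension of \<open>M\<close> by \<open>N\<close>: the spaces of \<open>N \<oplus> M\<close> with the maps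
  \<open>(y, x) \<mapsto> (Mp N v y + \<xi> v x, Mp M v x)\<close>. Up to equivalence every extension is of this form, and
  two of them are equivalent iff they differ by an element of \<open>bdry ` fam r 0 M N\<close>. Hence
  \<open>Ext\<^sup>1(M, N)\<close> is the cokernel of \<open>bdry\<close>. (If \<open>M\<close> and \<open>N\<close> are nilpotent, so is
  every extension.)\<close>

definition hscale ::
    "complex \<Rightarrow> (int \<Rightarrow> 'b cvec \<Rightarrow> 'c cvec) \<Rightarrow> int \<Rightarrow> 'b cvec \<Rightarrow> 'c cvec"
  where "hscale c \<phi> = (\<lambda>v x. cscale c (\<phi> v x))"

global_interpretation hvec: vector_space hscale
  by unfold_locales (auto simp: hscale_def cscale_def fun_eq_iff algebra_simps)

definition fam :: "int \<Rightarrow> int \<Rightarrow> 'b rep \<Rightarrow> 'c rep \<Rightarrow> (int \<Rightarrow> 'b cvec \<Rightarrow> 'c cvec) set"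
  where "fam r s M N =
    {\<phi>. (\<forall>v\<in>{1..r}. lin_on (Sp M v) (Sp N (wrap r (v - s))) (\<phi> v)) \<and>
        (\<forall>v x. \<not> (v \<in> {1..r} \<and> x \<in> Sp M v) \<longrightarrow> \<phi> v x = 0)}"

definition bdry ::
    "int \<Rightarrow> 'b rep \<Rightarrow> 'c rep \<Rightarrow> (int \<Rightarrow> 'b cvec \<Rightarrow> 'c cvec) \<Rightarrow> int \<Rightarrow> 'b cvec \<Rightarrow> 'c cvec"
  where "bdry r M N \<phi> =
    (\<lambda>v x. if v \<in> {1..r} \<and> x \<in> Sp M v
           then Mp N v (\<phi> v x) - \<phi> (wrap r (v - 1)) (Mp M v x) else 0)"

definition hom_dim :: "int \<Rightarrow> 'b rep \<Rightarrow> 'c rep \<Rightarrow> nat"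
  where "hom_dim r M N = hvec.dim {\<phi> \<in> fam r 0 M N. bdry r M N \<phi> = 0}"

definition ext_dim :: "int \<Rightarrow> 'b rep \<Rightarrow> 'c rep \<Rightarrow> nat"
  where "ext_dim r M N = hvec.dim (fam r 1 M N) - hvec.dim (bdry r M N ` fam r 0 M N)"

text \<open>The Euler form of two dimension vectors is the common value of
  \<open>dim Hom(M, N) - dim Ext\<^sup>1(M, N)\<close> for all \<open>M\<close> and \<open>N\<close> with these dimension vectors.\<close>

definition euler_form :: "int \<Rightarrow> (int \<Rightarrow> nat) \<Rightarrow> (int \<Rightarrow> nat) \<Rightarrow> int"
  where "euler_form r d e =
    (THE c. \<forall>(M :: nat rep) (N :: nat rep). nilpotent_rep r M \<and> nilpotent_rep r N \<and>
        dimv r M = d \<and> dimv r N = e \<longrightarrow>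
        c = int (hom_dim r M N) - int (ext_dim r M N))"

section \<open>Quiver Grassmannians and the Euler characteristic\<close>

text \<open>The Grassmannian of \<open>n\<close>-dimensional subspaces of \<open>V\<close>, with its classical (analytic) topology:
  the quotient topology for the map sending an \<open>n\<close>-frame to its span. A frame is a function on
  \<open>nat\<close> that is zero from \<open>n\<close> on; frames carry the topology of \<open>V\<^sup>n\<close>.\<close>

definition frames :: "nat \<Rightarrow> 'b cvec set \<Rightarrow> (nat \<Rightarrow> 'b cvec) set"
  where "frames n V =
    {B. (\<forall>t<n. B t \<in> V) \<and> inj_on B {..<n} \<and> cvec.independent (B ` {..<n}) \<and> (\<forall>t\<ge>n. B t = 0)}"

definition grass :: "nat \<Rightarrow> 'b cvec set \<Rightarrow> 'b cvec set topology"
  where "grass n V =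
    topology (\<lambda>G. G \<subseteq> {W. cvec.subspace W \<and> W \<subseteq> V \<and> cvec.dim W = n} \<and>
       openin (top_of_set (frames n V)) {B \<in> frames n V. cvec.span (B ` {..<n}) \<in> G})"

definition quiver_grass :: "int \<Rightarrow> (int \<Rightarrow> nat) \<Rightarrow> 'b rep \<Rightarrow> (int \<Rightarrow> 'b cvec set) topology"
  where "quiver_grass r e M =
    subtopology (product_topology (\<lambda>v. grass (e v) (Sp M v)) {1..r}) {U. submodule r M U}"

text \<open>The rank of an abelian group, and the Euler characteristic as the alternating sum of the
  ranks of the integral singular homology groups (to be used when these are finite and almost all
  of them zero, as is the case for complex projective varieties).\<close>

definition zindep :: "('a, 'm) monoid_scheme \<Rightarrow> 'a set \<Rightarrow> bool"
  where "zindep G S \<longleftrightarrow>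
    (\<forall>c :: 'a \<Rightarrow> int. finprod G (\<lambda>a. a [^]\<^bsub>G\<^esub> c a) S = \<one>\<^bsub>G\<^esub> \<longrightarrow> (\<forall>a\<in>S. c a = 0))"

definition group_rank :: "('a, 'm) monoid_scheme \<Rightarrow> nat"
  where "group_rank G = Sup {card S | S. finite S \<and> S \<subseteq> carrier G \<and> zindep G S}"

definition euler_char :: "'a topology \<Rightarrow> int"
  where "euler_char T =
    (\<Sum>p | group_rank (homology_group (int p) T) \<noteq> 0.
       (-1) ^ p * int (group_rank (homology_group (int p) T)))"

section \<open>The Caldero-Chapoton map\<close>

text \<open>Laurent polynomials over the integers in variables indexed by \<open>int\<close>: the monoid ring of the
  finitely supported exponent vectors. Only the variables with index in \<open>{1..r}\<close> are used.\<close>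

type_synonym laurent = "(int \<Rightarrow>\<^sub>0 int) \<Rightarrow>\<^sub>0 int"

definition xpow :: "int \<Rightarrow> int \<Rightarrow> laurent"
  where "xpow i n = Poly_Mapping.single (Poly_Mapping.single i n) 1"

definition CC :: "int \<Rightarrow> 'b rep \<Rightarrow> laurent"
  where "CC r M =
    (\<Sum>e | \<forall>v. e v \<le> dimv r M v.
       of_int (euler_char (quiver_grass r e M)) *
       (\<Prod>i\<in>{1..r}. xpow i
          (- euler_form r e (dimv r (simple_rep r i))
           - euler_form r (dimv r (simple_rep r i)) (\<lambda>v. dimv r M v - e v))))"

definition XE :: "int \<Rightarrow> int \<Rightarrow> int \<Rightarrow> laurent"
  where "XE r i n = CC r (indec r i n)"

definition no_ext :: "int \<Rightarrow> 'b rep \<Rightarrow> 'c rep \<Rightarrow> bool"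
  where "no_ext r M N \<longleftrightarrow> ext_dim r M N = 0 \<and> ext_dim r N M = 0"

end

theory Submission
  imports Defs
begin

text \<open>The module \<open>E\<^sub>i[n]\<close> is uniserial: it has a basis \<open>b\<^sub>0, \<dots>, b\<^sub>n\<^sub>-\<^sub>1\<close>, with \<open>b\<^sub>t\<close> at the vertex
  \<open>i + t\<close>, on which the arrows act as \<open>b\<^sub>t \<mapsto> b\<^sub>t\<^sub>-\<^sub>1 \<mapsto> \<dots> \<mapsto> b\<^sub>0 \<mapsto> 0\<close>, and its only submodules are the spans
  of the initial segments of the basis (\<open>uniserial_indec\<close>, \<open>submodule_cases\<close>). All its quiver
  Grassmannians are therefore empty or points, and its character is (\<open>CC_uniserial\<close>, \<open>XE_eq\<close>)
  \<open>x\<^sub>i\<^sub>-\<^sub>1 x\<^sub>i\<^sub>+\<^sub>n\<close> times the sum of \<open>1 / (x\<^sub>u\<^sub>-\<^sub>1 x\<^sub>u)\<close> over \<open>i \<le> u \<le> i + n\<close>. Up to a monomial this is the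
  difference of two values of one function, a primitive of \<open>u \<mapsto> 1 / (x\<^sub>u\<^sub>-\<^sub>1 x\<^sub>u)\<close>, and the four product
  formulas are the identity \<open>(B - A) (D - C) = (D - A) (B - C) + (C - A) (D - B)\<close> (\<open>XE_ptolemy\<close>): only
  the socle of one factor has to be moved by a multiple of \<open>r\<close>, which does not change the module,
  to bring the two intervals of integers into a position where they cross.

  The families of maps that describe extensions of uniserial modules have a basis of matrix units.
  The coboundary of a unit is a difference of two neighbouring units of a diagonal, or a single unit
  at an end of a diagonal; so \<open>Ext\<^sup>1\<close> is spanned by the diagonals with no such end
  (\<open>ext_dim_eq_0_iff\<close>), and the existence of one is a congruence modulo \<open>r\<close> that translates into the
  inequalities of the theorem.

  If there are no extensions, then \<open>k < r\<close>, so that each vertex occurs at most once as a composition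
  factor of \<open>E\<^sub>i[k]\<close>. A submodule of \<open>E\<^sub>i[k] \<oplus> E\<^sub>j[n]\<close> is then spanned by its intersections
  with the two summands and by a diagonal, of some slope, in two isomorphic uniserial subquotients of
  the summands (\<open>submodule_dsum_cases\<close>). Consequently the quiver Grassmannian of a dimension vector \<open>e\<close> is empty,
  a point or a projective line, the latter being a sphere (\<open>cells_homeomorphic_sphere\<close>). Its Euler
  characteristic 0, 1 or 2 is the number of pairs of submodules of the summands whose dimension
  vectors add up to \<open>e\<close> (\<open>euler_char_dsum\<close>); the two pairs in the last case are the two fixed points
  of the action of the non-zero scalars on the slope. As the exponents are additive, the character
  of the direct sum is the product of the characters (\<open>CC_dsum\<close>).

  Two facts connect this with the definitions: the Euler form is given by the usual formula in
  the dimension vectors, by rank and nullity (\<open>euler_form_eq\<close>), and every nilpotent representation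
  with socle \<open>E\<^sub>i\<close> has a basis as above, namely a longest chain \<open>b\<^sub>0, b\<^sub>1, \<dots>\<close> in which each vector
  is mapped to the preceding one (\<open>ex_uniserial\<close>).\<close>

section \<open>Euler characteristics\<close>

lemma group_rank_trivial:
  assumes "trivial_group G"
  shows "group_rank G = 0"
proof -
  have car: "carrier G = {\<one>\<^bsub>G\<^esub>}" and G: "group G"
    using assms by (auto simp: trivial_group_def)
  interpret group G by (rule G)
  interpret comm_group G
    by (rule group_comm_groupI) (auto simp: car)
  have "S = {}" if S: "S \<subseteq> carrier G" "zindep G S" for S
  proof -
    have "finprod G (\<lambda>a. a [^]\<^bsub>G\<^esub> (1::int)) S = \<one>\<^bsub>G\<^esub>"
      using S(1) car by (intro finprod_one_eqI) auto
    then show ?thesis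
      using S(2)[unfolded zindep_def, rule_format, of "\<lambda>_. 1"] by auto
  qed
  moreover have "zindep G {}"
    by (simp add: zindep_def)
  ultimately have "{card S | S. finite S \<and> S \<subseteq> carrier G \<and> zindep G S} = {0}"
    by force
  then show ?thesis
    by (simp add: group_rank_def)
qed

text \<open>Two elements of an infinite cyclic group always satisfy a non-trivial linear relation.\<close>

lemma group_rank_infinite_cyclic:
  assumes G: "comm_group G" and iso: "G \<cong> integer_group"
  shows "group_rank G = 1"
proof -
  interpret comm_group G by (rule G)
  obtain h where h: "h \<in> iso G integer_group"
    using iso by (auto simp: is_iso_def)
  then have hom: "h \<in> hom G integer_group" and inj: "inj_on h (carrier G)"
    and surj: "h ` carrier G = UNIV"
    by (auto simp: iso_def bij_betw_def)
  interpret h: group_hom G integer_group h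
    by (simp add: group_hom_def group_hom_axioms_def hom)
  have hpow: "h (a [^]\<^bsub>G\<^esub> (n::int)) = n * h a" if "a \<in> carrier G" for a n
    using that h.hom_int_pow[of a n] by (simp add: group_int_pow_integer_group)
  have le: "card S \<le> 1" if S: "finite S" "S \<subseteq> carrier G" "zindep G S" for S
  proof (rule ccontr)
    assume "\<not> card S \<le> 1"
    then obtain a b where ab: "a \<in> S" "b \<in> S" "a \<noteq> b"
      using card_le_Suc0_iff_eq[OF S(1)] by auto
    \<comment> \<open>the relation \<open>h b \<cdot> a - h a \<cdot> b = 0\<close>\<close>
    define c where "c = (\<lambda>x. if x = a then h b else if x = b then - h a else (0::int))"
    have car: "a \<in> carrier G" "b \<in> carrier G"
      using S ab by auto
    have "finprod G (\<lambda>x. x [^]\<^bsub>G\<^esub> c x) S = finprod G (\<lambda>x. x [^]\<^bsub>G\<^esub> c x) {a, b}"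
      using S ab by (intro finprod_mono_neutral_cong_right) (auto simp: c_def)
    also have "\<dots> = a [^]\<^bsub>G\<^esub> h b \<otimes>\<^bsub>G\<^esub> b [^]\<^bsub>G\<^esub> (- h a)"
      using ab car by (simp add: c_def)
    also have "\<dots> = \<one>\<^bsub>G\<^esub>"
    proof (rule inj_onD[OF inj])
      have "h (a [^]\<^bsub>G\<^esub> h b \<otimes>\<^bsub>G\<^esub> b [^]\<^bsub>G\<^esub> (- h a)) = h b * h a + (- h a) * h b"
        using car hpow[of a "h b"] hpow[of b "- h a"] by (subst h.hom_mult) auto
      then show "h (a [^]\<^bsub>G\<^esub> h b \<otimes>\<^bsub>G\<^esub> b [^]\<^bsub>G\<^esub> (- h a)) = h \<one>\<^bsub>G\<^esub>"
        using h.hom_one by simp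
    qed (use car in auto)
    finally have "\<forall>x\<in>S. c x = 0"
      using S(3) by (simp add: zindep_def)
    then have "h b = 0" "h a = 0"
      using ab by (auto simp: c_def split: if_splits)
    then show False
      using inj_onD[OF inj, of a b] car ab by auto
  qed
  obtain g where g: "g \<in> carrier G" "h g = 1"
    using surj by (metis UNIV_I imageE)
  have "zindep G {g}"
    unfolding zindep_def
  proof (intro allI impI ballI)
    fix c :: "'a \<Rightarrow> int" and a
    assume "finprod G (\<lambda>a. a [^]\<^bsub>G\<^esub> c a) {g} = \<one>\<^bsub>G\<^esub>" "a \<in> {g}"
    then have "g [^]\<^bsub>G\<^esub> c g = \<one>\<^bsub>G\<^esub>" "a = g"
      using g by simp_all
    then show "c a = 0"
      using hpow[of g "c g"] g h.hom_one by simp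
  qed
  then have "1 \<in> {card S | S. finite S \<and> S \<subseteq> carrier G \<and> zindep G S}"
    using g by (intro CollectI exI[of _ "{g}"]) auto
  moreover have "x \<le> 1" if "x \<in> {card S | S. finite S \<and> S \<subseteq> carrier G \<and> zindep G S}" for x
    using that le by auto
  ultimately show ?thesis
    unfolding group_rank_def by (intro cSup_eq_maximum) auto
qed

lemma group_rank_zeroth_homology:
  assumes "path_connected_space X" "topspace X \<noteq> {}"
  shows "group_rank (homology_group 0 X) = 1"
  using assms
  by (intro group_rank_infinite_cyclic isomorphic_integer_zeroth_homology_group)
     (auto simp: abelian_homology_group)

lemma euler_char_empty:
  assumes "topspace X = {}"
  shows "euler_char X = 0"
  using assms by (simp add: euler_char_def group_rank_trivial trivial_homology_group_empty)

lemma euler_char_point: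
  assumes "topspace X = {a}"
  shows "euler_char X = 1"
proof -
  have contr: "contractible_space X"
    using contractible_space_subtopology_singleton[of X a] subtopology_topspace[of X]
    unfolding assms by metis
  have rk: "group_rank (homology_group (int p) X) = (if p = 0 then 1 else 0)" for p
  proof (cases "p = 0")
    case True
    then show ?thesis
      using group_rank_zeroth_homology[of X] contr assms
      by (simp add: contractible_imp_path_connected_space)
  next
    case False
    then have "trivial_group (homology_group (int p) X)"
      using trivial_reduced_homology_group_contractible_space[OF contr, of "int p"]
      by (simp add: un_reduced_homology_group)
    then show ?thesis
      using False by (simp add: group_rank_trivial)
  qed
  have "{p. group_rank (homology_group (int p) X) \<noteq> 0} = {0}"
    by (auto simp: rk)
  then show ?thesis
    using rk[of 0] by (simp add: euler_char_def)
qed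

text \<open>The sphere is the union of two contractible hemispheres that meet in the equator. This
  settles the homology in degree zero, where reduced and unreduced homology differ.\<close>

lemma path_connected_space_sphere: "path_connected_space (nsphere 2)"
proof -
  let ?U = "topspace (nsphere 2) \<inter> {x. x 2 \<ge> 0}"
  let ?L = "topspace (nsphere 2) \<inter> {x. x 2 \<le> 0}"
  have "path_connected_space (subtopology (nsphere 2) {x. x 2 \<ge> 0})"
       "path_connected_space (subtopology (nsphere 2) {x. x 2 \<le> 0})"
    using contractible_space_upper_hemisphere[of 2 2] contractible_space_lower_hemisphere[of 2 2]
    by (simp_all only: contractible_imp_path_connected_space)
  then have "path_connectedin (nsphere 2) ?U" "path_connectedin (nsphere 2) ?L"
    by (auto simp: path_connectedin_def subtopology_restrict)
  moreover have "(\<lambda>i. if i = 0 then 1 else 0) \<in> ?U \<inter> ?L"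
    using in_topspace_nsphere[of 2] by auto
  ultimately have "path_connectedin (nsphere 2) (?U \<union> ?L)"
    by (intro path_connectedin_Un) blast+
  moreover have "?U \<union> ?L = topspace (nsphere 2)"
    by auto
  ultimately show ?thesis
    by (simp add: path_connectedin_topspace)
qed

lemma euler_char_sphere:
  assumes "nsphere 2 homeomorphic_space X"
  shows "euler_char X = 2"
proof -
  have iso: "homology_group p X \<cong> homology_group p (nsphere 2)" for p
    by (rule homeomorphic_space_imp_isomorphic_homology_groups)
       (use assms homeomorphic_space_sym in blast)
  have rk: "group_rank (homology_group (int p) X) = (if p = 0 \<or> p = 2 then 1 else 0)" for p
  proof -
    consider "p = 0" | "p = 2" | "p \<noteq> 0" "p \<noteq> 2" by blast
    then show ?thesis
    proof cases
      case 1
      have "homology_group 0 (nsphere 2) \<cong> integer_group"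
        by (rule isomorphic_integer_zeroth_homology_group[OF path_connected_space_sphere])
           (simp add: nonempty_nsphere)
      then have "homology_group 0 X \<cong> integer_group"
        using iso iso_trans by blast
      then show ?thesis
        using 1 group_rank_infinite_cyclic[of "homology_group 0 X"]
        by (simp add: abelian_homology_group)
    next
      case 2
      have "homology_group 2 X \<cong> integer_group"
        using iso[of 2] reduced_homology_group_nsphere(1)[of 2] iso_trans
        by (auto simp: un_reduced_homology_group)
      then show ?thesis
        using 2 group_rank_infinite_cyclic[of "homology_group 2 X"]
        by (simp add: abelian_homology_group)
    next
      case 3
      have "trivial_group (homology_group (int p) (nsphere 2))"
        using 3 reduced_homology_group_nsphere(2)[of "int p" 2]
        by (simp add: un_reduced_homology_group)
      then have "trivial_group (homology_group (int p) X)"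
        using isomorphic_group_triviality[OF iso[of "int p"]] by simp
      then show ?thesis
        using 3 by (simp add: group_rank_trivial)
    qed
  qed
  have "{p. group_rank (homology_group (int p) X) \<noteq> 0} = {0, 2}"
    by (auto simp: rk)
  then show ?thesis
    using rk[of 0] rk[of 2] by (simp add: euler_char_def)
qed

section \<open>Frames and Grassmannians\<close>

text \<open>Linear independence of an indexed family, which also expresses that the family is injective.\<close>

definition (in vector_space) indep_family :: "'i set \<Rightarrow> ('i \<Rightarrow> 'b) \<Rightarrow> bool"
  where "indep_family J g \<longleftrightarrow> (\<forall>c. (\<Sum>i\<in>J. c i *s g i) = 0 \<longrightarrow> (\<forall>i\<in>J. c i = 0))"

lemma (in vector_space) indep_family_iff:
  assumes "finite J"
  shows "indep_family J g \<longleftrightarrow> inj_on g J \<and> independent (g ` J)"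
proof
  assume L: "indep_family J g"
  have inj: "inj_on g J"
  proof (rule inj_onI, rule ccontr)
    fix x y assume xy: "x \<in> J" "y \<in> J" "g x = g y" "x \<noteq> y"
    define c :: "_ \<Rightarrow> 'a" where "c = (\<lambda>i. if i = x then 1 else if i = y then - 1 else 0)"
    have "(\<Sum>i\<in>J. c i *s g i) = (\<Sum>i\<in>{x, y}. c i *s g i)"
      using xy assms by (intro sum.mono_neutral_right) (auto simp: c_def)
    also have "\<dots> = 0"
      using xy by (simp add: c_def)
    finally have "c x = 0"
      using L xy by (simp add: indep_family_def)
    then show False
      by (simp add: c_def)
  qed
  have "independent (g ` J)"
  proof (rule independent_if_scalars_zero)
    show "finite (g ` J)" using assms by simp
    fix f x assume f: "(\<Sum>x\<in>g ` J. f x *s x) = 0" and x: "x \<in> g ` J"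
    have "(\<Sum>i\<in>J. (f \<circ> g) i *s g i) = 0"
      using f by (simp add: sum.reindex[OF inj])
    then have "\<forall>i\<in>J. (f \<circ> g) i = 0"
      using L unfolding indep_family_def by blast
    then show "f x = 0"
      using x by auto
  qed
  with inj show "inj_on g J \<and> independent (g ` J)" by simp
next
  assume R: "inj_on g J \<and> independent (g ` J)"
  show "indep_family J g"
    unfolding indep_family_def
  proof (intro allI impI ballI)
    fix c i assume c: "(\<Sum>i\<in>J. c i *s g i) = 0" and i: "i \<in> J"
    have "(\<Sum>x\<in>g ` J. c (the_inv_into J g x) *s x) = 0"
      using c R by (simp add: sum.reindex the_inv_into_f_f)
    then have "c (the_inv_into J g (g i)) = 0"
      using independentD[of "g ` J" "g ` J" "\<lambda>x. c (the_inv_into J g x)" "g i"] assms R i by auto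
    then show "c i = 0"
      using R i by (simp add: the_inv_into_f_f)
  qed
qed

lemma (in vector_space) sum_in_span_family: "(\<Sum>i\<in>J. c i *s g i) \<in> span (g ` J)"
  by (intro span_sum span_scale span_base imageI)

lemma (in vector_space) span_family:
  assumes "finite J"
  shows "span (g ` J) = range (\<lambda>c. \<Sum>i\<in>J. c i *s g i)"
proof (intro equalityI subsetI)
  fix x assume "x \<in> span (g ` J)"
  then show "x \<in> range (\<lambda>c. \<Sum>i\<in>J. c i *s g i)"
  proof (induction rule: span_induct_alt)
    case base
    have "0 = (\<Sum>i\<in>J. 0 *s g i)" by simp
    then show ?case by (rule range_eqI[of _ _ "\<lambda>_. 0"])
  next
    case (step a y z)
    obtain j where j: "j \<in> J" "y = g j" using step.hyps(1) by blast
    obtain c where c: "z = (\<Sum>i\<in>J. c i *s g i)" using step.IH by blast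
    have "a *s y + z = (\<Sum>i\<in>J. (if i = j then a *s g i else 0) + c i *s g i)"
      using j assms by (simp add: sum.distrib c)
    also have "\<dots> = (\<Sum>i\<in>J. ((if i = j then a else 0) + c i) *s g i)"
      by (intro sum.cong) (auto simp: scale_left_distrib)
    finally show ?case by (rule range_eqI[of _ _ "\<lambda>i. (if i = j then a else 0) + c i"])
  qed
next
  fix x assume "x \<in> range (\<lambda>c. \<Sum>i\<in>J. c i *s g i)"
  then obtain c where "x = (\<Sum>i\<in>J. c i *s g i)" by auto
  then show "x \<in> span (g ` J)" by (simp add: sum_in_span_family)
qed

lemma (in vector_space) dim_span_family:
  assumes "finite J" "indep_family J g"
  shows "dim (span (g ` J)) = card J"
  using dim_eq_card_independent[of "g ` J"] card_image[of g J] indep_family_iff[of J g] assms by simp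

lemma (in vector_space) obtain_family_basis:
  assumes "subspace W" "W \<subseteq> span A" "finite A"
  obtains g :: "nat \<Rightarrow> 'b" where "indep_family {..<dim W} g" "span (g ` {..<dim W}) = W"
proof -
  obtain B where B: "B \<subseteq> W" "independent B" "W \<subseteq> span B" "card B = dim W"
    using basis_exists by blast
  have fin: "finite B"
    using independent_span_bound[OF assms(3) B(2)] B(1) assms(2) by auto
  obtain g where g: "bij_betw g {..<dim W} B"
    using ex_bij_betw_nat_finite[OF fin] B(4) by (auto simp: atLeast0LessThan)
  then have im: "g ` {..<dim W} = B" by (simp add: bij_betw_def)
  show thesis
  proof
    show "indep_family {..<dim W} g"
      using g B(2) by (simp add: indep_family_iff bij_betw_def)
    show "span (g ` {..<dim W}) = W"
      using im B span_minimal[OF B(1) assms(1)] by auto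
  qed
qed

lemma sum_fun_apply: "(\<Sum>i\<in>J. f i) x = (\<Sum>i\<in>J. f i x)"
  for f :: "'i \<Rightarrow> 'x \<Rightarrow> 'c::comm_monoid_add"
  by (induction J rule: infinite_finite_induct) auto

lemma frames_iff:
  "B \<in> frames n V \<longleftrightarrow> (\<forall>t<n. B t \<in> V) \<and> cvec.indep_family {..<n} B \<and> (\<forall>t\<ge>n. B t = 0)"
  unfolding frames_def using cvec.indep_family_iff[of "{..<n}" B] by blast

lemma openin_grass:
  "openin (grass n V) G \<longleftrightarrow>
     G \<subseteq> {W. cvec.subspace W \<and> W \<subseteq> V \<and> cvec.dim W = n} \<and>
     openin (top_of_set (frames n V)) {B \<in> frames n V. cvec.span (B ` {..<n}) \<in> G}"
proof -
  let ?P = "\<lambda>G. G \<subseteq> {W. cvec.subspace W \<and> W \<subseteq> V \<and> cvec.dim W = n} \<and>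
     openin (top_of_set (frames n V)) {B \<in> frames n V. cvec.span (B ` {..<n}) \<in> G}"
  have "istopology ?P"
    unfolding istopology_def
  proof (rule conjI; intro allI impI)
    fix G H assume GH: "?P G" "?P H"
    have "{B \<in> frames n V. cvec.span (B ` {..<n}) \<in> G \<inter> H} =
      {B \<in> frames n V. cvec.span (B ` {..<n}) \<in> G} \<inter> {B \<in> frames n V. cvec.span (B ` {..<n}) \<in> H}"
      by auto
    with GH show "?P (G \<inter> H)"
      by (simp add: openin_Int le_infI1)
  next
    fix K assume K: "\<forall>G\<in>K. ?P G"
    have "{B \<in> frames n V. cvec.span (B ` {..<n}) \<in> \<Union>K} =
      \<Union>((\<lambda>G. {B \<in> frames n V. cvec.span (B ` {..<n}) \<in> G}) ` K)"
      by auto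
    moreover have "\<Union>K \<subseteq> {W. cvec.subspace W \<and> W \<subseteq> V \<and> cvec.dim W = n}"
      using K by blast
    ultimately show "?P (\<Union>K)"
      using K by auto
  qed
  then show ?thesis
    by (simp add: grass_def topology_inverse')
qed

lemma frame_span:
  assumes "cvec.subspace V" "B \<in> frames n V"
  shows "cvec.subspace (cvec.span (B ` {..<n}))" "cvec.span (B ` {..<n}) \<subseteq> V"
    "cvec.dim (cvec.span (B ` {..<n})) = n"
proof -
  have B: "B ` {..<n} \<subseteq> V" "cvec.indep_family {..<n} B"
    using assms(2) by (auto simp: frames_iff)
  show "cvec.subspace (cvec.span (B ` {..<n}))"
    by (rule cvec.subspace_span)
  show "cvec.span (B ` {..<n}) \<subseteq> V"
    by (rule cvec.span_minimal[OF B(1) assms(1)])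
  show "cvec.dim (cvec.span (B ` {..<n})) = n"
    using cvec.dim_span_family[OF _ B(2)] by simp
qed

lemma topspace_grass:
  assumes "cvec.subspace V"
  shows "topspace (grass n V) = {W. cvec.subspace W \<and> W \<subseteq> V \<and> cvec.dim W = n}"
proof -
  have "openin (grass n V) {W. cvec.subspace W \<and> W \<subseteq> V \<and> cvec.dim W = n}"
    unfolding openin_grass
  proof
    have "{B \<in> frames n V. cvec.span (B ` {..<n}) \<in> {W. cvec.subspace W \<and> W \<subseteq> V \<and> cvec.dim W = n}}
      = frames n V"
      using frame_span[OF assms] by blast
    then show "openin (top_of_set (frames n V))
      {B \<in> frames n V. cvec.span (B ` {..<n}) \<in> {W. cvec.subspace W \<and> W \<subseteq> V \<and> cvec.dim W = n}}"
      by (metis openin_subtopology_self)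
  qed simp
  then show ?thesis
    unfolding topspace_def openin_grass by blast
qed

lemma ex_frame:
  assumes "cvec.subspace W" "W \<subseteq> V" "cvec.dim W = n" "V \<subseteq> cvec.span A" "finite A"
  obtains B where "B \<in> frames n V" "cvec.span (B ` {..<n}) = W"
proof -
  obtain g :: "nat \<Rightarrow> 'a cvec" where g: "cvec.indep_family {..<n} g" "cvec.span (g ` {..<n}) = W"
    using cvec.obtain_family_basis[of W A] assms by auto
  define B where "B = (\<lambda>t. if t < n then g t else 0)"
  have im: "B ` {..<n} = g ` {..<n}"
    by (auto simp: B_def)
  have "B \<in> frames n V"
    unfolding frames_iff
  proof (intro conjI allI impI)
    show "B t \<in> V" if "t < n" for t
      using that g(2) assms(2) cvec.span_base[of "g t" "g ` {..<n}"] by (auto simp: B_def)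
    show "cvec.indep_family {..<n} B"
      using g(1) by (simp add: cvec.indep_family_def B_def)
  qed (simp add: B_def)
  then show thesis
    using that im g(2) by simp
qed

lemma continuous_map_into_function_space:
  fixes f :: "'x \<Rightarrow> 'i \<Rightarrow> 'c::topological_space"
  shows "continuous_map X euclidean f \<longleftrightarrow> (\<forall>i. continuous_map X euclidean (\<lambda>x. f x i))"
  by (simp add: continuous_map_componentwise_UNIV flip: euclidean_product_topology)

text \<open>The quotient topology makes maps out of a Grassmannian easy, while here a map into it is
  wanted: one lifts it to the frames, which is possible as soon as there is a continuous choice
  of a basis.\<close>

lemma continuous_map_into_grass:
  assumes J: "finite J" "card J = n" and V: "cvec.subspace V"
    and gV: "\<And>x i. x \<in> topspace X \<Longrightarrow> i \<in> J \<Longrightarrow> g x i \<in> V"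
    and ind: "\<And>x. x \<in> topspace X \<Longrightarrow> cvec.indep_family J (g x)"
    and cont: "\<And>i b. i \<in> J \<Longrightarrow> continuous_map X euclidean (\<lambda>x. g x i b)"
  shows "continuous_map X (grass n V) (\<lambda>x. cvec.span (g x ` J))"
proof -
  obtain h where h: "bij_betw h {..<n} J"
    using ex_bij_betw_nat_finite[OF J(1)] J(2) by (auto simp: atLeast0LessThan)
  define F where "F = (\<lambda>x t. if t < n then g x (h t) else 0)"
  have hJ: "h t \<in> J" if "t < n" for t
    using that h by (auto simp: bij_betw_def)
  have im: "F x ` {..<n} = g x ` J" for x
  proof -
    have "F x ` {..<n} = g x ` h ` {..<n}" by (force simp: F_def)
    then show ?thesis using h by (simp add: bij_betw_def)
  qed
  have F: "F x \<in> frames n V" if "x \<in> topspace X" for x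
    unfolding frames_iff
  proof (intro conjI allI impI)
    show "F x t \<in> V" if "t < n" for t
      using that hJ gV \<open>x \<in> topspace X\<close> by (auto simp: F_def)
    have "inj_on (g x) J" and "cvec.independent (g x ` J)"
      using ind[OF \<open>x \<in> topspace X\<close>] J(1) by (auto simp: cvec.indep_family_iff)
    moreover have "inj_on (g x \<circ> h) {..<n}"
      using h calculation(1) by (intro comp_inj_on) (auto simp: bij_betw_def)
    then have "inj_on (F x) {..<n}"
      by (simp add: F_def inj_on_def)
    ultimately show "cvec.indep_family {..<n} (F x)"
      by (simp add: cvec.indep_family_iff im)
  qed (simp add: F_def)
  have "continuous_map X euclidean F"
    unfolding continuous_map_into_function_space[of X F]
  proof
    fix t
    show "continuous_map X euclidean (\<lambda>x. F x t)"
      unfolding continuous_map_into_function_space[of X "\<lambda>x. F x t"]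
      using cont hJ by (cases "t < n") (auto simp: F_def)
  qed
  then have cF: "continuous_map X (top_of_set (frames n V)) F"
    using F by (auto simp: continuous_map_in_subtopology)
  show ?thesis
    unfolding continuous_map_def
  proof (rule conjI; (intro allI impI)?)
    show "(\<lambda>x. cvec.span (g x ` J)) \<in> topspace X \<rightarrow> topspace (grass n V)"
      using frame_span[OF V F] by (auto simp: topspace_grass[OF V] im)
    fix G assume G: "openin (grass n V) G"
    have "openin X {x \<in> topspace X. F x \<in> {B \<in> frames n V. cvec.span (B ` {..<n}) \<in> G}}"
      using G by (intro openin_continuous_map_preimage[OF cF]) (auto simp: openin_grass)
    moreover have "{x \<in> topspace X. F x \<in> {B \<in> frames n V. cvec.span (B ` {..<n}) \<in> G}} =
        {x \<in> topspace X. cvec.span (g x ` J) \<in> G}"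
      using F by (auto simp: im)
    ultimately show "openin X {x \<in> topspace X. cvec.span (g x ` J) \<in> G}"
      by simp
  qed
qed

lemma indep_family_unique:
  assumes "cvec.indep_family J g" "finite J"
    and "(\<Sum>i\<in>J. cscale (c i) (g i)) = (\<Sum>i\<in>J. cscale (d i) (g i))" "i \<in> J"
  shows "c i = d i"
proof -
  have "(\<Sum>i\<in>J. cscale (c i - d i) (g i)) = 0"
    using assms(3) by (simp add: cvec.scale_left_diff_distrib sum_subtractf)
  then have "c i - d i = 0"
    using assms(1,4) unfolding cvec.indep_family_def
    by (elim allE[of _ "\<lambda>i. c i - d i"]) blast
  then show ?thesis by simp
qed

text \<open>The quotient map from frames to subspaces is open: two frames with the same span differ by
  an invertible matrix, and a fixed matrix acts on all frames by a homeomorphism that preserves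
  the spans.\<close>

lemma openin_grass_spans:
  assumes V: "cvec.subspace V" and O: "openin (top_of_set (frames n V)) O'"
  shows "openin (grass n V) ((\<lambda>B. cvec.span (B ` {..<n})) ` O')"
  unfolding openin_grass
proof
  let ?q = "\<lambda>B :: nat \<Rightarrow> 'a cvec. cvec.span (B ` {..<n})"
  have sub: "O' \<subseteq> frames n V"
    using openin_subset[OF O] by simp
  show "?q ` O' \<subseteq> {W. cvec.subspace W \<and> W \<subseteq> V \<and> cvec.dim W = n}"
    using frame_span[OF V] sub by blast
  have "\<exists>T. openin (top_of_set (frames n V)) T \<and> D0 \<in> T \<and> T \<subseteq> {B \<in> frames n V. ?q B \<in> ?q ` O'}"
    if D0: "D0 \<in> frames n V" "?q D0 = ?q B" and B: "B \<in> O'" for D0 B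
  proof -
    have BF: "B \<in> frames n V" using B sub by auto
    \<comment> \<open>\<open>c\<close> and \<open>c'\<close> are the mutually inverse matrices relating the two frames\<close>
    have "\<forall>t<n. \<exists>c. B t = (\<Sum>s<n. cscale (c s) (D0 s))"
    proof (intro allI impI)
      fix t assume "t < n"
      then have "B t \<in> ?q D0" unfolding D0(2) by (auto intro: cvec.span_base)
      then show "\<exists>c. B t = (\<Sum>s<n. cscale (c s) (D0 s))"
        by (auto simp: cvec.span_family)
    qed
    then obtain c where c: "\<And>t. t < n \<Longrightarrow> B t = (\<Sum>s<n. cscale (c t s) (D0 s))"
      by metis
    have "\<forall>t<n. \<exists>c. D0 t = (\<Sum>s<n. cscale (c s) (B s))"
    proof (intro allI impI)
      fix t assume "t < n"
      then have "D0 t \<in> ?q B" unfolding D0(2)[symmetric] by (auto intro: cvec.span_base)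
      then show "\<exists>c. D0 t = (\<Sum>s<n. cscale (c s) (B s))"
        by (auto simp: cvec.span_family)
    qed
    then obtain c' where c': "\<And>t. t < n \<Longrightarrow> D0 t = (\<Sum>s<n. cscale (c' t s) (B s))"
      by metis
    have swap: "(\<Sum>s<n. cscale (a s) (\<Sum>u<n. cscale (m s u) (E u))) =
        (\<Sum>u<n. cscale (\<Sum>s<n. a s * m s u) (E u))" for a m and E :: "nat \<Rightarrow> 'a cvec"
    proof -
      have "(\<Sum>s<n. cscale (a s) (\<Sum>u<n. cscale (m s u) (E u))) =
          (\<Sum>s<n. \<Sum>u<n. cscale (a s * m s u) (E u))"
        by (simp add: cvec.scale_sum_right)
      also have "\<dots> = (\<Sum>u<n. \<Sum>s<n. cscale (a s * m s u) (E u))"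
        by (rule sum.swap)
      finally show ?thesis by (simp add: cvec.scale_sum_left)
    qed
    have delta: "E t = (\<Sum>s<n. cscale (if s = t then 1 else 0) (E s))" if "t < n" for t and E :: "nat \<Rightarrow> 'a cvec"
      using that by (simp add: if_distrib[of "\<lambda>x. cscale x _"] cong: if_cong)
    have c'c: "(\<Sum>s<n. c' t s * c s u) = (if u = t then 1 else 0)" if "t < n" "u < n" for t u
    proof (rule indep_family_unique[of "{..<n}" D0 "\<lambda>u. \<Sum>s<n. c' t s * c s u" "\<lambda>u. if u = t then 1 else 0"])
      show "cvec.indep_family {..<n} D0" using D0 by (simp add: frames_iff)
      show "(\<Sum>u<n. cscale (\<Sum>s<n. c' t s * c s u) (D0 u)) = (\<Sum>s<n. cscale (if s = t then 1 else 0) (D0 s))"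
        using c'[OF that(1)] c delta[OF that(1), of D0] by (simp flip: swap)
    qed (use that in auto)
    have cc': "(\<Sum>s<n. c t s * c' s u) = (if u = t then 1 else 0)" if "t < n" "u < n" for t u
    proof (rule indep_family_unique[of "{..<n}" B "\<lambda>u. \<Sum>s<n. c t s * c' s u" "\<lambda>u. if u = t then 1 else 0"])
      show "cvec.indep_family {..<n} B" using BF by (simp add: frames_iff)
      show "(\<Sum>u<n. cscale (\<Sum>s<n. c t s * c' s u) (B u)) = (\<Sum>s<n. cscale (if s = t then 1 else 0) (B s))"
        using c[OF that(1)] c' delta[OF that(1), of B] by (simp flip: swap)
    qed (use that in auto)
    define Phi where "Phi = (\<lambda>(D :: nat \<Rightarrow> 'a cvec) t. if t < n then \<Sum>s<n. cscale (c t s) (D s) else 0)"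
    have Phi_inv: "D t = (\<Sum>s<n. cscale (c' t s) (Phi D s))" if "t < n" for D t
    proof -
      have "(\<Sum>s<n. cscale (c' t s) (Phi D s)) = (\<Sum>s<n. cscale (c' t s) (\<Sum>u<n. cscale (c s u) (D u)))"
        by (simp add: Phi_def)
      also have "\<dots> = (\<Sum>u<n. cscale (\<Sum>s<n. c' t s * c s u) (D u))"
        by (rule swap)
      also have "\<dots> = (\<Sum>u<n. cscale (if u = t then 1 else 0) (D u))"
        using that c'c by simp
      finally show ?thesis using delta[OF that, of D] by simp
    qed
    have span_Phi: "?q (Phi D) = ?q D" for D
    proof (rule subset_antisym; rule cvec.span_minimal)
      show "Phi D ` {..<n} \<subseteq> ?q D"
        by (auto simp: Phi_def cvec.sum_in_span_family)
      show "D ` {..<n} \<subseteq> ?q (Phi D)"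
      proof
        fix x assume "x \<in> D ` {..<n}"
        then obtain t where "t < n" "x = D t" by auto
        then show "x \<in> ?q (Phi D)"
          using Phi_inv[of t D] cvec.sum_in_span_family[of "c' t" "Phi D" "{..<n}"] by simp
      qed
    qed auto
    have Phi_frame: "Phi D \<in> frames n V" if D: "D \<in> frames n V" for D
      unfolding frames_iff
    proof (intro conjI allI impI)
      show "Phi D t \<in> V" if "t < n" for t
        using frame_span(2)[OF V D] span_Phi[of D] that by (auto intro: cvec.span_base)
      show "cvec.indep_family {..<n} (Phi D)"
        unfolding cvec.indep_family_def
      proof (intro allI impI ballI)
        fix a t assume a: "(\<Sum>s<n. cscale (a s) (Phi D s)) = 0" and t: "t \<in> {..<n}"
        have "(\<Sum>u<n. cscale (\<Sum>s<n. a s * c s u) (D u)) = (\<Sum>s<n. cscale (a s) (Phi D s))"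
          by (simp add: Phi_def flip: swap)
        with a have *: "(\<Sum>s<n. a s * c s u) = 0" if "u < n" for u
          using D that unfolding frames_iff cvec.indep_family_def by fastforce
        have "a t = (\<Sum>s<n. a s * (\<Sum>u<n. c s u * c' u t))"
          using t cc' by (simp add: if_distrib[of "\<lambda>x. _ * x"] cong: if_cong)
        also have "\<dots> = (\<Sum>s<n. \<Sum>u<n. a s * c s u * c' u t)"
          by (simp add: sum_distrib_left mult.assoc)
        also have "\<dots> = (\<Sum>u<n. \<Sum>s<n. a s * c s u * c' u t)"
          by (rule sum.swap)
        also have "\<dots> = (\<Sum>u<n. (\<Sum>s<n. a s * c s u) * c' u t)"
          by (simp add: sum_distrib_right)
        also have "\<dots> = 0" using * by simp
        finally show "a t = 0" .
      qed
    qed (simp add: Phi_def)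
    have "continuous_map (top_of_set (frames n V)) euclidean Phi"
      unfolding continuous_map_into_function_space[of _ Phi]
    proof
      fix t
      show "continuous_map (top_of_set (frames n V)) euclidean (\<lambda>D. Phi D t)"
        unfolding continuous_map_into_function_space[of _ "\<lambda>D. Phi D t"]
      proof
        fix b
        have "(\<lambda>D. Phi D t b) = (\<lambda>D. if t < n then \<Sum>s<n. c t s * D s b else 0)"
          by (auto simp: Phi_def cscale_def fun_eq_iff sum_fun_apply)
        moreover have "continuous_on (frames n V) (\<lambda>D. D s b)" for s b
        proof -
          have "continuous_on (frames n V) (\<lambda>D :: nat \<Rightarrow> 'a cvec. D s)"
            by (rule continuous_on_product_then_coordinatewise) auto
          then show ?thesis by (rule continuous_on_product_then_coordinatewise)
        qed
        ultimately show "continuous_map (top_of_set (frames n V)) euclidean (\<lambda>D. Phi D t b)"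
          by (simp add: continuous_intros)
      qed
    qed
    then have "continuous_map (top_of_set (frames n V)) (top_of_set (frames n V)) Phi"
      using Phi_frame by (auto simp: continuous_map_in_subtopology)
    then have "openin (top_of_set (frames n V)) {D \<in> frames n V. Phi D \<in> O'}"
      using openin_continuous_map_preimage[of "top_of_set (frames n V)" "top_of_set (frames n V)" Phi, OF _ O]
      by simp
    moreover have "Phi D0 = B"
    proof
      fix t show "Phi D0 t = B t"
        using c[of t] BF by (auto simp: Phi_def frames_iff)
    qed
    moreover have "{D \<in> frames n V. Phi D \<in> O'} \<subseteq> {B \<in> frames n V. ?q B \<in> ?q ` O'}"
    proof (intro subsetI CollectI conjI)
      fix D assume "D \<in> {D \<in> frames n V. Phi D \<in> O'}"
      then show "D \<in> frames n V" "?q D \<in> ?q ` O'"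
        using imageI[of "Phi D" O' ?q] span_Phi[of D] by simp_all
    qed
    ultimately show ?thesis
      using B D0 by (intro exI[of _ "{D \<in> frames n V. Phi D \<in> O'}"]) simp
  qed
  then show "openin (top_of_set (frames n V)) {B \<in> frames n V. ?q B \<in> ?q ` O'}"
    by (subst openin_subopen) blast
qed

lemma topspace_quiver_grass:
  assumes "\<And>v. v \<in> {1..r} \<Longrightarrow> cvec.subspace (Sp M v)"
  shows "topspace (quiver_grass r e M) = {U. submodule r M U \<and> (\<forall>v\<in>{1..r}. cvec.dim (U v) = e v)}"
  using assms
  by (auto simp: quiver_grass_def submodule_def topspace_grass PiE_def Pi_def)

section \<open>Dual bases\<close>

text \<open>Continuity is part of the notion because coefficients with respect to a basis are later
  used as continuous functions of a frame.\<close>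

definition linear_functional :: "('b cvec \<Rightarrow> complex) \<Rightarrow> bool"
  where "linear_functional f \<longleftrightarrow>
    (\<forall>x y. f (x + y) = f x + f y) \<and> (\<forall>c x. f (cscale c x) = c * f x) \<and> continuous_on UNIV f"

lemma linear_functional_sum:
  assumes "linear_functional f"
  shows "f (\<Sum>i\<in>J. g i) = (\<Sum>i\<in>J. f (g i))"
proof -
  have "f 0 = 0"
    using assms by (metis add_cancel_right_left linear_functional_def)
  then show ?thesis
    using assms by (induction J rule: infinite_finite_induct) (auto simp: linear_functional_def)
qed

lemma linear_functional_zero: "linear_functional f \<Longrightarrow> f 0 = 0"
  using linear_functional_sum[of f id "{}"] by simp

lemma linear_functional_combination:
  assumes "linear_functional f" "linear_functional g"
  shows "linear_functional (\<lambda>x. f x - c * g x)"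
  using assms by (auto simp: linear_functional_def algebra_simps intro!: continuous_intros)

text \<open>The evaluations at points are continuous and vanish simultaneously at 0 only; Gaussian
  elimination, as an induction on the spanning set, makes a combination of them vanish on a given
  finite set.\<close>

lemma ex_separating_functional:
  assumes "finite B" "n \<notin> cvec.span B"
  shows "\<exists>f. linear_functional f \<and> (\<forall>x\<in>B. f x = 0) \<and> f n = 1"
  using assms
proof (induction B arbitrary: n rule: finite_induct)
  case empty
  then obtain p where p: "n p \<noteq> 0" by (auto simp: fun_eq_iff)
  have "continuous_on UNIV (\<lambda>x :: 'a cvec. inverse (n p) * x p)"
    by (intro continuous_intros continuous_on_product_coordinates)
  then have "linear_functional (\<lambda>x. inverse (n p) * x p)"
    by (simp add: linear_functional_def algebra_simps cscale_def)
  then show ?case using p by (intro exI[of _ "\<lambda>x. inverse (n p) * x p"]) simp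
next
  case (insert b B)
  show ?case
  proof (cases "b \<in> cvec.span B")
    case True
    then have "n \<notin> cvec.span B"
      using insert.prems by (simp add: cvec.span_redundant)
    then obtain f where f: "linear_functional f" "\<forall>x\<in>B. f x = 0" "f n = 1"
      using insert.IH by blast
    obtain c where "b = (\<Sum>x\<in>B. cscale (c x) x)"
      using True insert.hyps(1) cvec.span_family[of B id] by auto
    then have "f b = (\<Sum>x\<in>B. c x * f x)"
      using f(1) by (simp add: linear_functional_sum) (simp add: linear_functional_def)
    then show ?thesis using f by auto
  next
    case False
    then obtain g where g: "linear_functional g" "\<forall>x\<in>B. g x = 0" "g b = 1"
      using insert.IH by blast
    have "n - cscale (g n) b \<notin> cvec.span B"
    proof
      assume "n - cscale (g n) b \<in> cvec.span B"
      then have "n - cscale (g n) b \<in> cvec.span (insert b B)"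
        by (meson cvec.span_mono subsetD subset_insertI)
      moreover have "cscale (g n) b \<in> cvec.span (insert b B)"
        by (intro cvec.span_scale cvec.span_base) simp
      ultimately have "n - cscale (g n) b + cscale (g n) b \<in> cvec.span (insert b B)"
        by (rule cvec.span_add)
      then show False using insert.prems by simp
    qed
    then obtain f where f: "linear_functional f" "\<forall>x\<in>B. f x = 0" "f (n - cscale (g n) b) = 1"
      using insert.IH by blast
    have "f n = f (n - cscale (g n) b) + g n * f b"
    proof -
      have "f n = f ((n - cscale (g n) b) + cscale (g n) b)" by simp
      also have "\<dots> = f (n - cscale (g n) b) + g n * f b"
        using f(1) unfolding linear_functional_def by metis
      finally show ?thesis .
    qed
    then show ?thesis
      using f g by (intro exI[of _ "\<lambda>x. f x - f b * g x"])
        (auto simp: linear_functional_combination)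
  qed
qed

lemma ex_dual_family:
  assumes "finite J" "cvec.indep_family J g"
  obtains co where "\<And>i. i \<in> J \<Longrightarrow> linear_functional (co i)"
    "\<And>i j. i \<in> J \<Longrightarrow> j \<in> J \<Longrightarrow> co i (g j) = (if j = i then 1 else 0)"
proof -
  have "\<exists>f. linear_functional f \<and> (\<forall>j\<in>J. f (g j) = (if j = i then 1 else 0))" if i: "i \<in> J" for i
  proof -
    have "g i \<notin> cvec.span (g ` (J - {i}))"
    proof
      assume "g i \<in> cvec.span (g ` (J - {i}))"
      then obtain c where c: "g i = (\<Sum>j\<in>J - {i}. cscale (c j) (g j))"
        using assms(1) by (auto simp: cvec.span_family)
      define d where "d = (\<lambda>j. if j = i then - 1 else c j)"
      have "(\<Sum>j\<in>J. cscale (d j) (g j)) =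
          cscale (- 1) (g i) + (\<Sum>j\<in>J - {i}. cscale (d j) (g j))"
        using i assms(1) by (simp add: sum.remove[of J i] d_def)
      also have "(\<Sum>j\<in>J - {i}. cscale (d j) (g j)) = g i"
        unfolding c by (intro sum.cong) (auto simp: d_def)
      finally have "(\<Sum>j\<in>J. cscale (d j) (g j)) = 0"
        by (simp add: zero_fun_def)
      then have "d i = 0"
        using assms(2) i unfolding cvec.indep_family_def by blast
      then show False by (simp add: d_def)
    qed
    then obtain f where f: "linear_functional f" "\<forall>x\<in>g ` (J - {i}). f x = 0" "f (g i) = 1"
      using ex_separating_functional[of "g ` (J - {i})" "g i"] assms(1) by blast
    show ?thesis
      using f by (intro exI[of _ f]) auto
  qed
  then obtain co where "\<And>i. i \<in> J \<Longrightarrow>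
      linear_functional (co i) \<and> (\<forall>j\<in>J. co i (g j) = (if j = i then 1 else 0))"
    by metis
  then show thesis using that[of co] by auto
qed

section \<open>Representations with a basis\<close>

lemma wrap_in: "r \<ge> 1 \<Longrightarrow> wrap r v \<in> {1..r}"
  using pos_mod_sign[of r "v - 1"] pos_mod_bound[of r "v - 1"]
  unfolding wrap_def atLeastAtMost_iff by linarith

lemma wrap_id: "v \<in> {1..r} \<Longrightarrow> wrap r v = v"
  by (auto simp: wrap_def)

lemma wrap_eq_iff: "wrap r u = wrap r v \<longleftrightarrow> u mod r = v mod r"
  by (metis (no_types, opaque_lifting) add_right_cancel diff_add_cancel mod_add_cong mod_diff_cong wrap_def)

lemma wrap_wrap_add: "wrap r (wrap r u + v) = wrap r (u + v)"
  using mod_add_left_eq[of "u - 1" r "1 + v"] unfolding wrap_eq_iff by (simp add: wrap_def algebra_simps)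

lemma wrap_wrap_diff: "wrap r (wrap r u - v) = wrap r (u - v)"
  using wrap_wrap_add[of r u "- v"] by simp

text \<open>A representation with a chosen basis \<open>b a\<close>, indexed by one set for all vertices, where
  \<open>vt a\<close> is the vertex of \<open>b a\<close>. The coordinates \<open>co a\<close> are functionals on the whole function
  space, so that they are linear and continuous without restriction to the space at the vertex.\<close>

locale based_rep =
  fixes r :: int and M :: "'b rep" and I :: "'a set" and vt :: "'a \<Rightarrow> int"
    and b :: "'a \<Rightarrow> 'b cvec" and co :: "'a \<Rightarrow> 'b cvec \<Rightarrow> complex"
  assumes r_pos: "r \<ge> 1" and finI: "finite I" and vt_in: "\<And>a. a \<in> I \<Longrightarrow> vt a \<in> {1..r}"
    and Sp_subspace: "\<And>v. v \<in> {1..r} \<Longrightarrow> cvec.subspace (Sp M v)"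
    and b_in: "\<And>a. a \<in> I \<Longrightarrow> b a \<in> Sp M (vt a)"
    and co: "\<And>a. a \<in> I \<Longrightarrow> linear_functional (co a)"
    and co_b: "\<And>a a'. a \<in> I \<Longrightarrow> a' \<in> I \<Longrightarrow> vt a' = vt a \<Longrightarrow> co a (b a') = (if a' = a then 1 else 0)"
    and expand: "\<And>v x. v \<in> {1..r} \<Longrightarrow> x \<in> Sp M v \<Longrightarrow>
      x = (\<Sum>a\<in>{a \<in> I. vt a = v}. cscale (co a x) (b a))"
begin

lemma co_add [simp]: "a \<in> I \<Longrightarrow> co a (x + y) = co a x + co a y"
  using co[of a] unfolding linear_functional_def by blast

lemma co_scale [simp]: "a \<in> I \<Longrightarrow> co a (cscale c x) = c * co a x"
  using co[of a] unfolding linear_functional_def by blast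

lemma co_sum [simp]: "a \<in> I \<Longrightarrow> co a (\<Sum>j\<in>J. g j) = (\<Sum>j\<in>J. co a (g j))"
  by (rule linear_functional_sum[OF co])

lemma co_zero [simp]: "a \<in> I \<Longrightarrow> co a 0 = 0"
  by (rule linear_functional_zero[OF co])

lemma co_diff [simp]: "a \<in> I \<Longrightarrow> co a (x - y) = co a x - co a y"
  using co_add[of a "x - y" y] by simp

lemma co_combination:
  assumes "a \<in> I" "vt a = v"
  shows "co a (\<Sum>a'\<in>{a \<in> I. vt a = v}. cscale (c a') (b a')) = c a"
proof -
  have "co a (\<Sum>a'\<in>{a \<in> I. vt a = v}. cscale (c a') (b a')) =
      (\<Sum>a'\<in>{a \<in> I. vt a = v}. if a' = a then c a' else 0)"
    using assms by (auto intro!: sum.cong simp: co_b)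
  then show ?thesis using assms finI by simp
qed

lemma Sp_eqI:
  assumes "v \<in> {1..r}" "x \<in> Sp M v" "y \<in> Sp M v"
    and "\<And>a. a \<in> I \<Longrightarrow> vt a = v \<Longrightarrow> co a x = co a y"
  shows "x = y"
proof -
  have "(\<Sum>a\<in>{a \<in> I. vt a = v}. cscale (co a x) (b a)) = (\<Sum>a\<in>{a \<in> I. vt a = v}. cscale (co a y) (b a))"
    using assms(4) by (intro sum.cong) auto
  then show ?thesis
    using expand[OF assms(1,2)] expand[OF assms(1,3)] by simp
qed

lemma indep: "cvec.indep_family {a \<in> I. vt a = v} b"
  unfolding cvec.indep_family_def
proof (intro allI impI ballI)
  fix c a assume c: "(\<Sum>a\<in>{a \<in> I. vt a = v}. cscale (c a) (b a)) = 0" and a: "a \<in> {a \<in> I. vt a = v}"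
  show "c a = 0"
    using co_combination[of a v c] a by (simp add: c)
qed

lemma Sp_span:
  assumes "v \<in> {1..r}"
  shows "Sp M v = cvec.span (b ` {a \<in> I. vt a = v})"
proof (intro equalityI)
  show "Sp M v \<subseteq> cvec.span (b ` {a \<in> I. vt a = v})"
  proof
    fix x assume "x \<in> Sp M v"
    then show "x \<in> cvec.span (b ` {a \<in> I. vt a = v})"
      using cvec.sum_in_span_family[of "\<lambda>a. co a x" b "{a \<in> I. vt a = v}"] expand[OF assms, of x]
      by simp
  qed
  show "cvec.span (b ` {a \<in> I. vt a = v}) \<subseteq> Sp M v"
    using b_in by (intro cvec.span_minimal Sp_subspace assms) auto
qed

lemma dimv_eq: "dimv r M v = card {a \<in> I. vt a = v}"
proof (cases "v \<in> {1..r}")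
  case True
  then show ?thesis
    using cvec.dim_span_family[OF _ indep[of v]] finI by (simp add: dimv_def Sp_span)
next
  case False
  then have "{a \<in> I. vt a = v} = {}" using vt_in by auto
  with False show ?thesis by (simp only: dimv_def) simp
qed

end

lemma ex_based_rep:
  fixes M :: "'b rep"
  assumes r: "r \<ge> 1" and M: "\<And>v. v \<in> {1..r} \<Longrightarrow> \<exists>B. finite B \<and> Sp M v = cvec.span B"
  obtains I :: "(int \<times> 'b cvec) set" and co where "based_rep r M I fst snd co"
proof -
  have "\<exists>B. finite B \<and> cvec.independent B \<and> cvec.span B = Sp M v" if v: "v \<in> {1..r}" for v
  proof -
    obtain A where A: "finite A" "Sp M v = cvec.span A" using M[OF v] by auto
    obtain B where "B \<subseteq> A" "cvec.independent B" "A \<subseteq> cvec.span B"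
      using cvec.maximal_independent_subset by blast
    then show ?thesis
      using A cvec.span_mono[of B A] cvec.span_minimal[of A "cvec.span B"]
      by (intro exI[of _ B]) (auto intro: finite_subset)
  qed
  then obtain B where B: "\<And>v. v \<in> {1..r} \<Longrightarrow> finite (B v)"
      "\<And>v. v \<in> {1..r} \<Longrightarrow> cvec.independent (B v)" "\<And>v. v \<in> {1..r} \<Longrightarrow> cvec.span (B v) = Sp M v"
    by metis
  have "\<exists>co. (\<forall>x\<in>B v. linear_functional (co x)) \<and>
      (\<forall>x\<in>B v. \<forall>y\<in>B v. co x y = (if y = x then 1 else 0))" if v: "v \<in> {1..r}" for v
  proof -
    have "cvec.indep_family (B v) id"
      using B(1,2)[OF v] by (simp add: cvec.indep_family_iff)
    from ex_dual_family[OF B(1)[OF v] this] show ?thesis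
      by (metis id_apply)
  qed
  then obtain co where co: "\<And>v x. v \<in> {1..r} \<Longrightarrow> x \<in> B v \<Longrightarrow> linear_functional (co v x)"
      "\<And>v x y. v \<in> {1..r} \<Longrightarrow> x \<in> B v \<Longrightarrow> y \<in> B v \<Longrightarrow> co v x y = (if y = x then 1 else 0)"
    by metis
  define I where "I = Sigma {1..r} B"
  have fib: "{a \<in> I. fst a = v} = Pair v ` B v" if "v \<in> {1..r}" for v
    using that by (auto simp: I_def)
  have "based_rep r M I fst snd (\<lambda>(v, x). co v x)"
  proof
    fix v x assume v: "v \<in> {1..r}" and x: "x \<in> Sp M v"
    obtain c where c: "x = (\<Sum>y\<in>B v. cscale (c y) y)"
      using x B(1,3)[OF v] cvec.span_family[of "B v" id] by auto
    have "co v y x = c y" if "y \<in> B v" for y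
    proof -
      have "co v y x = (\<Sum>z\<in>B v. c z * co v y z)"
        using co(1)[OF v that] unfolding c
        by (simp add: linear_functional_sum) (simp add: linear_functional_def)
      also have "\<dots> = (\<Sum>z\<in>B v. if z = y then c z else 0)"
        using co(2)[OF v that] by (intro sum.cong) auto
      finally show ?thesis using that B(1)[OF v] by simp
    qed
    then have "x = (\<Sum>y\<in>B v. cscale (co v y x) y)"
      unfolding c by (intro sum.cong) auto
    then show "x = (\<Sum>a\<in>{a \<in> I. fst a = v}. cscale ((case a of (v, y) \<Rightarrow> co v y) x) (snd a))"
      by (simp add: fib[OF v] sum.reindex inj_on_def)
  next
    show "finite I" using B(1) by (auto simp: I_def)
    show "cvec.subspace (Sp M v)" if "v \<in> {1..r}" for v
      using B(3)[OF that] by (metis cvec.subspace_span)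
    show "snd a \<in> Sp M (fst a)" if "a \<in> I" for a
    proof -
      have "fst a \<in> {1..r}" "snd a \<in> B (fst a)" using that by (auto simp: I_def)
      then show ?thesis using B(3)[of "fst a"] cvec.span_base[of "snd a" "B (fst a)"] by simp
    qed
  qed (use r co in \<open>auto simp: I_def split: if_splits\<close>)
  then show thesis using that by blast
qed

section \<open>Families of linear maps and the Euler form\<close>

text \<open>Rank and nullity for a map that is linear on a subspace only. The families \<open>fam r s M N\<close>
  are such subspaces, and \<open>bdry\<close> need not be additive outside of them.\<close>

lemma (in vector_space) dim_kernel_image:
  assumes V: "subspace V" "V \<subseteq> span A" "finite A"
    and add: "\<And>x y. x \<in> V \<Longrightarrow> y \<in> V \<Longrightarrow> f (x + y) = f x + f y"
    and scale: "\<And>c x. x \<in> V \<Longrightarrow> f (scale c x) = scale c (f x)"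
  shows "dim V = dim {x \<in> V. f x = 0} + dim (f ` V)"
proof -
  let ?K = "{x \<in> V. f x = 0}"
  have f0: "f 0 = 0"
    using scale[of 0 0] subspace_0[OF V(1)] by simp
  have K: "subspace ?K"
    using V(1) f0 by (auto simp: subspace_def add scale)
  have f_sum: "f (\<Sum>x\<in>S. scale (c x) x) = (\<Sum>x\<in>S. scale (c x) (f x))" if "S \<subseteq> V" for S c
    using that
  proof (induction S rule: infinite_finite_induct)
    case (insert x S)
    then have "(\<Sum>x\<in>S. scale (c x) x) \<in> V" "scale (c x) x \<in> V"
      using V(1) by (auto intro!: subspace_sum subspace_scale)
    with insert show ?case by (simp add: add scale)
  qed (auto simp: f0)
  obtain B1 where B1: "B1 \<subseteq> ?K" "independent B1" "?K \<subseteq> span B1"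
    using maximal_independent_subset by blast
  obtain B where B: "B1 \<subseteq> B" "B \<subseteq> V" "independent B" "V \<subseteq> span B"
    using maximal_independent_subset_extend[of B1 V] B1 by blast
  have fin: "finite B"
    using independent_span_bound[OF V(3) B(3)] B(2) V(2) by auto
  let ?C = "B - B1"
  have ind: "indep_family ?C f"
    unfolding indep_family_def
  proof (intro allI impI ballI)
    fix c x assume c: "(\<Sum>x\<in>?C. scale (c x) (f x)) = 0" and x: "x \<in> ?C"
    have "(\<Sum>x\<in>?C. scale (c x) x) \<in> V"
      using B(2) V(1) by (intro subspace_sum subspace_scale) auto
    moreover have "f (\<Sum>x\<in>?C. scale (c x) x) = 0"
      using c B(2) by (subst f_sum) auto
    ultimately have "(\<Sum>x\<in>?C. scale (c x) x) \<in> span B1"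
      using B1(3) by auto
    then obtain d where d: "(\<Sum>x\<in>?C. scale (c x) x) = (\<Sum>x\<in>B1. scale (d x) x)"
      using span_family[of B1 id] finite_subset[OF B(1) fin] by auto
    let ?u = "\<lambda>x. if x \<in> B1 then - d x else c x"
    have "(\<Sum>x\<in>B. scale (?u x) x) = (\<Sum>x\<in>B1. scale (?u x) x) + (\<Sum>x\<in>?C. scale (?u x) x)"
      using sum.subset_diff[OF B(1) fin, of "\<lambda>x. scale (?u x) x"] by (simp add: add.commute)
    also have "(\<Sum>x\<in>?C. scale (?u x) x) = (\<Sum>x\<in>?C. scale (c x) x)"
      by (intro sum.cong) auto
    also have "(\<Sum>x\<in>B1. scale (?u x) x) = - (\<Sum>x\<in>B1. scale (d x) x)"
      by (simp add: sum_negf)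
    finally have "(\<Sum>x\<in>B. scale (?u x) x) = 0"
      using d by simp
    then have "?u x = 0"
      using independentD[OF B(3) fin subset_refl, of ?u x] x by blast
    then show "c x = 0" using x by simp
  qed
  have img: "f ` V \<subseteq> span (f ` ?C)"
  proof
    fix y assume "y \<in> f ` V"
    then obtain x where x: "x \<in> V" "y = f x" by auto
    obtain c where c: "x = (\<Sum>x\<in>B. scale (c x) x)"
      using x(1) B(4) span_family[of B id] fin by auto
    have "y = (\<Sum>x\<in>B. scale (c x) (f x))"
      unfolding x(2) by (subst c) (rule f_sum[OF B(2)])
    also have "\<dots> = (\<Sum>x\<in>?C. scale (c x) (f x))"
      using B1(1) fin by (intro sum.mono_neutral_right) auto
    finally show "y \<in> span (f ` ?C)"
      by (simp add: sum_in_span_family)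
  qed
  have "dim (f ` V) = card ?C"
  proof (rule dim_unique)
    show "f ` ?C \<subseteq> f ` V" using B(2) by auto
    show "independent (f ` ?C)" "card (f ` ?C) = card ?C"
      using ind fin by (auto simp: indep_family_iff card_image)
  qed (rule img)
  moreover have "dim ?K = card B1"
    using B1 by (intro dim_unique) auto
  moreover have "dim V = card B"
    using B by (intro dim_unique) auto
  moreover have "card B = card B1 + card ?C"
    using B(1) fin by (metis card_Diff_subset card_mono finite_subset le_add_diff_inverse)
  ultimately show ?thesis by simp
qed

lemma hscale_apply [simp]: "hscale c \<phi> v x = cscale c (\<phi> v x)"
  by (simp add: hscale_def)

lemma lin_onD:
  assumes "lin_on V W f"
  shows "x \<in> V \<Longrightarrow> f x \<in> W" "x \<in> V \<Longrightarrow> y \<in> V \<Longrightarrow> f (x + y) = f x + f y"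
    "x \<in> V \<Longrightarrow> f (cscale c x) = cscale c (f x)"
  using assms by (auto simp: lin_on_def)

lemma lin_on_sum:
  assumes f: "lin_on V W f" and V: "cvec.subspace V" and J: "\<And>a. a \<in> J \<Longrightarrow> g a \<in> V"
  shows "f (\<Sum>a\<in>J. cscale (c a) (g a)) = (\<Sum>a\<in>J. cscale (c a) (f (g a)))"
  using J
proof (induction J rule: infinite_finite_induct)
  case (insert x S)
  then have "(\<Sum>a\<in>S. cscale (c a) (g a)) \<in> V" "cscale (c x) (g x) \<in> V"
    using V by (auto intro!: cvec.subspace_sum cvec.subspace_scale)
  then have "f (cscale (c x) (g x) + (\<Sum>a\<in>S. cscale (c a) (g a))) =
      cscale (c x) (f (g x)) + f (\<Sum>a\<in>S. cscale (c a) (g a))"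
    using lin_onD(2)[OF f] lin_onD(3)[OF f insert.prems[of x]] by simp
  moreover have "f (\<Sum>a\<in>S. cscale (c a) (g a)) = (\<Sum>a\<in>S. cscale (c a) (f (g a)))"
    using insert by simp
  ultimately show ?case
    unfolding sum.insert[OF insert.hyps] by (simp add: plus_fun_def)
qed (use lin_onD(3)[OF f cvec.subspace_0[OF V], of 0] in auto)

locale based_rep_pair = M: based_rep r M I vt b co + N: based_rep r N I' vt' b' co'
  for r :: int and M :: "'b rep" and I :: "'a set" and vt b co
    and N :: "'c rep" and I' :: "'d set" and vt' b' co' +
  assumes linM: "\<And>v. v \<in> {1..r} \<Longrightarrow> lin_on (Sp M v) (Sp M (wrap r (v - 1))) (Mp M v)"
    and linN: "\<And>v. v \<in> {1..r} \<Longrightarrow> lin_on (Sp N v) (Sp N (wrap r (v - 1))) (Mp N v)"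
begin

text \<open>The matrix units, as families of maps concentrated at one vertex.\<close>

definition unit_map :: "'a \<times> 'd \<Rightarrow> int \<Rightarrow> 'b cvec \<Rightarrow> 'c cvec"
  where "unit_map = (\<lambda>(a, a') v x. if v = vt a \<and> x \<in> Sp M v then cscale (co a x) (b' a') else 0)"

definition index_pairs :: "int \<Rightarrow> ('a \<times> 'd) set"
  where "index_pairs s = {(a, a') \<in> I \<times> I'. vt' a' = wrap r (vt a - s)}"

lemma finite_index_pairs: "finite (index_pairs s)"
  by (rule finite_subset[of _ "I \<times> I'"]) (auto simp: index_pairs_def M.finI N.finI)

lemma subspace_fam: "hvec.subspace (fam r s M N)"
  unfolding hvec.subspace_def
proof (intro conjI allI ballI)
  have sub: "cvec.subspace (Sp N (wrap r (v - s)))" for v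
    by (rule N.Sp_subspace[OF wrap_in[OF M.r_pos]])
  show "0 \<in> fam r s M N"
    using cvec.subspace_0[OF sub] by (auto simp: fam_def lin_on_def)
  show "x + y \<in> fam r s M N" if "x \<in> fam r s M N" "y \<in> fam r s M N" for x y
    using that cvec.subspace_add[OF sub]
    by (auto simp: fam_def lin_on_def cvec.scale_right_distrib)
  show "hscale c x \<in> fam r s M N" if "x \<in> fam r s M N" for c x
    using that cvec.subspace_scale[OF sub]
    by (auto simp: fam_def lin_on_def cvec.scale_right_distrib mult.commute)
qed

lemma unit_map_in_fam:
  assumes "p \<in> index_pairs s"
  shows "unit_map p \<in> fam r s M N"
proof -
  obtain a a' where p: "p = (a, a')" "a \<in> I" "a' \<in> I'" "vt' a' = wrap r (vt a - s)"
    using assms by (auto simp: index_pairs_def)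
  have sub: "cvec.subspace (Sp N (wrap r (v - s)))" for v
    by (rule N.Sp_subspace[OF wrap_in[OF M.r_pos]])
  have "b' a' \<in> Sp N (wrap r (vt a - s))"
    using N.b_in[OF p(3)] p(4) by simp
  then have "cscale c (b' a') \<in> Sp N (wrap r (vt a - s))" for c
    using cvec.subspace_scale[OF sub] by blast
  moreover have "x + y \<in> Sp M v" "cscale c x \<in> Sp M v" if "v \<in> {1..r}" "x \<in> Sp M v" "y \<in> Sp M v" for v x y c
    using that M.Sp_subspace cvec.subspace_add cvec.subspace_scale by blast+
  ultimately show ?thesis
    using cvec.subspace_0[OF sub] p M.vt_in[OF p(2)]
    by (auto simp: fam_def lin_on_def unit_map_def cvec.scale_left_distrib)
qed

definition entry :: "'a \<times> 'd \<Rightarrow> (int \<Rightarrow> 'b cvec \<Rightarrow> 'c cvec) \<Rightarrow> complex"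
  where "entry = (\<lambda>(a, a') \<phi>. co' a' (\<phi> (vt a) (b a)))"

lemma entry_scale: "p \<in> index_pairs s \<Longrightarrow> entry p (hscale c \<phi>) = c * entry p \<phi>"
  by (auto simp: entry_def index_pairs_def)

lemma entry_sum:
  "p \<in> index_pairs s \<Longrightarrow> entry p (\<Sum>j\<in>J. g j) = (\<Sum>j\<in>J. entry p (g j))"
  by (auto simp: entry_def index_pairs_def sum_fun_apply)

lemma entry_unit_map:
  assumes "p \<in> index_pairs s" "q \<in> index_pairs s"
  shows "entry p (unit_map q) = (if q = p then 1 else 0)"
proof -
  obtain a a' c c' where p: "p = (a, a')" "a \<in> I" "a' \<in> I'" "vt' a' = wrap r (vt a - s)"
    and q: "q = (c, c')" "c \<in> I" "c' \<in> I'" "vt' c' = wrap r (vt c - s)"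
    using assms by (auto simp: index_pairs_def)
  show ?thesis
    using p q M.b_in[OF p(2)] M.co_b[OF q(2) p(2)] N.co_b[OF p(3) q(3)]
    by (auto simp: entry_def unit_map_def)
qed

text \<open>A family of linear maps vanishes outside of the spaces of the representation, so it is
  determined by its matrix.\<close>

lemma fam_expand:
  assumes "\<phi> \<in> fam r s M N"
  shows "\<phi> = (\<Sum>p\<in>index_pairs s. hscale (entry p \<phi>) (unit_map p))" (is "_ = ?R")
proof -
  have R: "?R \<in> fam r s M N"
    using subspace_fam unit_map_in_fam by (intro hvec.subspace_sum hvec.subspace_scale) auto
  have lin: "lin_on (Sp M v) (Sp N (wrap r (v - s))) (\<phi> v)"
    "lin_on (Sp M v) (Sp N (wrap r (v - s))) (?R v)" if "v \<in> {1..r}" for v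
    using R assms that by (auto simp only: fam_def mem_Collect_eq)
  have ent: "entry p ?R = entry p \<phi>" if "p \<in> index_pairs s" for p
  proof -
    have "entry p ?R = (\<Sum>q\<in>index_pairs s. if q = p then entry q \<phi> else 0)"
      using that by (auto simp: entry_sum entry_scale entry_unit_map intro!: sum.cong)
    then show ?thesis using that finite_index_pairs by simp
  qed
  have basis: "\<phi> (vt a) (b a) = ?R (vt a) (b a)" if a: "a \<in> I" for a
  proof (rule N.Sp_eqI[of "wrap r (vt a - s)"])
    show "wrap r (vt a - s) \<in> {1..r}" by (rule wrap_in[OF M.r_pos])
    show "\<phi> (vt a) (b a) \<in> Sp N (wrap r (vt a - s))" "?R (vt a) (b a) \<in> Sp N (wrap r (vt a - s))"
      using lin[OF M.vt_in[OF a]] M.b_in[OF a] lin_onD(1) by blast+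
    fix a' assume "a' \<in> I'" "vt' a' = wrap r (vt a - s)"
    then have "entry (a, a') ?R = entry (a, a') \<phi>"
      using a by (intro ent) (simp add: index_pairs_def)
    then show "co' a' (\<phi> (vt a) (b a)) = co' a' (?R (vt a) (b a))"
      by (simp add: entry_def)
  qed
  show ?thesis
  proof (rule ext, rule ext)
    fix v x
    show "\<phi> v x = ?R v x"
    proof (cases "v \<in> {1..r} \<and> x \<in> Sp M v")
      case True
      then have v: "v \<in> {1..r}" and x: "x \<in> Sp M v" by auto
      let ?J = "{a \<in> I. vt a = v}"
      have xe: "x = (\<Sum>a\<in>?J. cscale (co a x) (b a))" by (rule M.expand[OF v x])
      have J: "b a \<in> Sp M v" if "a \<in> ?J" for a using that M.b_in by auto
      have "\<phi> v x = (\<Sum>a\<in>?J. cscale (co a x) (\<phi> v (b a)))"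
        by (subst xe) (rule lin_on_sum[OF lin(1)[OF v] M.Sp_subspace[OF v] J])
      also have "\<dots> = (\<Sum>a\<in>?J. cscale (co a x) (?R v (b a)))"
        using basis by (intro sum.cong) auto
      also have "\<dots> = ?R v x"
        by (subst (2) xe) (rule lin_on_sum[OF lin(2)[OF v] M.Sp_subspace[OF v] J, symmetric])
      finally show ?thesis .
    next
      case False
      have "\<phi> v x = 0" "?R v x = 0"
        using False assms R unfolding fam_def by blast+
      then show ?thesis by simp
    qed
  qed
qed

lemma indep_unit_map: "hvec.indep_family (index_pairs s) unit_map"
  unfolding hvec.indep_family_def
proof (intro allI impI ballI)
  fix c p assume c: "(\<Sum>q\<in>index_pairs s. hscale (c q) (unit_map q)) = 0" and p: "p \<in> index_pairs s"
  have "entry p (\<Sum>q\<in>index_pairs s. hscale (c q) (unit_map q)) =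
      (\<Sum>q\<in>index_pairs s. if q = p then c q else 0)"
    using p by (auto simp: entry_sum entry_scale entry_unit_map intro!: sum.cong)
  moreover have "entry p 0 = 0"
    using p by (auto simp: entry_def index_pairs_def)
  ultimately show "c p = 0"
    using c p finite_index_pairs by simp
qed

lemma fam_span: "fam r s M N = hvec.span (unit_map ` index_pairs s)"
proof (intro equalityI)
  show "fam r s M N \<subseteq> hvec.span (unit_map ` index_pairs s)"
  proof
    fix \<phi> assume "\<phi> \<in> fam r s M N"
    from fam_expand[OF this] show "\<phi> \<in> hvec.span (unit_map ` index_pairs s)"
      using hvec.sum_in_span_family[of "\<lambda>p. entry p \<phi>" unit_map "index_pairs s"] by simp
  qed
  show "hvec.span (unit_map ` index_pairs s) \<subseteq> fam r s M N"
    using unit_map_in_fam by (intro hvec.span_minimal subspace_fam) auto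
qed

lemma dim_fam: "hvec.dim (fam r s M N) = card (index_pairs s)"
  using hvec.dim_span_family[OF finite_index_pairs indep_unit_map, of s] by (simp add: fam_span)

lemma bdry_in_fam:
  assumes "\<phi> \<in> fam r 0 M N"
  shows "bdry r M N \<phi> \<in> fam r 1 M N"
proof -
  have w: "wrap r (v - 1) \<in> {1..r}" for v
    by (rule wrap_in[OF M.r_pos])
  have lin: "lin_on (Sp M v) (Sp N v) (\<phi> v)" if "v \<in> {1..r}" for v
    using assms that by (auto simp: fam_def wrap_id)
  show ?thesis
    unfolding fam_def
  proof (intro CollectI conjI ballI allI impI)
    fix v assume v: "v \<in> {1..r}"
    note l = lin_onD[OF lin[OF v]] lin_onD[OF linM[OF v]] lin_onD[OF lin[OF w]] lin_onD[OF linN[OF v]]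
    show "lin_on (Sp M v) (Sp N (wrap r (v - 1))) (bdry r M N \<phi> v)"
      unfolding lin_on_def
    proof (intro conjI ballI allI)
      fix x y c assume x: "x \<in> Sp M v" and y: "y \<in> Sp M v"
      have xy: "x + y \<in> Sp M v" "cscale c x \<in> Sp M v"
        using x y M.Sp_subspace[OF v] cvec.subspace_add cvec.subspace_scale by blast+
      show "bdry r M N \<phi> v (x + y) = bdry r M N \<phi> v x + bdry r M N \<phi> v y"
        using v x y xy by (simp add: bdry_def l)
    next
      fix x c assume x: "x \<in> Sp M v"
      have xy: "cscale c x \<in> Sp M v"
        using x M.Sp_subspace[OF v] cvec.subspace_scale by blast
      show "bdry r M N \<phi> v (cscale c x) = cscale c (bdry r M N \<phi> v x)"
        using v x xy by (simp add: bdry_def l cvec.scale_right_diff_distrib)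
    next
      fix x assume x: "x \<in> Sp M v"
      show "bdry r M N \<phi> v x \<in> Sp N (wrap r (v - 1))"
        using v x cvec.subspace_diff[OF N.Sp_subspace[OF w]] by (simp add: bdry_def l)
    qed
  qed (auto simp: bdry_def)
qed

lemma bdry_add:
  "bdry r M N (\<phi> + \<psi>) = bdry r M N \<phi> + bdry r M N \<psi>" if "\<phi> \<in> fam r 0 M N" "\<psi> \<in> fam r 0 M N"
proof -
  have "\<phi> v x \<in> Sp N v" "\<psi> v x \<in> Sp N v" if "v \<in> {1..r}" "x \<in> Sp M v" for v x
    using \<open>\<phi> \<in> _\<close> \<open>\<psi> \<in> _\<close> that by (auto simp: fam_def wrap_id lin_on_def)
  then show ?thesis
    using lin_onD(2)[OF linN] by (auto simp: bdry_def fun_eq_iff)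
qed

lemma bdry_scale:
  "bdry r M N (hscale c \<phi>) = hscale c (bdry r M N \<phi>)" if "\<phi> \<in> fam r 0 M N"
proof -
  have "\<phi> v x \<in> Sp N v" if "v \<in> {1..r}" "x \<in> Sp M v" for v x
    using \<open>\<phi> \<in> _\<close> that by (auto simp: fam_def wrap_id lin_on_def)
  then show ?thesis
    using lin_onD(3)[OF linN] by (auto simp: bdry_def fun_eq_iff cvec.scale_right_diff_distrib)
qed

lemma dim_bdry_le: "hvec.dim (bdry r M N ` fam r 0 M N) \<le> hvec.dim (fam r 1 M N)"
proof -
  have "bdry r M N ` fam r 0 M N \<subseteq> hvec.span (unit_map ` index_pairs 1)"
    using bdry_in_fam by (auto simp: fam_span)
  then have "hvec.dim (bdry r M N ` fam r 0 M N) \<le> card (unit_map ` index_pairs 1)"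
    by (rule hvec.dim_le_card) (simp add: finite_index_pairs)
  also have "\<dots> \<le> card (index_pairs 1)"
    by (rule card_image_le[OF finite_index_pairs])
  finally show ?thesis by (simp add: dim_fam)
qed

text \<open>\<open>Hom\<close> and \<open>Ext\<^sup>1\<close> are the kernel and the cokernel of one linear map, hence the difference
  of their dimensions depends on source and target only.\<close>

lemma hom_minus_ext:
  "int (hom_dim r M N) - int (ext_dim r M N) = int (card (index_pairs 0)) - int (card (index_pairs 1))"
proof -
  have "hvec.dim (fam r 0 M N) =
      hvec.dim {\<phi> \<in> fam r 0 M N. bdry r M N \<phi> = 0} + hvec.dim (bdry r M N ` fam r 0 M N)"
    by (rule hvec.dim_kernel_image[OF subspace_fam _ _ bdry_add bdry_scale])
       (auto simp: fam_span finite_index_pairs)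
  then show ?thesis
    using dim_bdry_le by (simp add: hom_dim_def ext_dim_def dim_fam)
qed

lemma card_index_pairs:
  "card (index_pairs s) = (\<Sum>v\<in>{1..r}. dimv r M v * dimv r N (wrap r (v - s)))"
proof -
  have "index_pairs s = (\<Union>v\<in>{1..r}. {a \<in> I. vt a = v} \<times> {a' \<in> I'. vt' a' = wrap r (v - s)})"
    using M.vt_in by (auto simp: index_pairs_def)
  also have "card \<dots> = (\<Sum>v\<in>{1..r}. card ({a \<in> I. vt a = v} \<times> {a' \<in> I'. vt' a' = wrap r (v - s)}))"
    by (rule card_UN_disjoint) (auto simp: M.finI N.finI)
  finally show ?thesis
    by (simp add: card_cartesian_product M.dimv_eq N.dimv_eq)
qed

end

text \<open>The description of the Euler form refers to all pairs of representations with the given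
  dimension vectors. It has a value because there is such a pair, with all maps zero, and
  because the difference of the dimensions of \<open>Hom\<close> and \<open>Ext\<^sup>1\<close> is the same for all of them.\<close>

lemma euler_form_eq:
  assumes r: "r \<ge> 1" and d: "\<And>v. v \<notin> {1..r} \<Longrightarrow> d v = 0" and e: "\<And>v. v \<notin> {1..r} \<Longrightarrow> e v = 0"
  shows "euler_form r d e =
    (\<Sum>v\<in>{1..r}. int (d v) * int (e v)) - (\<Sum>v\<in>{1..r}. int (d v) * int (e (wrap r (v - 1))))"
    (is "_ = ?R")
proof -
  have ex: "\<exists>M :: nat rep. nilpotent_rep r M \<and> dimv r M = f" if f: "\<And>v. v \<notin> {1..r} \<Longrightarrow> f v = 0" for f
  proof -
    define g :: "nat \<Rightarrow> nat cvec" where "g = (\<lambda>t b. if b = t then 1 else 0)"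
    have app: "(\<Sum>t<k. cscale (c t) (g t)) = (\<lambda>b. if b < k then c b else 0)" for k c
    proof
      fix b
      have "(\<Sum>t<k. cscale (c t) (g t)) b = (\<Sum>t<k. if t = b then c t else 0)"
        unfolding sum_fun_apply by (intro sum.cong) (auto simp: cscale_def g_def)
      then show "(\<Sum>t<k. cscale (c t) (g t)) b = (if b < k then c b else 0)" by simp
    qed
    have ind: "cvec.indep_family {..<k} g" for k
      unfolding cvec.indep_family_def app by (auto simp: fun_eq_iff)
    define M :: "nat rep" where "M = \<lparr>Sp = (\<lambda>v. cvec.span (g ` {..<f v})), Mp = (\<lambda>_ _. 0)\<rparr>"
    have "is_rep r M"
      unfolding is_rep_def
    proof (intro ballI conjI)
      fix v
      show "\<exists>B. finite B \<and> Sp M v = cvec.span B"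
        by (rule exI[of _ "g ` {..<f v}"]) (simp add: M_def)
      show "lin_on (Sp M v) (Sp M (wrap r (v - 1))) (Mp M v)"
        by (simp add: M_def lin_on_def cvec.span_zero)
    qed
    then have "nilpotent_rep r M"
      unfolding nilpotent_rep_def by (intro conjI exI[of _ 1]) (simp_all add: M_def)
    moreover have "dimv r M = f"
      using f cvec.dim_span_family[OF _ ind] by (auto simp: dimv_def M_def fun_eq_iff)
    ultimately show ?thesis by blast
  qed
  have val: "int (hom_dim r M N) - int (ext_dim r M N) = ?R"
    if M: "nilpotent_rep r M" "dimv r M = d" and N: "nilpotent_rep r N" "dimv r N = e" for M N :: "nat rep"
  proof -
    obtain I :: "(int \<times> nat cvec) set" and co where I: "based_rep r M I fst snd co"
      using ex_based_rep[OF r, of M] M by (auto simp: nilpotent_rep_def is_rep_def)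
    obtain I' :: "(int \<times> nat cvec) set" and co' where I': "based_rep r N I' fst snd co'"
      using ex_based_rep[OF r, of N] N by (auto simp: nilpotent_rep_def is_rep_def)
    have lin: "lin_on (Sp M v) (Sp M (wrap r (v - 1))) (Mp M v)"
        "lin_on (Sp N v) (Sp N (wrap r (v - 1))) (Mp N v)" if "v \<in> {1..r}" for v
      using M(1) N(1) that unfolding nilpotent_rep_def is_rep_def by blast+
    interpret based_rep_pair r M I fst snd co N I' fst snd co'
      by (intro based_rep_pair.intro based_rep_pair_axioms.intro I I' lin)
    show ?thesis
      unfolding hom_minus_ext card_index_pairs M N by (simp add: wrap_id)
  qed
  show ?thesis
    unfolding euler_form_def
  proof (rule the_equality)
    show "\<forall>(M :: nat rep) (N :: nat rep). nilpotent_rep r M \<and> nilpotent_rep r N \<and> dimv r M = d \<and> dimv r N = e \<longrightarrow>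
        ?R = int (hom_dim r M N) - int (ext_dim r M N)"
      by (intro allI impI, elim conjE) (rule val[symmetric])
    fix c
    assume c: "\<forall>(M :: nat rep) (N :: nat rep). nilpotent_rep r M \<and> nilpotent_rep r N \<and> dimv r M = d \<and> dimv r N = e \<longrightarrow>
        c = int (hom_dim r M N) - int (ext_dim r M N)"
    obtain M :: "nat rep" where M: "nilpotent_rep r M" "dimv r M = d"
      using ex[of d, OF d] by blast
    obtain N :: "nat rep" where N: "nilpotent_rep r N" "dimv r N = e"
      using ex[of e, OF e] by blast
    have "c = int (hom_dim r M N) - int (ext_dim r M N)"
      by (rule c[rule_format]) (simp add: M N)
    then show "c = ?R"
      using val[OF M N] by simp
  qed
qed

section \<open>Uniserial representations\<close>

lemma (in vector_space) indep_family_subset: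
  assumes "indep_family J g" "finite J" "J' \<subseteq> J"
  shows "indep_family J' g"
  unfolding indep_family_def
proof (intro allI impI ballI)
  fix c j assume c: "(\<Sum>i\<in>J'. scale (c i) (g i)) = 0" and j: "j \<in> J'"
  define d where "d = (\<lambda>i. if i \<in> J' then c i else 0)"
  have "(\<Sum>i\<in>J. scale (d i) (g i)) = (\<Sum>i\<in>J'. scale (d i) (g i))"
    using assms(2,3) by (intro sum.mono_neutral_right) (auto simp: d_def)
  also have "\<dots> = (\<Sum>i\<in>J'. scale (c i) (g i))"
    by (intro sum.cong) (auto simp: d_def)
  finally have "(\<Sum>i\<in>J. scale (d i) (g i)) = 0" using c by simp
  then have "d j = 0"
    using assms(1,3) j unfolding indep_family_def by blast
  then show "c j = 0" using j by (simp add: d_def)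
qed

lemma lin_on_comp: "lin_on V W f \<Longrightarrow> lin_on W X g \<Longrightarrow> lin_on V X (\<lambda>x. g (f x))"
  unfolding lin_on_def by simp

lemma lin_on_subset:
  assumes "lin_on V W f" "V' \<subseteq> V" "f ` V' \<subseteq> W'"
  shows "lin_on V' W' f"
proof -
  have "x \<in> V" "f x \<in> W'" if "x \<in> V'" for x
    using assms(2,3) that by auto
  then show ?thesis
    using assms(1) unfolding lin_on_def by blast
qed

lemma submoduleD:
  assumes "submodule r M U" "v \<in> {1..r}"
  shows "cvec.subspace (U v)" "U v \<subseteq> Sp M v" "Mp M v ` U v \<subseteq> U (wrap r (v - 1))"
    "x \<in> U v \<Longrightarrow> Mp M v x \<in> U (wrap r (v - 1))"
proof -
  have *: "cvec.subspace (U v) \<and> U v \<subseteq> Sp M v \<and> Mp M v ` U v \<subseteq> U (wrap r (v - 1))"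
    using assms unfolding submodule_def by (elim conjE bspec)
  show "cvec.subspace (U v)" by (rule conjunct1[OF *])
  show "U v \<subseteq> Sp M v" by (rule conjunct1[OF conjunct2[OF *]])
  show "Mp M v ` U v \<subseteq> U (wrap r (v - 1))" by (rule conjunct2[OF conjunct2[OF *]])
  then show "x \<in> U v \<Longrightarrow> Mp M v x \<in> U (wrap r (v - 1))"
    by (meson imageI subsetD)
qed

lemma submodule_undefined: "submodule r M U \<Longrightarrow> v \<notin> {1..r} \<Longrightarrow> U v = undefined"
  unfolding submodule_def by (elim conjE extensional_arb)

lemma submodule_subrep_iff:
  assumes "submodule r M U"
  shows "submodule r (subrep M U) W \<longleftrightarrow> submodule r M W \<and> W \<le> U"
proof
  assume W: "submodule r (subrep M U) W"
  have "W v \<subseteq> U v" for v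
  proof (cases "v \<in> {1..r}")
    case True
    then show ?thesis using submoduleD(2)[OF W] by (simp add: subrep_def)
  next
    case False
    then show ?thesis using submodule_undefined[OF W] submodule_undefined[OF assms] by simp
  qed
  moreover have "submodule r M W"
    using submoduleD[OF W] submoduleD(2)[OF assms] W unfolding submodule_def subrep_def
    by (auto simp: subset_iff image_iff)
  ultimately show "submodule r M W \<and> W \<le> U" by (simp add: le_fun_def)
next
  assume "submodule r M W \<and> W \<le> U"
  then show "submodule r (subrep M U) W"
    unfolding submodule_def subrep_def by (auto simp: le_fun_def)
qed

lemma full_sub_subrep: "submodule r M U \<Longrightarrow> full_sub r (subrep M U) = U"
  by (auto simp: submodule_def subrep_def full_sub_def extensional_def fun_eq_iff)

lemma path_map_lin:
  assumes r: "r \<ge> 1" and M: "\<And>v. v \<in> {1..r} \<Longrightarrow> lin_on (Sp M v) (Sp M (wrap r (v - 1))) (Mp M v)"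
    and v: "v \<in> {1..r}"
  shows "lin_on (Sp M v) (Sp M (wrap r (v - int m))) (path_map r M m v)"
  using v
proof (induction m arbitrary: v)
  case 0
  then show ?case by (auto simp: lin_on_def wrap_id)
next
  case (Suc m)
  note IH = Suc.IH[OF wrap_in[OF r], of "v - 1", unfolded wrap_wrap_diff]
  have eq: "wrap r (v - int (Suc m)) = wrap r (v - 1 - int m)"
    by (simp add: algebra_simps)
  have "path_map r M (Suc m) v = (\<lambda>x. path_map r M m (wrap r (v - 1)) (Mp M v x))"
    by (rule ext) simp
  then show ?case
    unfolding eq using lin_on_comp[OF M[OF Suc.prems] IH] by simp
qed

text \<open>The recursion of \<open>path_map\<close> starts with the first arrow of the path; this is the one that
  splits off the last arrow.\<close>

lemma path_map_Suc':
  "path_map r M (Suc m) v x = Mp M (wrap r (v - int m)) (path_map r M m v x)" if "v \<in> {1..r}"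
  using that
proof (induction m arbitrary: v x)
  case 0
  then show ?case by (simp add: wrap_id)
next
  case (Suc m)
  show ?case
  proof (cases "r \<ge> 1")
    case True
    have "wrap r (wrap r (v - 1) - int m) = wrap r (v - int (Suc m))"
      by (simp add: wrap_wrap_diff algebra_simps)
    then show ?thesis
      using Suc.IH[OF wrap_in[OF True], of "v - 1" "Mp M v x"] by simp
  qed (use Suc.prems in auto)
qed

lemma submodule_path_map:
  assumes r: "r \<ge> 1" and U: "submodule r M U" and v: "v \<in> {1..r}" and x: "x \<in> U v"
  shows "path_map r M m v x \<in> U (wrap r (v - int m))"
  using v x
proof (induction m arbitrary: v x)
  case 0
  then show ?case by (simp add: wrap_id)
next
  case (Suc m)
  have "Mp M v x \<in> U (wrap r (v - 1))"
    using submoduleD(4)[OF U] Suc.prems by blast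
  from Suc.IH[OF wrap_in[OF r] this] show ?case
    by (simp add: wrap_wrap_diff algebra_simps)
qed

text \<open>The representation \<open>E\<^sub>i[n]\<close> with an explicit basis: \<open>b 0\<close> spans the socle, and each basis
  vector is mapped to the preceding one.\<close>

locale uniserial = based_rep r M "{..<n}" "\<lambda>t. wrap r (i + int t)" b co
  for r :: int and M :: "'b rep" and i :: int and n :: nat and b co +
  assumes lin: "\<And>v. v \<in> {1..r} \<Longrightarrow> lin_on (Sp M v) (Sp M (wrap r (v - 1))) (Mp M v)"
    and Mp_b: "\<And>t. t < n \<Longrightarrow> Mp M (wrap r (i + int t)) (b t) = (if t = 0 then 0 else b (t - 1))"
begin

abbreviation pos :: "nat \<Rightarrow> int"
  where "pos t \<equiv> wrap r (i + int t)"

lemma pos_Suc: "pos (Suc t) = v \<longleftrightarrow> pos t = wrap r (v - 1)" if "v \<in> {1..r}"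
proof -
  have "pos (Suc t) = wrap r (pos t + 1)"
    unfolding wrap_wrap_add by (simp add: algebra_simps)
  moreover have "pos t = wrap r (pos (Suc t) - 1)"
    by (simp add: wrap_wrap_diff)
  moreover have "wrap r (wrap r (v - 1) + 1) = v"
    using that by (simp add: wrap_wrap_add wrap_id)
  ultimately show ?thesis by metis
qed

lemma pos_add: "wrap r (pos (t + m) - int m) = pos t"
  by (simp add: wrap_wrap_diff)

lemma co_Mp:
  assumes v: "v \<in> {1..r}" and x: "x \<in> Sp M v" and t: "t < n" "pos t = wrap r (v - 1)"
  shows "co t (Mp M v x) = (if Suc t < n then co (Suc t) x else 0)"
proof -
  let ?J = "{s \<in> {..<n}. pos s = v}"
  have bJ: "b s \<in> Sp M v" if "s \<in> ?J" for s
    using that b_in[of s] by auto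
  have "Mp M v x = (\<Sum>s\<in>?J. cscale (co s x) (Mp M v (b s)))"
    by (subst expand[OF v x]) (rule lin_on_sum[OF lin[OF v] Sp_subspace[OF v] bJ])
  then have "co t (Mp M v x) = (\<Sum>s\<in>?J. co s x * co t (Mp M v (b s)))"
    using t by simp
  also have "\<dots> = (\<Sum>s\<in>?J. if s = Suc t then co s x else 0)"
  proof (rule sum.cong)
    fix s assume s: "s \<in> ?J"
    show "co s x * co t (Mp M v (b s)) = (if s = Suc t then co s x else 0)"
    proof (cases s)
      case 0
      then show ?thesis using s t Mp_b[of s] by auto
    next
      case (Suc s')
      then have "pos s' = pos t"
        using s v t pos_Suc[of v s'] by auto
      then have "co t (b s') = (if s' = t then 1 else 0)"
        using co_b[of t s'] t s Suc by auto
      then show ?thesis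
        using s Suc Mp_b[of s] by auto
    qed
  qed simp
  also have "\<dots> = (if Suc t < n then co (Suc t) x else 0)"
    using pos_Suc[OF v, of t] t by (auto simp: if_distrib)
  finally show ?thesis .
qed

lemma path_map_in: "v \<in> {1..r} \<Longrightarrow> x \<in> Sp M v \<Longrightarrow> path_map r M m v x \<in> Sp M (wrap r (v - int m))"
  using path_map_lin[OF r_pos lin, where m = m] lin_onD(1) by blast

lemma co_path_map:
  assumes "v \<in> {1..r}" "x \<in> Sp M v" "t < n" "pos t = wrap r (v - int m)"
  shows "co t (path_map r M m v x) = (if t + m < n then co (t + m) x else 0)"
  using assms
proof (induction m arbitrary: v x)
  case 0
  then show ?case by simp
next
  case (Suc m)
  have v': "wrap r (v - 1) \<in> {1..r}" by (rule wrap_in[OF r_pos])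
  have Mx: "Mp M v x \<in> Sp M (wrap r (v - 1))"
    using lin_onD(1)[OF lin] Suc.prems by blast
  have p: "pos t = wrap r (wrap r (v - 1) - int m)"
    using Suc.prems(4) by (simp add: wrap_wrap_diff algebra_simps)
  have "pos (t + m) = wrap r (pos t + int m)"
    by (simp add: wrap_wrap_add add.assoc)
  also have "\<dots> = wrap r (v - 1)"
    by (simp add: p wrap_wrap_add wrap_wrap_diff)
  finally have "t + m < n \<Longrightarrow> co (t + m) (Mp M v x) = (if Suc (t + m) < n then co (Suc (t + m)) x else 0)"
    using Suc.prems by (intro co_Mp) auto
  then show ?case
    using Suc.IH[OF v' Mx Suc.prems(3) p] by auto
qed

lemma path_map_n: "path_map r M n v x = 0" if "v \<in> {1..r}" "x \<in> Sp M v"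
proof (rule Sp_eqI[of "wrap r (v - int n)"])
  show "0 \<in> Sp M (wrap r (v - int n))"
    by (rule cvec.subspace_0[OF Sp_subspace[OF wrap_in[OF r_pos]]])
qed (use path_map_in[OF that] co_path_map[OF that] wrap_in[OF r_pos] in auto)

lemma is_rep: "is_rep r M"
  unfolding is_rep_def
proof (intro ballI conjI)
  fix v assume v: "v \<in> {1..r}"
  show "\<exists>B. finite B \<and> Sp M v = cvec.span B"
    by (rule exI[of _ "b ` {t \<in> {..<n}. pos t = v}"]) (simp add: Sp_span[OF v])
qed (rule lin)

lemma nilpotent: "nilpotent_rep r M"
  unfolding nilpotent_rep_def using is_rep path_map_n by blast

subsection \<open>Submodules\<close>

text \<open>The submodule of length \<open>t\<close>.\<close>

definition Sub :: "nat \<Rightarrow> int \<Rightarrow> 'b cvec set"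
  where "Sub t = (\<lambda>v\<in>{1..r}. {x \<in> Sp M v. \<forall>s. t \<le> s \<and> s < n \<and> pos s = v \<longrightarrow> co s x = 0})"

lemma mem_Sub: "v \<in> {1..r} \<Longrightarrow> x \<in> Sub t v \<longleftrightarrow> x \<in> Sp M v \<and> (\<forall>s. t \<le> s \<and> s < n \<and> pos s = v \<longrightarrow> co s x = 0)"
  by (simp add: Sub_def)

lemma b_in_Sub: "s < n \<Longrightarrow> b s \<in> Sub t (pos s) \<longleftrightarrow> s < t"
  using b_in[of s] vt_in[of s] co_b[of s s] co_b[of _ s] by (auto simp: mem_Sub not_less[symmetric])

lemma Sub_span:
  assumes v: "v \<in> {1..r}" and t: "t \<le> n"
  shows "Sub t v = cvec.span (b ` {s. s < t \<and> pos s = v})"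
proof (intro equalityI)
  show "Sub t v \<subseteq> cvec.span (b ` {s. s < t \<and> pos s = v})"
  proof
    fix x assume "x \<in> Sub t v"
    then have x: "x \<in> Sp M v" "\<And>s. t \<le> s \<Longrightarrow> s < n \<Longrightarrow> pos s = v \<Longrightarrow> co s x = 0"
      using v by (auto simp: mem_Sub)
    have "x = (\<Sum>s\<in>{s \<in> {..<n}. pos s = v}. cscale (co s x) (b s))"
      by (rule expand[OF v x(1)])
    also have "\<dots> = (\<Sum>s\<in>{s. s < t \<and> pos s = v}. cscale (co s x) (b s))"
      using t x(2) by (intro sum.mono_neutral_right) (auto simp: not_less)
    finally show "x \<in> cvec.span (b ` {s. s < t \<and> pos s = v})"
      using cvec.sum_in_span_family[of "\<lambda>s. co s x" b "{s. s < t \<and> pos s = v}"] by simp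
  qed
  have "cvec.subspace (Sub t v)"
    using v Sp_subspace[OF v] by (auto simp: cvec.subspace_def mem_Sub)
  then show "cvec.span (b ` {s. s < t \<and> pos s = v}) \<subseteq> Sub t v"
    using t b_in_Sub by (intro cvec.span_minimal) auto
qed

lemma submodule_Sub: "submodule r M (Sub t)"
  unfolding submodule_def
proof (intro conjI ballI)
  show "Sub t \<in> extensional {1..r}" by (simp add: Sub_def)
  fix v assume v: "v \<in> {1..r}"
  show "cvec.subspace (Sub t v)"
    using v Sp_subspace[OF v] by (auto simp: cvec.subspace_def mem_Sub)
  show "Sub t v \<subseteq> Sp M v" using v by (auto simp: mem_Sub)
  show "Mp M v ` Sub t v \<subseteq> Sub t (wrap r (v - 1))"
  proof
    fix y assume "y \<in> Mp M v ` Sub t v"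
    then obtain x where x: "x \<in> Sp M v" "\<forall>s. t \<le> s \<and> s < n \<and> pos s = v \<longrightarrow> co s x = 0" "y = Mp M v x"
      using v by (auto simp: mem_Sub)
    have "co s y = 0" if "t \<le> s" "s < n" "pos s = wrap r (v - 1)" for s
      using co_Mp[OF v x(1) that(2,3)] x(2,3) that pos_Suc[OF v, of s] by simp
    then show "y \<in> Sub t (wrap r (v - 1))"
      using lin_onD(1)[OF lin[OF v] x(1)] x(3) by (simp add: mem_Sub[OF wrap_in[OF r_pos]])
  qed
qed

text \<open>Let \<open>t - 1\<close> be the largest index at which some vector of the submodule has a non-zero
  coefficient. Since the arrows shift the coefficients, suitable paths turn this vector into
  vectors with leading terms \<open>b (t - 1), \<dots>, b 0\<close>, and by induction the basis vectors themselves
  lie in the submodule.\<close>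

lemma submodule_cases:
  assumes U: "submodule r M U"
  obtains t where "t \<le> n" "U = Sub t"
proof -
  define P where "P = {s. s < n \<and> (\<exists>x\<in>U (pos s). co s x \<noteq> 0)}"
  define t where "t = (if P = {} then 0 else Suc (Max P))"
  have finP: "finite P" by (rule finite_subset[of _ "{..<n}"]) (auto simp: P_def)
  have tP: "t - 1 \<in> P" if "t > 0"
    using that Max_in[OF finP] by (auto simp: t_def split: if_splits)
  have Pt: "s < t" if "s \<in> P" for s
    using that Max_ge[OF finP] by (auto simp: t_def less_Suc_eq_le)
  have tn: "t \<le> n"
    using tP by (cases "t = 0") (auto simp: P_def)
  have sub: "cvec.subspace (U v)" "U v \<subseteq> Sp M v" if "v \<in> {1..r}" for v
    using U that by (auto simp: submodule_def)
  have bU: "b s \<in> U (pos s)" if "s < t" for s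
    using that
  proof (induction s rule: less_induct)
    case (less s)
    have "t - 1 \<in> P" using tP less.prems by simp
    then obtain x where x: "x \<in> U (pos (t - 1))" "co (t - 1) x \<noteq> 0" by (auto simp: P_def)
    have v: "pos (t - 1) \<in> {1..r}" and w: "pos s \<in> {1..r}" by (rule wrap_in[OF r_pos])+
    define m where "m = t - 1 - s"
    have sm: "t - 1 = s + m" using less.prems by (simp add: m_def)
    define y where "y = path_map r M m (pos (t - 1)) x"
    have ps: "wrap r (pos (t - 1) - int m) = pos s" unfolding sm by (rule pos_add)
    have y: "y \<in> U (pos s)"
      using submodule_path_map[OF r_pos U v x(1), of m] unfolding y_def ps .
    have xS: "x \<in> Sp M (pos (t - 1))" using x(1) sub(2)[OF v] by auto
    have cy: "co u y = (if u + m < n then co (u + m) x else 0)" if "u < n" "pos u = pos s" for u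
      using co_path_map[OF v xS that(1), of m] that(2) unfolding y_def ps by simp
    have cs: "co s y \<noteq> 0"
      using cy[of s] x(2) less.prems tn sm by auto
    have cu: "co u y = 0" if "u < n" "pos u = pos s" "s < u" for u
    proof (cases "u + m < n")
      case True
      have "pos (u + m) = wrap r (pos u + int m)" by (simp add: wrap_wrap_add add.assoc)
      also have "\<dots> = pos (s + m)" unfolding that(2) by (simp add: wrap_wrap_add add.assoc)
      finally have "x \<in> U (pos (u + m))" using x(1) unfolding sm by simp
      moreover have "u + m \<notin> P"
      proof
        assume "u + m \<in> P"
        then have "u + m < t" by (rule Pt)
        then show False using that(3) sm by linarith
      qed
      ultimately have "co (u + m) x = 0"
        using True unfolding P_def by blast
      then show ?thesis using cy[OF that(1,2)] by simp
    qed (use cy[OF that(1,2)] in simp)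
    let ?J = "{u \<in> {..<n}. pos u = pos s}"
    have sJ: "s \<in> ?J" using less.prems tn by auto
    have "y = (\<Sum>u\<in>?J. cscale (co u y) (b u))"
      using y sub(2)[OF w] by (intro expand[OF w]) auto
    also have "\<dots> = cscale (co s y) (b s) + (\<Sum>u\<in>?J - {s}. cscale (co u y) (b u))"
      by (rule sum.remove) (use sJ in auto)
    finally have y_eq: "y = cscale (co s y) (b s) + (\<Sum>u\<in>?J - {s}. cscale (co u y) (b u))" .
    have "(\<Sum>u\<in>?J - {s}. cscale (co u y) (b u)) \<in> U (pos s)"
    proof (rule cvec.subspace_sum[OF sub(1)[OF w]])
      fix u assume u: "u \<in> ?J - {s}"
      show "cscale (co u y) (b u) \<in> U (pos s)"
      proof (cases "u < s")
        case True
        then have "b u \<in> U (pos s)" using less.IH[of u] less.prems u by auto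
        then show ?thesis by (rule cvec.subspace_scale[OF sub(1)[OF w]])
      next
        case False
        then have "co u y = 0" using u by (intro cu) auto
        then show ?thesis using cvec.subspace_0[OF sub(1)[OF w]] by simp
      qed
    qed
    then have "y - (\<Sum>u\<in>?J - {s}. cscale (co u y) (b u)) \<in> U (pos s)"
      by (rule cvec.subspace_diff[OF sub(1)[OF w] y])
    moreover have "cscale (co s y) (b s) = y - (\<Sum>u\<in>?J - {s}. cscale (co u y) (b u))"
      unfolding eq_diff_eq by (rule y_eq[symmetric])
    ultimately have "cscale (co s y) (b s) \<in> U (pos s)" by simp
    then have "cscale (inverse (co s y)) (cscale (co s y) (b s)) \<in> U (pos s)"
      by (rule cvec.subspace_scale[OF sub(1)[OF w]])
    then show ?case using cs by simp
  qed
  have "U v = Sub t v" for v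
  proof (cases "v \<in> {1..r}")
    case True
    show ?thesis
    proof (intro equalityI subsetI)
      fix x assume x: "x \<in> U v"
      have "co s x = 0" if "t \<le> s" "s < n" "pos s = v" for s
        using Pt[of s] that x by (auto simp: P_def)
      then show "x \<in> Sub t v" using sub(2)[OF True] x True by (auto simp: mem_Sub)
    next
      fix x assume "x \<in> Sub t v"
      moreover have "cvec.span (b ` {s. s < t \<and> pos s = v}) \<subseteq> U v"
        using bU by (intro cvec.span_minimal sub(1)[OF True]) auto
      ultimately show "x \<in> U v" by (auto simp: Sub_span[OF True tn])
    qed
  next
    case False
    then show ?thesis
      using submodule_undefined[OF U False] submodule_undefined[OF submodule_Sub False] by simp
  qed
  then have "U = Sub t" by (rule ext)
  then show thesis using that tn by blast
qed

lemma dim_Sub: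
  assumes "v \<in> {1..r}" "t \<le> n"
  shows "cvec.dim (Sub t v) = card {s. s < t \<and> pos s = v}"
proof -
  have "cvec.indep_family {s. s < t \<and> pos s = v} b"
  proof (rule cvec.indep_family_subset[OF indep[of v]])
    show "finite {s \<in> {..<n}. pos s = v}" by simp
    show "{s. s < t \<and> pos s = v} \<subseteq> {s \<in> {..<n}. pos s = v}"
      using assms(2) by (intro Collect_mono) simp
  qed
  from cvec.dim_span_family[OF _ this] show ?thesis
    by (simp add: Sub_span[OF assms])
qed

lemma Sub_le_iff: "s \<le> n \<Longrightarrow> Sub s \<le> Sub t \<longleftrightarrow> s \<le> t"
proof
  assume s: "s \<le> n" and le: "Sub s \<le> Sub t"
  show "s \<le> t"
  proof (rule ccontr)
    assume "\<not> s \<le> t"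
    then have "b t \<in> Sub s (pos t)" "b t \<notin> Sub t (pos t)"
      using b_in_Sub[of t s] b_in_Sub[of t t] s by auto
    then show False using le by (auto simp: le_fun_def)
  qed
next
  assume st: "s \<le> t"
  have "Sub s v \<subseteq> Sub t v" for v
  proof (cases "v \<in> {1..r}")
    case True
    show ?thesis
    proof
      fix x assume "x \<in> Sub s v"
      then show "x \<in> Sub t v"
        using st le_trans[OF st] unfolding mem_Sub[OF True] by blast
    qed
  next
    case False
    then show ?thesis
      using submodule_undefined[OF submodule_Sub False] by simp
  qed
  then show "Sub s \<le> Sub t" by (simp add: le_fun_def)
qed

lemma Sub_eq_iff: "s \<le> n \<Longrightarrow> t \<le> n \<Longrightarrow> Sub s = Sub t \<longleftrightarrow> s = t"
  using Sub_le_iff[of s t] Sub_le_iff[of t s] by auto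

lemma Sub_0: "Sub 0 = zero_sub r"
proof
  fix v show "Sub 0 v = zero_sub r v"
  proof (cases "v \<in> {1..r}")
    case True
    have "Sub 0 v = {0}" using Sub_span[OF True le0] by simp
    then show ?thesis using True by (simp only: zero_sub_def restrict_apply if_True)
  next
    case False
    show ?thesis by (simp only: Sub_def zero_sub_def restrict_apply False if_False)
  qed
qed

lemma Sub_n: "Sub n = full_sub r M"
  unfolding Sub_def full_sub_def by (intro restrict_ext) auto

text \<open>The submodules form a chain, so a composition series has to run through all of them.\<close>

lemma has_length_iff: "has_length r M N \<longleftrightarrow> N = n"
proof
  assume "has_length r M N"
  then obtain U where U: "U 0 = zero_sub r" "U N = full_sub r M" "\<And>t. t \<le> N \<Longrightarrow> submodule r M (U t)"
    "\<And>t. t < N \<Longrightarrow> U t < U (Suc t)"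
    "\<And>t W. t < N \<Longrightarrow> submodule r M W \<Longrightarrow> U t \<le> W \<Longrightarrow> W \<le> U (Suc t) \<Longrightarrow> W = U t \<or> W = U (Suc t)"
    unfolding has_length_def by blast
  have "U t = Sub t \<and> t \<le> n" if "t \<le> N" for t
    using that
  proof (induction t)
    case 0
    then show ?case using U(1) Sub_0 by simp
  next
    case (Suc t)
    then have IH: "U t = Sub t" "t \<le> n" by auto
    obtain u where u: "u \<le> n" "U (Suc t) = Sub u"
      using submodule_cases U(3)[OF Suc.prems] by blast
    have "Sub t < Sub u" using U(4)[of t] Suc.prems IH u by simp
    then have tu: "t < u"
      using Sub_le_iff[of u t] u(1) by (simp add: less_le_not_le[of "Sub t"])
    have "Sub (Suc t) = U t \<or> Sub (Suc t) = U (Suc t)"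
      using tu Suc.prems u IH by (intro U(5) submodule_Sub) (auto simp: Sub_le_iff)
    then show ?case
      using tu u IH by (auto simp: Sub_eq_iff)
  qed
  from this[of N] have UN: "U N = Sub N" "N \<le> n" by auto
  have "Sub N = Sub n"
    using UN(1) U(2) Sub_n by (metis (no_types))
  then show "N = n" unfolding Sub_eq_iff[OF UN(2) order_refl] .
next
  assume N: "N = n"
  show "has_length r M N"
    unfolding has_length_def N
  proof (rule exI[of _ Sub], intro conjI allI impI)
    show "Sub 0 = zero_sub r" by (rule Sub_0)
    show "Sub n = full_sub r M" by (rule Sub_n)
    show "submodule r M (Sub t)" for t by (rule submodule_Sub)
  next
    fix t assume t: "t < n"
    then have tn: "t \<le> n" "Suc t \<le> n" by simp_all
    show "Sub t < Sub (Suc t)"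
      unfolding less_le_not_le[of "Sub t" "Sub (Suc t)"] Sub_le_iff[OF tn(1)] Sub_le_iff[OF tn(2)] by simp
    fix W assume W: "submodule r M W \<and> Sub t \<le> W \<and> W \<le> Sub (Suc t)"
    then obtain u where u: "u \<le> n" "W = Sub u" using submodule_cases by blast
    have "t \<le> u" "u \<le> Suc t"
      using W Sub_le_iff[OF tn(1), of u] Sub_le_iff[OF u(1), of "Suc t"] u(2) by blast+
    then show "W = Sub t \<or> W = Sub (Suc t)"
      using u(2) le_Suc_eq[of u t] by auto
  qed
qed

lemma simple_Sub_iff:
  assumes t: "t \<le> n"
  shows "is_simple r (subrep M (Sub t)) \<longleftrightarrow> t = 1"
proof
  assume S: "is_simple r (subrep M (Sub t))"
  then have "Sub t \<noteq> Sub 0"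
    by (simp add: is_simple_def full_sub_subrep[OF submodule_Sub] Sub_0)
  then have "t > 0" by (cases t) auto
  then have "submodule r (subrep M (Sub t)) (Sub 1)"
    using t by (auto simp: submodule_subrep_iff[OF submodule_Sub] submodule_Sub Sub_le_iff)
  then have "Sub 1 = Sub 0 \<or> Sub 1 = Sub t"
    using S by (simp add: is_simple_def full_sub_subrep[OF submodule_Sub] Sub_0)
  then show "t = 1" using Sub_eq_iff[of 1 0] Sub_eq_iff[of 1 t] t \<open>t > 0\<close> by auto
next
  assume t1: "t = 1"
  have "is_rep r (subrep M (Sub 1))"
    unfolding is_rep_def
  proof (intro ballI conjI)
    fix v assume v: "v \<in> {1..r}"
    show "\<exists>B. finite B \<and> Sp (subrep M (Sub 1)) v = cvec.span B"
      using Sub_span[OF v, of 1] t t1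
      by (intro exI[of _ "b ` {s. s < 1 \<and> pos s = v}"]) (simp add: subrep_def)
    show "lin_on (Sp (subrep M (Sub 1)) v) (Sp (subrep M (Sub 1)) (wrap r (v - 1))) (Mp (subrep M (Sub 1)) v)"
      using lin_on_subset[OF lin[OF v] submoduleD(2,3)[OF submodule_Sub v]] by (simp add: subrep_def)
  qed
  moreover have "full_sub r (subrep M (Sub 1)) \<noteq> zero_sub r"
    using Sub_eq_iff[of 1 0] t t1 by (simp add: full_sub_subrep[OF submodule_Sub] Sub_0)
  moreover have "W = zero_sub r \<or> W = Sub 1" if "submodule r (subrep M (Sub 1)) W" for W
  proof -
    have "submodule r M W" "W \<le> Sub 1" using that submodule_subrep_iff[OF submodule_Sub] by auto
    then obtain u where "u \<le> n" "W = Sub u" "Sub u \<le> Sub 1" using submodule_cases by blast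
    then show ?thesis using Sub_le_iff[of u 1] Sub_0 by (cases u) auto
  qed
  ultimately show "is_simple r (subrep M (Sub t))"
    using t1 by (simp add: is_simple_def full_sub_subrep[OF submodule_Sub])
qed

text \<open>Two non-zero submodules both contain the socle.\<close>

lemma indecomposable: "indecomposable r M" if "n > 0"
  unfolding indecomposable_def
proof (intro conjI allI impI)
  show "full_sub r M \<noteq> zero_sub r"
    using that Sub_eq_iff[of n 0] by (simp add: Sub_n Sub_0)
  fix U W assume "submodule r M U" "submodule r M W"
    and *: "\<forall>v\<in>{1..r}. U v \<inter> W v = {0} \<and> Sp M v = {u + w |u w. u \<in> U v \<and> w \<in> W v}"
  then obtain s t where st: "s \<le> n" "U = Sub s" "t \<le> n" "W = Sub t"
    using submodule_cases by metis
  show "U = zero_sub r \<or> W = zero_sub r"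
  proof (rule ccontr)
    assume "\<not> (U = zero_sub r \<or> W = zero_sub r)"
    then have "s > 0" "t > 0" using st Sub_0 by auto
    then have "b 0 \<in> U (pos 0) \<inter> W (pos 0)"
      using that st b_in_Sub[of 0] by auto
    moreover have "pos 0 \<in> {1..r}" by (rule wrap_in[OF r_pos])
    ultimately have "b 0 = 0" using * by blast
    then show False using co_b[of 0 0] that by simp
  qed
qed (rule is_rep)

lemma socle_eq: "socle r M = Sub 1" if "n > 0"
proof
  fix v
  show "socle r M v = Sub 1 v"
  proof (cases "v \<in> {1..r}")
    case True
    have "{U v |U. submodule r M U \<and> is_simple r (subrep M U)} = {Sub 1 v}"
    proof (intro equalityI subsetI)
      fix X assume "X \<in> {U v |U. submodule r M U \<and> is_simple r (subrep M U)}"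
      then obtain U where U: "X = U v" "submodule r M U" "is_simple r (subrep M U)" by blast
      obtain t where "t \<le> n" "U = Sub t" using U(2) submodule_cases by blast
      then show "X \<in> {Sub 1 v}" using U simple_Sub_iff by auto
    next
      fix X assume "X \<in> {Sub 1 v}"
      then show "X \<in> {U v |U. submodule r M U \<and> is_simple r (subrep M U)}"
        using submodule_Sub[of 1] simple_Sub_iff[of 1] that by auto
    qed
    moreover have "cvec.span (Sub 1 v) = Sub 1 v"
      using submodule_Sub[of 1] True by (simp add: submodule_def cvec.span_eq_iff)
    ultimately show ?thesis using True by (simp add: socle_def)
  next
    case False
    show ?thesis by (simp only: Sub_def socle_def restrict_apply False if_False)
  qed
qed

lemma socle_iso_simple: "rep_iso r (subrep M (socle r M)) (simple_rep r i)" if n: "n > 0"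
proof -
  define phi :: "int \<Rightarrow> 'b cvec \<Rightarrow> nat cvec" where "phi = (\<lambda>v x. if v = pos 0 then (\<lambda>p. if p = 0 then co 0 x else 0) else 0)"
  have S: "Sub 1 v = (if v = pos 0 then cvec.span {b 0} else {0})" if "v \<in> {1..r}" for v
  proof -
    have "{s. s < 1 \<and> pos s = v} = (if v = pos 0 then {0} else {})" by auto
    then show ?thesis using Sub_span[OF that, of 1] n by simp
  qed
  have c0: "co 0 (b 0) = 1" using co_b[of 0 0] n by simp
  show ?thesis
    unfolding rep_iso_def socle_eq[OF n]
  proof (intro exI[of _ phi] ballI conjI)
    fix v assume v: "v \<in> {1..r}"
    show "lin_on (Sp (subrep M (Sub 1)) v) (Sp (simple_rep r i) v) (phi v)"
      using n co_scale[of 0] by (auto simp: lin_on_def subrep_def simple_rep_def phi_def fun_eq_iff)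
        (simp_all add: cscale_def)
    show "bij_betw (phi v) (Sp (subrep M (Sub 1)) v) (Sp (simple_rep r i) v)"
    proof (cases "v = pos 0")
      case True
      have "bij_betw (phi v) (cvec.span {b 0}) {x. \<forall>p>0. x p = 0}"
      proof (rule bij_betw_byWitness[where f' = "\<lambda>x. cscale (x 0) (b 0)"])
        show "\<forall>x\<in>cvec.span {b 0}. cscale (phi v x 0) (b 0) = x"
          using True n c0 by (auto simp: phi_def cvec.span_singleton)
        show "\<forall>x\<in>{x. \<forall>p>0. x p = 0}. phi v (cscale (x 0) (b 0)) = x"
          using True n c0 by (auto simp: phi_def fun_eq_iff)
        show "phi v ` cvec.span {b 0} \<subseteq> {x. \<forall>p>0. x p = 0}"
          using True by (auto simp: phi_def)
        show "(\<lambda>x. cscale (x 0) (b 0)) ` {x. \<forall>p>0. x p = 0} \<subseteq> cvec.span {b 0}"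
          by (auto simp: cvec.span_singleton)
      qed
      then show ?thesis using True v S[OF v] by (simp add: subrep_def simple_rep_def)
    next
      case False
      then show ?thesis using v S[OF v] by (auto simp: subrep_def simple_rep_def phi_def bij_betw_def)
    qed
    fix x assume x: "x \<in> Sp (subrep M (Sub 1)) v"
    have "Mp M v x = 0"
    proof (cases "v = pos 0")
      case True
      then obtain c where "x = cscale c (b 0)"
        using x S[OF v] by (auto simp: subrep_def cvec.span_singleton)
      then show ?thesis
        using lin_onD(3)[OF lin[OF v]] b_in[of 0] Mp_b[of 0] True n by simp
    next
      case False
      then have "x = cscale 0 x" "x \<in> Sp M v"
        using x S[OF v] cvec.subspace_0[OF Sp_subspace[OF v]] by (auto simp: subrep_def)
      then show ?thesis using lin_onD(3)[OF lin[OF v], of x 0] by simp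
    qed
    then have "Mp (subrep M (Sub 1)) v x = 0" by (simp add: subrep_def)
    moreover have "phi (wrap r (v - 1)) 0 = Mp (simple_rep r i) v (phi v x)"
      using n co_zero[of 0] unfolding phi_def simple_rep_def by (simp del: zero_fun_apply) auto
    ultimately show "phi (wrap r (v - 1)) (Mp (subrep M (Sub 1)) v x) = Mp (simple_rep r i) v (phi v x)"
      by simp
  qed
qed

end

section \<open>The modules \<open>E\<^sub>i[n]\<close>\<close>

lemma ex_dual_basis:
  assumes r: "r \<ge> 1" and I: "finite I" "\<And>a. a \<in> I \<Longrightarrow> vt a \<in> {1..r}"
    and sub: "\<And>v. v \<in> {1..r} \<Longrightarrow> cvec.subspace (Sp M v)"
    and b: "\<And>a. a \<in> I \<Longrightarrow> b a \<in> Sp M (vt a)"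
    and ind: "\<And>v. v \<in> {1..r} \<Longrightarrow> cvec.indep_family {a \<in> I. vt a = v} b"
    and span: "\<And>v. v \<in> {1..r} \<Longrightarrow> Sp M v \<subseteq> cvec.span (b ` {a \<in> I. vt a = v})"
  obtains co where "based_rep r M I vt b co"
proof -
  have fin: "finite {a \<in> I. vt a = v}" for v using I(1) by simp
  let ?Q = "\<lambda>v f. (\<forall>a\<in>{a \<in> I. vt a = v}. linear_functional (f a)) \<and>
      (\<forall>a\<in>{a \<in> I. vt a = v}. \<forall>a'\<in>{a \<in> I. vt a = v}. f a (b a') = (if a' = a then 1 else 0))"
  have "\<exists>f. ?Q v f" if v: "v \<in> {1..r}" for v
    by (rule ex_dual_family[OF fin ind[OF v]]) blast
  then have "\<forall>v\<in>{1..r}. \<exists>f. ?Q v f" by (intro ballI)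
  from bchoice[OF this] obtain f where f': "\<forall>v\<in>{1..r}. ?Q v (f v)" ..
  have f: "linear_functional (f v a)" "a' \<in> I \<Longrightarrow> vt a' = v \<Longrightarrow> f v a (b a') = (if a' = a then 1 else 0)"
    if "v \<in> {1..r}" "a \<in> I" "vt a = v" for v a a'
    using bspec[OF f' that(1)] that(2,3) by simp_all
  define co where "co a = f (vt a) a" for a
  have "based_rep r M I vt b co"
  proof
    show "linear_functional (co a)" if "a \<in> I" for a
      unfolding co_def by (rule f(1)[OF I(2)]) (use that in simp_all)
    show co_b: "co a (b a') = (if a' = a then 1 else 0)" if "a \<in> I" "a' \<in> I" "vt a' = vt a" for a a'
      unfolding co_def by (rule f(2)[OF I(2)]) (use that in simp_all)
    fix v x assume v: "v \<in> {1..r}" and x: "x \<in> Sp M v"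
    let ?J = "{a \<in> I. vt a = v}"
    obtain c where c: "x = (\<Sum>a\<in>?J. cscale (c a) (b a))"
      using x span[OF v] cvec.span_family[OF fin[of v], of b] by auto
    have "co a x = c a" if a: "a \<in> ?J" for a
    proof -
      have lf: "linear_functional (co a)"
        unfolding co_def by (rule f(1)[OF I(2)]) (use a in simp_all)
      have "co a x = (\<Sum>a'\<in>?J. c a' * co a (b a'))"
        unfolding c linear_functional_sum[OF lf] using lf by (simp add: linear_functional_def)
      also have "\<dots> = (\<Sum>a'\<in>?J. if a' = a then c a' else 0)"
        using a by (intro sum.cong) (simp_all add: co_b)
      finally show ?thesis using a I(1) by simp
    qed
    then show "x = (\<Sum>a\<in>?J. cscale (co a x) (b a))"
      unfolding c by (intro sum.cong) simp_all
  qed (use r I sub b in simp_all)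
  then show thesis by (rule that)
qed

lemma path_map_eq_0_mono:
  assumes r: "r \<ge> 1" and M: "\<And>v. v \<in> {1..r} \<Longrightarrow> lin_on (Sp M v) (Sp M (wrap r (v - 1))) (Mp M v)"
    and sub: "\<And>v. v \<in> {1..r} \<Longrightarrow> cvec.subspace (Sp M v)"
    and v: "v \<in> {1..r}" and 0: "path_map r M m v x = 0" and le: "m \<le> m'"
  shows "path_map r M m' v x = 0"
  using le
proof (induction m' rule: dec_induct)
  case (step m')
  have w: "wrap r (v - int m') \<in> {1..r}" by (rule wrap_in[OF r])
  show ?case
    unfolding path_map_Suc'[OF v] step.IH
    using lin_onD(3)[OF M[OF w] cvec.subspace_0[OF sub[OF w]], of 0] by simp
qed (rule 0)

text \<open>A non-zero vector killed by the arrow at its vertex spans a one-dimensional submodule,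
  which is simple.\<close>

lemma kernel_subset_socle:
  assumes r: "r \<ge> 1" and M: "\<And>v. v \<in> {1..r} \<Longrightarrow> lin_on (Sp M v) (Sp M (wrap r (v - 1))) (Mp M v)"
    and sub: "\<And>v. v \<in> {1..r} \<Longrightarrow> cvec.subspace (Sp M v)"
    and v: "v \<in> {1..r}" and x: "x \<in> Sp M v" "Mp M v x = 0" "x \<noteq> 0"
  shows "x \<in> socle r M v"
proof -
  define U where "U = (\<lambda>u\<in>{1..r}. if u = v then cvec.span {x} else {0})"
  have U: "U u = (if u = v then cvec.span {x} else {0})" if "u \<in> {1..r}" for u
    using that by (simp only: U_def restrict_apply if_True)
  have Mp0: "Mp M u 0 = 0" if "u \<in> {1..r}" for u
    using lin_onD(3)[OF M[OF that] cvec.subspace_0[OF sub[OF that]], of 0] by simp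
  have MU: "Mp M u z = 0" if "u \<in> {1..r}" "z \<in> U u" for u z
    using that Mp0[OF that(1)] lin_onD(3)[OF M[OF v] x(1)] x(2)
    by (auto simp: U cvec.span_singleton split: if_splits)
  have USp: "U u \<subseteq> Sp M u" if "u \<in> {1..r}" for u
    using U[OF that] cvec.span_minimal[of "{x}", OF _ sub[OF v]] cvec.subspace_0[OF sub[OF that]] x(1)
    by (cases "u = v") simp_all
  have subU: "cvec.subspace (U u)" if "u \<in> {1..r}" for u
    using U[OF that] by simp
  have smU: "submodule r M U"
    unfolding submodule_def
  proof (intro conjI ballI)
    show "U \<in> extensional {1..r}" unfolding U_def by (rule restrict_extensional)
    fix u assume u: "u \<in> {1..r}"
    show "cvec.subspace (U u)" "U u \<subseteq> Sp M u" by (rule subU[OF u], rule USp[OF u])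
    show "Mp M u ` U u \<subseteq> U (wrap r (u - 1))"
      using MU[OF u] cvec.subspace_0[OF subU[OF wrap_in[OF r]]] by (intro image_subsetI) simp
  qed
  have "is_simple r (subrep M U)"
    unfolding is_simple_def full_sub_subrep[OF smU] submodule_subrep_iff[OF smU]
  proof (intro conjI allI impI)
    show "is_rep r (subrep M U)"
      unfolding is_rep_def
    proof (intro ballI conjI)
      fix u assume u: "u \<in> {1..r}"
      show "\<exists>B. finite B \<and> Sp (subrep M U) u = cvec.span B"
        by (rule exI[of _ "if u = v then {x} else {}"]) (simp add: subrep_def U[OF u])
      show "lin_on (Sp (subrep M U) u) (Sp (subrep M U) (wrap r (u - 1))) (Mp (subrep M U) u)"
        using lin_on_subset[OF M[OF u] submoduleD(2,3)[OF smU u]] by (simp add: subrep_def)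
    qed
    show "U \<noteq> zero_sub r"
    proof
      assume "U = zero_sub r"
      then have "U v = {0}" using v by (simp only: zero_sub_def restrict_apply if_True)
      then show False using U[OF v] cvec.span_base[of x "{x}"] x(3) by auto
    qed
    fix W assume W: "submodule r M W \<and> W \<le> U"
    have WU: "W u \<subseteq> U u" for u using W by (simp add: le_fun_def)
    have W0: "0 \<in> W u" if "u \<in> {1..r}" for u
      using submoduleD(1)[OF conjunct1[OF W] that] by (rule cvec.subspace_0)
    have out: "W u = undefined" "U u = undefined" "zero_sub r u = undefined" if "u \<notin> {1..r}" for u
      using submodule_undefined[OF _ that] W smU that by (auto simp only: zero_sub_def restrict_apply if_False)
    show "W = zero_sub r \<or> W = U"
    proof (cases "W v \<subseteq> {0}")
      case True
      have "W u = zero_sub r u" for u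
      proof (cases "u \<in> {1..r}")
        case u: True
        have "W u = {0}" using True W0[OF u] WU[of u] U[OF u] by (cases "u = v") auto
        then show ?thesis using u by (simp only: zero_sub_def restrict_apply if_True)
      next
        case u: False
        show ?thesis by (simp only: out[OF u])
      qed
      then show ?thesis by (intro disjI1 ext)
    next
      case False
      then obtain z where z: "z \<in> W v" "z \<noteq> 0" by blast
      then have "z \<in> cvec.span {x}" using WU[of v] U[OF v] by auto
      then obtain c where "z = cscale c x" unfolding cvec.span_singleton by blast
      with z have c: "cscale c x \<in> W v" "cscale c x \<noteq> 0" by simp_all
      then have "cscale (inverse c) (cscale c x) \<in> W v"
        using cvec.subspace_scale[OF submoduleD(1)[OF conjunct1[OF W] v]] by blast
      then have "x \<in> W v" using c(2) by simp
      then have "cvec.span {x} \<subseteq> W v"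
        by (intro cvec.span_minimal submoduleD(1)[OF conjunct1[OF W] v]) simp
      then have "W u = U u" for u
      proof (cases "u \<in> {1..r}")
        case u: True
        assume "cvec.span {x} \<subseteq> W v"
        then show ?thesis using WU[of u] W0[OF u] U[OF u] by (cases "u = v") auto
      next
        case u: False
        show ?thesis by (simp only: out[OF u])
      qed
      then show ?thesis by (intro disjI2 ext)
    qed
  qed
  then have "U v \<subseteq> \<Union>{U v | U. submodule r M U \<and> is_simple r (subrep M U)}"
    using smU by blast
  moreover have "x \<in> U v" using U[OF v] by (simp add: cvec.span_base)
  ultimately have "x \<in> cvec.span (\<Union>{U v | U. submodule r M U \<and> is_simple r (subrep M U)})"
    by (intro cvec.span_base) blast
  then show ?thesis using v by (simp only: socle_def restrict_apply if_True)
qed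

text \<open>By the preceding inclusion the vectors killed by the arrows form at most a line, at the
  vertex of the socle. Nilpotency ensures that this line is not zero: along a path starting at a
  socle vector, the last non-zero vector is killed.\<close>

lemma kernel_of_simple_socle:
  assumes r: "r \<ge> 1" and nil: "nilpotent_rep r M"
    and iso: "rep_iso r (subrep M (socle r M)) (simple_rep r i)"
  obtains y where "y \<in> Sp M (wrap r i)" "y \<noteq> 0" "Mp M (wrap r i) y = 0"
    "\<And>v x. v \<in> {1..r} \<Longrightarrow> x \<in> Sp M v \<Longrightarrow> Mp M v x = 0 \<Longrightarrow> \<exists>c. x = (if v = wrap r i then cscale c y else 0)"
proof -
  have lin: "lin_on (Sp M v) (Sp M (wrap r (v - 1))) (Mp M v)" if "v \<in> {1..r}" for v
    using nil that by (auto simp only: nilpotent_rep_def is_rep_def)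
  have sub: "cvec.subspace (Sp M v)" if v: "v \<in> {1..r}" for v
  proof -
    obtain B where "Sp M v = cvec.span B"
      using nil v by (auto simp only: nilpotent_rep_def is_rep_def)
    then show ?thesis by simp
  qed
  let ?w = "wrap r i"
  have w: "?w \<in> {1..r}" by (rule wrap_in[OF r])
  let ?S = "socle r M" and ?T = "\<lambda>v. Sp (simple_rep r i) v"
  have Ssub: "Sp (subrep M ?S) v = ?S v" for v by (simp add: subrep_def)
  obtain phi where phi': "\<forall>v\<in>{1..r}. lin_on (?S v) (?T v) (phi v) \<and> bij_betw (phi v) (?S v) (?T v) \<and>
      (\<forall>x\<in>?S v. phi (wrap r (v - 1)) (Mp (subrep M ?S) v x) = Mp (simple_rep r i) v (phi v x))"
    using iso unfolding rep_iso_def Ssub by (elim exE)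
  have phi: "lin_on (?S v) (?T v) (phi v)" "bij_betw (phi v) (?S v) (?T v)" if "v \<in> {1..r}" for v
  proof -
    note * = bspec[OF phi' that]
    show "lin_on (?S v) (?T v) (phi v)" by (rule conjunct1[OF *])
    show "bij_betw (phi v) (?S v) (?T v)" by (rule conjunct1[OF conjunct2[OF *]])
  qed
  have S: "?S v = cvec.span (\<Union>{U v | U. submodule r M U \<and> is_simple r (subrep M U)})" if "v \<in> {1..r}" for v
    using that by (simp only: socle_def restrict_apply if_True)
  have subS: "cvec.subspace (?S v)" if "v \<in> {1..r}" for v
    unfolding S[OF that] by (rule cvec.subspace_span)
  have S_Sp: "?S v \<subseteq> Sp M v" if "v \<in> {1..r}" for v
    unfolding S[OF that]
  proof (rule cvec.span_minimal[OF _ sub[OF that]])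
    show "\<Union>{U v | U. submodule r M U \<and> is_simple r (subrep M U)} \<subseteq> Sp M v"
      using submoduleD(2)[OF _ that, of M] by blast
  qed
  have phi0: "phi v 0 = 0" if "v \<in> {1..r}" for v
    using lin_onD(3)[OF phi(1)[OF that] cvec.subspace_0[OF subS[OF that]], of 0] by simp
  have S0: "x = 0" if "v \<in> {1..r}" "v \<noteq> ?w" "x \<in> ?S v" for v x
  proof -
    have "phi v x = 0" using lin_onD(1)[OF phi(1)[OF that(1)] that(3)] that(2) by (simp add: simple_rep_def)
    then show ?thesis
      using phi0[OF that(1)] phi(2)[OF that(1)] that(3) cvec.subspace_0[OF subS[OF that(1)]]
      by (metis bij_betw_def inj_on_def)
  qed
  have T: "?T ?w = {x. \<forall>p>0. x p = 0}"
    by (simp add: simple_rep_def)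
  have "(\<lambda>p. if p = 0 then 1 else 0) \<in> phi ?w ` ?S ?w"
    using phi(2)[OF w] unfolding bij_betw_def T by auto
  then obtain z where z: "z \<in> ?S ?w" "phi ?w z = (\<lambda>p. if p = 0 then 1 else 0)" by auto
  have z0: "z \<noteq> 0"
  proof
    assume "z = 0"
    then have "phi ?w z = 0" using phi0[OF w] by simp
    then have "phi ?w z 0 = 0" by (simp only: zero_fun_apply)
    then show False using z(2) by simp
  qed
  obtain n0 where n0: "\<forall>v\<in>{1..r}. \<forall>x\<in>Sp M v. path_map r M n0 v x = 0"
    using nil unfolding nilpotent_rep_def by blast
  \<comment> \<open>the path just before a socle vector \<open>z\<close> is killed ends in the kernel\<close>
  define m where "m = (LEAST m. path_map r M m ?w z = 0)"
  have "path_map r M n0 ?w z = 0" using n0 w z(1) S_Sp[OF w] by blast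
  then have m: "path_map r M m ?w z = 0" unfolding m_def by (rule LeastI)
  have "m \<noteq> 0" using m z0 by (intro notI) simp
  then obtain m' where m': "m = Suc m'" by (cases m) auto
  define y where "y = path_map r M m' ?w z"
  let ?u = "wrap r (?w - int m')"
  have u: "?u \<in> {1..r}" by (rule wrap_in[OF r])
  have y0: "y \<noteq> 0"
  proof
    assume "y = 0"
    then have "m \<le> m'" unfolding m_def y_def by (rule Least_le)
    then show False using m' by simp
  qed
  have y: "y \<in> Sp M ?u"
    using lin_onD(1)[OF path_map_lin[OF r lin w]] z(1) S_Sp[OF w] unfolding y_def by blast
  have My: "Mp M ?u y = 0"
    using m unfolding m' path_map_Suc'[OF w] y_def .
  have yS: "y \<in> ?S ?u" by (rule kernel_subset_socle[OF r lin sub u y My y0])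
  have uw: "?u = ?w" using S0[OF u _ yS] y0 by blast
  show thesis
  proof (rule that[of y])
    show "y \<in> Sp M ?w" "Mp M ?w y = 0" using y My uw by simp_all
    show "y \<noteq> 0" by (rule y0)
    fix v x assume v: "v \<in> {1..r}" and x: "x \<in> Sp M v" "Mp M v x = 0"
    show "\<exists>c. x = (if v = ?w then cscale c y else 0)"
    proof (cases "x = 0")
      case True
      then show ?thesis by (intro exI[of _ 0]) simp
    next
      case False
      have xS: "x \<in> ?S v" by (rule kernel_subset_socle[OF r lin sub v x False])
      have vw: "v = ?w" using S0[OF v _ xS] False by blast
      have yS': "y \<in> ?S ?w" using yS uw by simp
      have Tx: "phi ?w x \<in> ?T ?w" and Ty: "phi ?w y \<in> ?T ?w"
        using lin_onD(1)[OF phi(1)[OF w]] xS yS' vw by auto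
      have inj: "inj_on (phi ?w) (?S ?w)" using phi(2)[OF w] by (simp add: bij_betw_def)
      have "phi ?w y 0 \<noteq> 0"
      proof
        assume "phi ?w y 0 = 0"
        then have "phi ?w y p = 0" for p using Ty unfolding T by (cases p) auto
        then have "phi ?w y = phi ?w 0" unfolding phi0[OF w] by (simp add: fun_eq_iff)
        then show False
          using inj_onD[OF inj _ yS' cvec.subspace_0[OF subS[OF w]]] y0 by blast
      qed
      then have "phi ?w x p = cscale (phi ?w x 0 / phi ?w y 0) (phi ?w y) p" for p
        using Tx Ty unfolding T by (cases p) (auto simp: cscale_def)
      then have "phi ?w x = phi ?w (cscale (phi ?w x 0 / phi ?w y 0) y)"
        unfolding lin_onD(3)[OF phi(1)[OF w] yS'] by (rule ext)
      then have "x = cscale (phi ?w x 0 / phi ?w y 0) y"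
        using inj_onD[OF inj] xS vw cvec.subspace_scale[OF subS[OF w] yS'] by blast
      then show ?thesis using vw by auto
    qed
  qed
qed

text \<open>The basis is a longest chain of vectors, starting with a vector of the socle, in which
  each vector is mapped to its predecessor. Nilpotency bounds the length of such chains.\<close>

lemma ex_uniserial:
  assumes r: "r \<ge> 1" and nil: "nilpotent_rep r M"
    and iso: "rep_iso r (subrep M (socle r M)) (simple_rep r i)"
  obtains n b co where "uniserial r M i n b co"
proof -
  let ?pos = "\<lambda>t. wrap r (i + int t)"
  have lin: "lin_on (Sp M v) (Sp M (wrap r (v - 1))) (Mp M v)" if "v \<in> {1..r}" for v
    using nil that by (auto simp only: nilpotent_rep_def is_rep_def)
  have sub: "cvec.subspace (Sp M v)" if v: "v \<in> {1..r}" for v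
  proof -
    obtain B where "Sp M v = cvec.span B"
      using nil v by (auto simp only: nilpotent_rep_def is_rep_def)
    then show ?thesis by simp
  qed
  have pos: "?pos t \<in> {1..r}" for t by (rule wrap_in[OF r])
  have Mp0: "Mp M u 0 = 0" if "u \<in> {1..r}" for u
    using lin_onD(3)[OF lin[OF that] cvec.subspace_0[OF sub[OF that]], of 0] by simp
  have pos_Suc: "?pos (Suc s) = v \<longleftrightarrow> ?pos s = wrap r (v - 1)" if "v \<in> {1..r}" for v s
  proof
    assume "?pos (Suc s) = v"
    then have "wrap r (v - 1) = wrap r (wrap r (i + int (Suc s)) - 1)" by simp
    then show "?pos s = wrap r (v - 1)" by (simp add: wrap_wrap_diff)
  next
    assume "?pos s = wrap r (v - 1)"
    then have "wrap r (wrap r (i + int s) + 1) = wrap r (wrap r (v - 1) + 1)" by simp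
    then show "?pos (Suc s) = v"
      unfolding wrap_wrap_add using wrap_id[OF that] by (simp add: algebra_simps)
  qed
  obtain y where y: "y \<in> Sp M (wrap r i)" "y \<noteq> 0" "Mp M (wrap r i) y = 0"
    and ker: "\<And>v x. v \<in> {1..r} \<Longrightarrow> x \<in> Sp M v \<Longrightarrow> Mp M v x = 0 \<Longrightarrow>
      \<exists>c. x = (if v = wrap r i then cscale c y else 0)"
    using kernel_of_simple_socle[OF r nil iso] by blast
  define chain where "chain t b \<longleftrightarrow> b 0 = y \<and> (\<forall>s<t. b s \<in> Sp M (?pos s)) \<and>
      (\<forall>s. Suc s < t \<longrightarrow> Mp M (?pos (Suc s)) (b (Suc s)) = b s)" for t and b :: "nat \<Rightarrow> _"
  have path_chain: "path_map r M m (?pos (s + m)) (b (s + m)) = b s" if "chain t b" "s + m < t" for t b s m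
    using that(2)
  proof (induction m)
    case (Suc m)
    have "wrap r (?pos (s + Suc m) - 1) = ?pos (s + m)"
      by (simp add: wrap_wrap_diff)
    moreover have "Mp M (?pos (s + Suc m)) (b (s + Suc m)) = b (s + m)"
      using that(1) Suc.prems unfolding chain_def add_Suc_right by blast
    ultimately show ?case
      unfolding path_map.simps using Suc by simp
  qed simp
  have path_chain0: "path_map r M m (?pos s) (b s) = 0" if b: "chain t b" "s < t" "s < m" for t b s m
  proof (rule path_map_eq_0_mono[OF r lin sub pos])
    show "Suc s \<le> m" using b(3) by simp
    have "path_map r M s (?pos s) (b s) = y"
      using path_chain[OF b(1), of 0 s] b by (simp add: chain_def)
    moreover have "wrap r (?pos s - int s) = wrap r i" by (simp add: wrap_wrap_diff)
    ultimately show "path_map r M (Suc s) (?pos s) (b s) = 0"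
      unfolding path_map_Suc'[OF pos] using y(3) by simp
  qed
  obtain n0 where n0: "\<forall>v\<in>{1..r}. \<forall>x\<in>Sp M v. path_map r M n0 v x = 0"
    using nil unfolding nilpotent_rep_def by blast
  have bound: "t \<le> n0" if b: "chain t b" for t b
  proof (rule ccontr)
    assume "\<not> t \<le> n0"
    then have "path_map r M n0 (?pos n0) (b n0) = y" "b n0 \<in> Sp M (?pos n0)"
      using path_chain[OF b, of 0 n0] b by (simp_all add: chain_def)
    then show False using n0 pos y(2) by metis
  qed
  have "chain 1 (\<lambda>_. y)" using y(1) by (simp add: chain_def)
  then have "\<exists>t. (\<exists>b. chain t b) \<and> (\<forall>t'. (\<exists>b. chain t' b) \<longrightarrow> t' \<le> t)"
    using ex_has_greatest_nat[of "\<lambda>t. \<exists>b. chain t b" 1 id "Suc n0"] bound by (auto simp: less_Suc_eq_le)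
  then obtain t b where b: "chain t b" and max: "\<And>t' b'. chain t' b' \<Longrightarrow> t' \<le> t" by blast
  have t1: "t \<ge> 1" using max \<open>chain 1 (\<lambda>_. y)\<close> by blast
  have bSp: "b s \<in> Sp M (?pos s)" if "s < t" for s using b that by (simp add: chain_def)
  \<comment> \<open>A vector outside the span of a longest chain would prolong it.\<close>
  have span: "x \<in> cvec.span (b ` {s \<in> {..<t}. ?pos s = v})"
    if "v \<in> {1..r}" "x \<in> Sp M v" "path_map r M m v x = 0" for m v x
    using that
  proof (induction m arbitrary: v x)
    case 0
    then have "x = 0" by (simp only: path_map.simps)
    then show ?case using cvec.span_zero by (simp only:)
  next
    case (Suc m)
    note v = Suc.prems(1)
    have v': "wrap r (v - 1) \<in> {1..r}" by (rule wrap_in[OF r])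
    let ?J = "{s \<in> {..<t}. ?pos s = wrap r (v - 1)}"
    have "Mp M v x \<in> cvec.span (b ` ?J)"
      using Suc.prems lin_onD(1)[OF lin[OF v]] by (intro Suc.IH v') auto
    then obtain c where c: "Mp M v x = (\<Sum>s\<in>?J. cscale (c s) (b s))"
      using cvec.span_family[of ?J b] by auto
    have finJ: "finite ?J" by simp
    let ?J' = "?J - {t - 1}"
    define z where "z = (\<Sum>s\<in>?J'. cscale (c s) (b (Suc s)))"
    have bS: "b (Suc s) \<in> Sp M v" "Mp M v (b (Suc s)) = b s" if s: "s \<in> ?J'" for s
    proof -
      have *: "Suc s < t" "?pos (Suc s) = v" using s pos_Suc[OF v, of s] by auto
      show "b (Suc s) \<in> Sp M v" using bSp[OF *(1)] *(2) by simp
      show "Mp M v (b (Suc s)) = b s" using b * unfolding chain_def by metis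
    qed
    have zSp: "z \<in> Sp M v"
      unfolding z_def using bS(1) by (intro cvec.subspace_sum cvec.subspace_scale sub v)
    have "Mp M v z = (\<Sum>s\<in>?J'. cscale (c s) (Mp M v (b (Suc s))))"
      unfolding z_def by (rule lin_on_sum[OF lin[OF v] sub[OF v]]) (rule bS(1))
    also have "\<dots> = (\<Sum>s\<in>?J'. cscale (c s) (b s))"
      using bS(2) by (intro sum.cong) simp_all
    finally have Mz: "Mp M v z = (\<Sum>s\<in>?J'. cscale (c s) (b s))" .
    have xz: "x - z \<in> Sp M v" using cvec.subspace_diff[OF sub[OF v] Suc.prems(2) zSp] .
    have Mxz: "Mp M v (x - z) = Mp M v x - Mp M v z"
      using lin_onD(2)[OF lin[OF v] xz zSp] by (simp add: eq_diff_eq)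
    have top: "t - 1 \<notin> ?J \<or> c (t - 1) = 0"
    proof (rule ccontr)
      assume "\<not> (t - 1 \<notin> ?J \<or> c (t - 1) = 0)"
      then have tJ: "t - 1 \<in> ?J" and ct: "c (t - 1) \<noteq> 0" by auto
      have "Mp M v (x - z) = cscale (c (t - 1)) (b (t - 1))"
        unfolding Mxz Mz c using sum.remove[OF finJ tJ, of "\<lambda>s. cscale (c s) (b s)"] by simp
      then have Mb: "Mp M v (cscale (inverse (c (t - 1))) (x - z)) = b (t - 1)"
        using lin_onD(3)[OF lin[OF v] xz] ct by simp
      define b' where "b' = b(t := cscale (inverse (c (t - 1))) (x - z))"
      have post: "?pos t = v" using tJ pos_Suc[OF v, of "t - 1"] t1 by simp
      have "chain (Suc t) b'"
        unfolding chain_def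
      proof (intro conjI allI impI)
        show "b' 0 = y" using b t1 by (simp add: b'_def chain_def)
        show "b' s \<in> Sp M (?pos s)" if "s < Suc t" for s
          using that bSp[of s] post cvec.subspace_scale[OF sub[OF v] xz] by (cases "s = t") (auto simp: b'_def)
        fix s assume s: "Suc s < Suc t"
        show "Mp M (?pos (Suc s)) (b' (Suc s)) = b' s"
        proof (cases "Suc s = t")
          case True
          then have "Mp M (?pos (Suc s)) (b' (Suc s)) = b (t - 1)"
            using Mb post unfolding b'_def by simp
          then show ?thesis using True unfolding b'_def by auto
        next
          case False
          then show ?thesis using s b unfolding b'_def chain_def by simp
        qed
      qed
      from max[OF this] show False by simp
    qed
    have "(\<Sum>s\<in>?J. cscale (c s) (b s)) = (\<Sum>s\<in>?J'. cscale (c s) (b s))"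
      using top by (intro sum.mono_neutral_right) auto
    then have "Mp M v (x - z) = 0" unfolding Mxz Mz c by simp
    then obtain d where d: "x - z = (if v = wrap r i then cscale d y else 0)"
      using ker[OF v xz] by blast
    have "x - z \<in> cvec.span (b ` {s \<in> {..<t}. ?pos s = v})"
    proof (cases "v = wrap r i")
      case True
      have "b 0 \<in> b ` {s \<in> {..<t}. ?pos s = v}" using True t1 by (intro imageI) simp
      then have "y \<in> cvec.span (b ` {s \<in> {..<t}. ?pos s = v})"
        using b by (intro cvec.span_base) (simp add: chain_def)
      then show ?thesis using d True cvec.span_scale by simp
    qed (use d cvec.span_zero in simp)
    moreover have "z \<in> cvec.span (b ` {s \<in> {..<t}. ?pos s = v})"
      unfolding z_def
    proof (intro cvec.span_sum cvec.span_scale cvec.span_base)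
      fix s assume s: "s \<in> ?J'"
      have "Suc s \<in> {s \<in> {..<t}. ?pos s = v}" using s pos_Suc[OF v, of s] by auto
      then show "b (Suc s) \<in> b ` {s \<in> {..<t}. ?pos s = v}" by (rule imageI)
    qed
    ultimately have "x - z + z \<in> cvec.span (b ` {s \<in> {..<t}. ?pos s = v})"
      by (rule cvec.span_add)
    then show ?case by simp
  qed
  have ind: "cvec.indep_family {s \<in> {..<t}. ?pos s = v} b" if v: "v \<in> {1..r}" for v
    unfolding cvec.indep_family_def
  proof (intro allI impI, rule ccontr)
    let ?J = "{s \<in> {..<t}. ?pos s = v}"
    fix c assume c: "(\<Sum>s\<in>?J. cscale (c s) (b s)) = 0" and "\<not> (\<forall>s\<in>?J. c s = 0)"
    then have ne: "{s \<in> ?J. c s \<noteq> 0} \<noteq> {}" by blast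
    define m where "m = Max {s \<in> ?J. c s \<noteq> 0}"
    have mJ: "m \<in> ?J" "c m \<noteq> 0" using Max_in[OF _ ne] by (auto simp: m_def)
    have mx: "c s = 0" if "s \<in> ?J" "m < s" for s
    proof (rule ccontr)
      assume "c s \<noteq> 0"
      then have "s \<le> m" unfolding m_def using that by (intro Max_ge) auto
      then show False using that by simp
    qed
    have bJ: "b s \<in> Sp M v" if "s \<in> ?J" for s using bSp[of s] that by auto
    have plin: "lin_on (Sp M v) (Sp M (wrap r (v - int m))) (path_map r M m v)"
      by (rule path_map_lin[OF r lin v])
    have "path_map r M m v 0 = 0"
      using lin_onD(3)[OF plin cvec.subspace_0[OF sub[OF v]], of 0] by simp
    moreover have "path_map r M m v (\<Sum>s\<in>?J. cscale (c s) (b s)) =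
        (\<Sum>s\<in>?J. cscale (c s) (path_map r M m v (b s)))"
      by (rule lin_on_sum[OF plin sub[OF v]]) (rule bJ)
    ultimately have "0 = (\<Sum>s\<in>?J. cscale (c s) (path_map r M m v (b s)))"
      unfolding c by simp
    also have "\<dots> = (\<Sum>s\<in>?J. if s = m then cscale (c m) y else 0)"
    proof (rule sum.cong)
      fix s assume s: "s \<in> ?J"
      consider "s = m" | "s < m" | "m < s" by linarith
      then show "cscale (c s) (path_map r M m v (b s)) = (if s = m then cscale (c m) y else 0)"
      proof cases
        case 1
        then show ?thesis using path_chain[OF b, of 0 m] s b by (auto simp: chain_def)
      next
        case 2
        then show ?thesis using path_chain0[OF b, of s m] s by auto
      qed (use mx s in auto)
    qed simp
    also have "\<dots> = cscale (c m) y" using mJ by simp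
    finally show False using mJ(2) y(2) by simp
  qed
  obtain co where co: "based_rep r M {..<t} ?pos b co"
  proof (rule ex_dual_basis[OF r _ _ sub _ ind])
    show "Sp M v \<subseteq> cvec.span (b ` {s \<in> {..<t}. ?pos s = v})" if "v \<in> {1..r}" for v
      using span[OF that] n0 that by blast
  qed (use pos bSp in auto)
  have "uniserial r M i t b co"
  proof (rule uniserial.intro[OF co], unfold_locales)
    fix s assume s: "s < t"
    show "Mp M (?pos s) (b s) = (if s = 0 then 0 else b (s - 1))"
      using b y(3) s by (cases s) (simp_all add: chain_def)
  qed (rule lin)
  then show thesis by (rule that)
qed

subsection \<open>Existence\<close>

text \<open>The standard basis vectors at \<open>0, \<dots>, n - 1\<close> are the basis, and the arrows shift the
  argument.\<close>

definition string_rep :: "int \<Rightarrow> int \<Rightarrow> nat \<Rightarrow> nat rep"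
  where "string_rep r i n =
    \<lparr>Sp = (\<lambda>v. {x. \<forall>t. x t \<noteq> 0 \<longrightarrow> t < n \<and> wrap r (i + int t) = v}), Mp = (\<lambda>_ x t. x (Suc t))\<rparr>"

lemma uniserial_string_rep:
  assumes r: "r \<ge> 1"
  shows "uniserial r (string_rep r i n) i n (\<lambda>t p. if p = t then 1 else 0) (\<lambda>t x. x t)"
proof (rule uniserial.intro)
  show "based_rep r (string_rep r i n) {..<n} (\<lambda>t. wrap r (i + int t)) (\<lambda>t p. if p = t then 1 else 0) (\<lambda>t x. x t)"
  proof
    show "wrap r (i + int a) \<in> {1..r}" for a by (rule wrap_in[OF r])
    show "cvec.subspace (Sp (string_rep r i n) v)" for v
    proof -
      have "x t \<noteq> 0 \<or> y t \<noteq> 0" if "x t + y t \<noteq> 0" for x y :: "nat cvec" and t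
        using that by auto
      then show ?thesis
        unfolding string_rep_def cvec.subspace_def by (fastforce simp: cscale_def)
    qed
    show "linear_functional (\<lambda>x. x a)" for a :: nat
      unfolding linear_functional_def by (auto simp: cscale_def continuous_on_product_coordinates)
    fix v x assume x: "x \<in> Sp (string_rep r i n) v"
    show "x = (\<Sum>a\<in>{a \<in> {..<n}. wrap r (i + int a) = v}. cscale (x a) (\<lambda>p. if p = a then 1 else 0))"
    proof
      fix p
      have "(\<Sum>a\<in>{a \<in> {..<n}. wrap r (i + int a) = v}. cscale (x a) (\<lambda>p. if p = a then 1 else 0)) p =
          (\<Sum>a\<in>{a \<in> {..<n}. wrap r (i + int a) = v}. if a = p then x a else 0)"
        unfolding sum_fun_apply by (intro sum.cong) (auto simp: cscale_def)
      also have "\<dots> = x p" using x by (auto simp: string_rep_def)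
      finally show "x p = (\<Sum>a\<in>{a \<in> {..<n}. wrap r (i + int a) = v}. cscale (x a) (\<lambda>p. if p = a then 1 else 0)) p"
        by simp
    qed
  qed (use r in \<open>auto simp: string_rep_def\<close>)
  show "uniserial_axioms r (string_rep r i n) i n (\<lambda>t p. if p = t then 1 else 0)"
  proof
    fix v assume v: "v \<in> {1..r}"
    have "wrap r (i + int t) = wrap r (v - 1)" if "wrap r (i + int (Suc t)) = v" for t
      using wrap_wrap_diff[of r "i + int (Suc t)" 1] unfolding that by (simp add: algebra_simps)
    then show "lin_on (Sp (string_rep r i n) v) (Sp (string_rep r i n) (wrap r (v - 1))) (Mp (string_rep r i n) v)"
      unfolding lin_on_def string_rep_def by (auto simp: cscale_def fun_eq_iff)
  qed (auto simp: string_rep_def fun_eq_iff)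
qed

lemma uniserial_zero_rep:
  assumes "r \<ge> 1"
  shows "uniserial r (zero_rep :: 'b rep) i 0 (\<lambda>_. 0) (\<lambda>_ _. 0)"
  by unfold_locales (use assms in \<open>auto simp: zero_rep_def lin_on_def\<close>)

text \<open>The module \<open>indec r i n\<close> is an unspecified one with certain properties. The string module
  shows that there is one, and by \<open>ex_uniserial\<close> these properties force the structure of a
  uniserial module of the right length.\<close>

lemma uniserial_indec:
  assumes r: "r \<ge> 1" and n: "n \<ge> 0"
  obtains b co where "uniserial r (indec r i n) i (nat n) b co"
proof (cases "n = 0")
  case True
  then show thesis
    using uniserial_zero_rep[OF r, of i] that[of "\<lambda>_. 0" "\<lambda>_ _. 0"] by (simp add: indec_def)
next
  case False
  define P where "P M \<longleftrightarrow> nilpotent_rep r M \<and> indecomposable r M \<and>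
            rep_iso r (subrep M (socle r M)) (simple_rep r i) \<and> has_length r M (nat n)" for M :: "nat rep"
  interpret S: uniserial r "string_rep r i (nat n)" i "nat n" "\<lambda>t p. if p = t then 1 else 0" "\<lambda>t x. x t"
    by (rule uniserial_string_rep[OF r])
  have "P (string_rep r i (nat n))"
    unfolding P_def using S.nilpotent S.indecomposable S.socle_iso_simple S.has_length_iff False n by simp
  then have "P (SOME M. P M)" by (rule someI)
  then have P: "P (indec r i n)"
    using False unfolding indec_def P_def by simp
  obtain n' b co where U: "uniserial r (indec r i n) i n' b co"
    using ex_uniserial[OF r] P unfolding P_def by blast
  have "has_length r (indec r i n) (nat n)" using P unfolding P_def by blast
  then have "nat n = n'" using uniserial.has_length_iff[OF U] by blast
  then show thesis using U that by blast
qed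

section \<open>Extensions between uniserial representations\<close>

lemma (in vector_space) subspace_eq_of_dim_le:
  assumes V: "subspace V" and VW: "V \<subseteq> W" and W: "W \<subseteq> span A" "finite A" and le: "dim W \<le> dim V"
  shows "V = W"
proof
  obtain B where B: "B \<subseteq> V" "independent B" "V \<subseteq> span B" "card B = dim V"
    using basis_exists by blast
  obtain C where C: "B \<subseteq> C" "C \<subseteq> W" "independent C" "W \<subseteq> span C"
    using maximal_independent_subset_extend[of B W] B(1,2) VW by (metis subset_trans)
  have "finite C"
    using independent_span_bound[OF W(2) C(3)] C(2) W(1) by auto
  moreover have "card C = dim W"
    by (rule basis_card_eq_dim[OF C(2,4,3)])
  ultimately have "B = C"
    using card_seteq[of C B] C(1) B(4) le by simp
  then show "W \<subseteq> V"
    using C(4) span_minimal[OF B(1) V] by blast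
qed (rule VW)

locale uniserial_pair = M: uniserial r M i k b co + N: uniserial r N j l b' co'
  for r :: int and M :: "'b rep" and i :: int and k :: nat and b co
    and N :: "'c rep" and j :: int and l :: nat and b' co'
begin

sublocale P: based_rep_pair r M "{..<k}" "\<lambda>t. wrap r (i + int t)" b co N "{..<l}" "\<lambda>t. wrap r (j + int t)" b' co'
  by unfold_locales (rule M.lin N.lin; assumption)+

lemma mem_index_pairs: "(s, t) \<in> P.index_pairs u \<longleftrightarrow> s < k \<and> t < l \<and> N.pos t = wrap r (i + int s - u)"
  by (simp add: P.index_pairs_def wrap_wrap_diff)

lemma pos_pred: "wrap r (u - 1) = wrap r (w - 1) \<longleftrightarrow> wrap r u = wrap r w"
proof
  assume "wrap r (u - 1) = wrap r (w - 1)"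
  then have "wrap r (wrap r (u - 1) + 1) = wrap r (wrap r (w - 1) + 1)" by simp
  then show "wrap r u = wrap r w" by (simp add: wrap_wrap_add)
next
  assume "wrap r u = wrap r w"
  then have "wrap r (wrap r u - 1) = wrap r (wrap r w - 1)" by simp
  then show "wrap r (u - 1) = wrap r (w - 1)" by (simp add: wrap_wrap_diff)
qed

text \<open>The coboundary of a matrix unit is the difference of two neighbouring units of a diagonal;
  a neighbour whose index would leave the matrix is missing.\<close>

lemma bdry_unit_map:
  assumes "(s, t) \<in> P.index_pairs 0"
  shows "bdry r M N (P.unit_map (s, t)) =
    (if t = 0 then 0 else P.unit_map (s, t - 1)) - (if Suc s < k then P.unit_map (Suc s, t) else 0)"
proof (rule ext, rule ext)
  fix v x
  have st: "s < k" "t < l" "N.pos t = M.pos s"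
    using assms by (auto simp: mem_index_pairs)
  show "bdry r M N (P.unit_map (s, t)) v x =
    ((if t = 0 then 0 else P.unit_map (s, t - 1)) - (if Suc s < k then P.unit_map (Suc s, t) else 0)) v x"
  proof (cases "v \<in> {1..r} \<and> x \<in> Sp M v")
    case False
    have "v \<noteq> M.pos u \<or> x \<notin> Sp M v" for u
      using False wrap_in[OF M.r_pos] by blast
    then have "P.unit_map (u, u') v x = 0" for u u'
      unfolding P.unit_map_def by auto
    with False show ?thesis
      by (auto simp: bdry_def)
  next
    case True
    then have v: "v \<in> {1..r}" and x: "x \<in> Sp M v" by auto
    have "Mp N v 0 = 0"
      using lin_onD(3)[OF N.lin[OF v] cvec.subspace_0[OF N.Sp_subspace[OF v]], of 0] by simp
    moreover have "Mp N v (cscale c (b' t)) = cscale c (if t = 0 then 0 else b' (t - 1))" if "v = M.pos s" for c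
    proof -
      have vt: "v = N.pos t" using that st(3) by simp
      then have "b' t \<in> Sp N v" using N.b_in[of t] st(2) by simp
      then show ?thesis
        using lin_onD(3)[OF N.lin[OF v]] N.Mp_b[OF st(2)] vt by simp
    qed
    ultimately have 1: "Mp N v (P.unit_map (s, t) v x) = (if t = 0 then 0 else P.unit_map (s, t - 1)) v x"
      using x by (auto simp: P.unit_map_def)
    have Mx: "Mp M v x \<in> Sp M (wrap r (v - 1))"
      by (rule lin_onD(1)[OF M.lin[OF v] x])
    have 2: "P.unit_map (s, t) (wrap r (v - 1)) (Mp M v x) = (if Suc s < k then P.unit_map (Suc s, t) else 0) v x"
    proof (cases "wrap r (v - 1) = M.pos s")
      case True
      then have vs: "v = M.pos (Suc s)" using M.pos_Suc[OF v, of s] by simp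
      have "co s (Mp M v x) = (if Suc s < k then co (Suc s) x else 0)"
        using M.co_Mp[OF v x st(1)] True by simp
      then show ?thesis
        using Mx True x vs unfolding P.unit_map_def by (simp split: if_splits)
    next
      case False
      then have "v \<noteq> M.pos (Suc s)" using M.pos_Suc[OF v, of s] by metis
      then show ?thesis using False by (auto simp: P.unit_map_def)
    qed
    show ?thesis
      using v x 1 2 by (simp add: bdry_def)
  qed
qed

lemma subspace_bdry: "hvec.subspace (bdry r M N ` fam r 0 M N)"
  unfolding hvec.subspace_def
proof (intro conjI ballI allI)
  have "bdry r M N (hscale 0 0) = hscale 0 (bdry r M N 0)"
    by (rule P.bdry_scale[OF hvec.subspace_0[OF P.subspace_fam]])
  then have "0 = bdry r M N 0" by (simp only: hvec.scale_zero_left)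
  then show "0 \<in> bdry r M N ` fam r 0 M N"
    by (rule image_eqI[OF _ hvec.subspace_0[OF P.subspace_fam]])
  show "x + y \<in> bdry r M N ` fam r 0 M N"
    if xy: "x \<in> bdry r M N ` fam r 0 M N" "y \<in> bdry r M N ` fam r 0 M N" for x y
  proof -
    obtain \<phi> \<psi> where *: "\<phi> \<in> fam r 0 M N" "x = bdry r M N \<phi>" "\<psi> \<in> fam r 0 M N" "y = bdry r M N \<psi>"
      using xy by blast
    show ?thesis
      unfolding *(2,4) P.bdry_add[OF *(1,3), symmetric]
      by (rule imageI) (rule hvec.subspace_add[OF P.subspace_fam *(1,3)])
  qed
  show "hscale c x \<in> bdry r M N ` fam r 0 M N" if x: "x \<in> bdry r M N ` fam r 0 M N" for c x
  proof -
    obtain \<phi> where *: "\<phi> \<in> fam r 0 M N" "x = bdry r M N \<phi>" using x by blast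
    show ?thesis
      unfolding *(2) P.bdry_scale[OF *(1), symmetric]
      by (rule imageI) (rule hvec.subspace_scale[OF P.subspace_fam *(1)])
  qed
qed

lemma bdry_unit_map_in: "(s, t) \<in> P.index_pairs 0 \<Longrightarrow> bdry r M N (P.unit_map (s, t)) \<in> bdry r M N ` fam r 0 M N"
  by (rule imageI) (rule P.unit_map_in_fam)

text \<open>If a diagonal exhausts the basis of the source before that of the target, then its last
  unit is a coboundary, and the differences of neighbours carry this over to the other units.\<close>

lemma unit_map_boundary_right:
  assumes "(s, t) \<in> P.index_pairs 1" "t + k < l + s"
  shows "P.unit_map (s, t) \<in> bdry r M N ` fam r 0 M N"
  using assms
proof (induction "k - s" arbitrary: s t)
  case 0
  then show ?case by (simp add: mem_index_pairs)
next
  case (Suc d)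
  have st: "s < k" "t < l" "N.pos t = wrap r (i + int s - 1)"
    using Suc.prems by (auto simp: mem_index_pairs)
  have t1: "Suc t < l" using Suc.prems(2) st by simp
  have p: "N.pos (Suc t) = wrap r (i + int s)"
    using pos_pred[of "j + int (Suc t)" "i + int s"] st(3) by simp
  have m: "(s, Suc t) \<in> P.index_pairs 0" using st t1 p by (simp add: mem_index_pairs)
  have b: "bdry r M N (P.unit_map (s, Suc t)) = P.unit_map (s, t) - (if Suc s < k then P.unit_map (Suc s, Suc t) else 0)"
    using bdry_unit_map[OF m] by simp
  have "(if Suc s < k then P.unit_map (Suc s, Suc t) else 0) \<in> bdry r M N ` fam r 0 M N"
  proof (cases "Suc s < k")
    case True
    then have "(Suc s, Suc t) \<in> P.index_pairs 1" using t1 p by (simp add: mem_index_pairs)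
    then have "P.unit_map (Suc s, Suc t) \<in> bdry r M N ` fam r 0 M N"
      using Suc.hyps Suc.prems by (intro Suc.hyps(1)) auto
    then show ?thesis using True by simp
  next
    case False
    then show ?thesis using hvec.subspace_0[OF subspace_bdry] by (simp only: if_False)
  qed
  from hvec.subspace_add[OF subspace_bdry bdry_unit_map_in[OF m] this] show ?case
    unfolding b by (simp only: diff_add_cancel)
qed

text \<open>A diagonal on which the index of the source is the greater one starts at the target index
  0, with a coboundary.\<close>

lemma unit_map_boundary_left:
  assumes "(s, t) \<in> P.index_pairs 1" "t < s"
  shows "P.unit_map (s, t) \<in> bdry r M N ` fam r 0 M N"
  using assms
proof (induction t arbitrary: s)
  case (0 s)
  then obtain s' where s: "s = Suc s'" by (cases s) auto
  have m: "(s', 0) \<in> P.index_pairs 0" using 0 by (simp add: mem_index_pairs s)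
  have "bdry r M N (P.unit_map (s', 0)) = 0 - P.unit_map (s, 0)"
    using bdry_unit_map[OF m] 0 by (simp add: s mem_index_pairs)
  from hvec.subspace_neg[OF subspace_bdry bdry_unit_map_in[OF m], unfolded this] show ?case
    by (simp only: minus_diff_eq diff_0_right)
next
  case (Suc t)
  then obtain s' where s: "s = Suc s'" by (cases s) auto
  have m: "(s', Suc t) \<in> P.index_pairs 0" using Suc by (simp add: mem_index_pairs s)
  have b: "bdry r M N (P.unit_map (s', Suc t)) = P.unit_map (s', t) - P.unit_map (s, Suc t)"
    using bdry_unit_map[OF m] Suc by (simp add: s mem_index_pairs)
  have "(s', t) \<in> P.index_pairs 1"
    using Suc.prems(1) pos_pred[of "j + int (Suc t)" "i + int s'"]
    by (simp add: mem_index_pairs s)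
  then have "P.unit_map (s', t) \<in> bdry r M N ` fam r 0 M N"
    using Suc.prems(2) s by (intro Suc.IH) auto
  from hvec.subspace_diff[OF subspace_bdry this bdry_unit_map_in[OF m]] show ?case
    unfolding b by (simp only: diff_diff_eq2 add_diff_cancel_left')
qed

text \<open>Along a diagonal that neither starts nor ends with a coboundary the entries of a
  coboundary telescope to zero. So their sum is a functional on \<open>Ext\<^sup>1\<close> that detects the units
  of the diagonal.\<close>

lemma diagonal_sum_bdry:
  assumes c: "c < l" "l \<le> c + k" "N.pos c = wrap r (i - 1)" and \<phi>: "\<phi> \<in> fam r 0 M N"
  shows "(\<Sum>s<l - c. P.entry (s, s + c) (bdry r M N \<phi>)) = 0"
proof -
  \<comment> \<open>the entry of \<open>\<phi>\<close> on the diagonal of degree 0 between two places of the diagonal of degree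
    1, extended by 0 at both ends\<close>
  define e where "e s = (if 0 < s \<and> s + c < l then co' (s + c) (\<phi> (M.pos (s - 1)) (b (s - 1))) else 0)" for s
  have "P.entry (s, s + c) (bdry r M N \<phi>) = e (Suc s) - e s" if s: "s < l - c" for s
  proof -
    have sk: "s < k" "s + c < l" using s c by auto
    have v: "M.pos s \<in> {1..r}" by (rule wrap_in[OF M.r_pos])
    have bs: "b s \<in> Sp M (M.pos s)" using M.b_in sk by simp
    have \<phi>s: "\<phi> (M.pos s) (b s) \<in> Sp N (M.pos s)"
    proof -
      have "lin_on (Sp M (M.pos s)) (Sp N (wrap r (M.pos s - 0))) (\<phi> (M.pos s))"
        using \<phi> v unfolding fam_def by blast
      from lin_onD(1)[OF this bs] show ?thesis using wrap_id[OF v] by simp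
    qed
    have pos: "N.pos (s + c) = wrap r (M.pos s - 1)"
    proof -
      have "N.pos (s + c) = wrap r (N.pos c + int s)" unfolding wrap_wrap_add by (simp add: algebra_simps)
      also have "\<dots> = wrap r (i + int s - 1)" unfolding c(3) wrap_wrap_add by (simp add: algebra_simps)
      finally show ?thesis unfolding wrap_wrap_diff .
    qed
    have phi0: "\<phi> u 0 = 0" if "u \<in> {1..r}" for u
    proof -
      have "lin_on (Sp M u) (Sp N (wrap r (u - 0))) (\<phi> u)"
        using \<phi> that unfolding fam_def by blast
      from lin_onD(3)[OF this cvec.subspace_0[OF M.Sp_subspace[OF that]], of 0] show ?thesis by simp
    qed
    have A: "co' (s + c) (Mp N (M.pos s) (\<phi> (M.pos s) (b s))) = e (Suc s)"
      using N.co_Mp[OF v \<phi>s sk(2) pos] by (simp add: e_def)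
    have B: "co' (s + c) (\<phi> (wrap r (M.pos s - 1)) (Mp M (M.pos s) (b s))) = e s"
    proof (cases s)
      case 0
      then have "Mp M (M.pos s) (b s) = 0" using M.Mp_b[OF sk(1)] by simp
      then show ?thesis
        using phi0[OF wrap_in[OF M.r_pos]] N.co_zero[of "s + c"] sk(2) 0 by (simp only: e_def) simp
    next
      case (Suc s')
      then have "wrap r (M.pos s - 1) = M.pos s'" by (simp add: wrap_wrap_diff)
      then show ?thesis using M.Mp_b[OF sk(1)] Suc sk(2) by (simp add: e_def)
    qed
    show ?thesis
      unfolding P.entry_def using v bs A B sk(2) by (simp add: bdry_def)
  qed
  then have "(\<Sum>s<l - c. P.entry (s, s + c) (bdry r M N \<phi>)) = (\<Sum>s<l - c. e (Suc s) - e s)"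
    by (intro sum.cong) auto
  also have "\<dots> = e (l - c) - e 0"
    by (rule sum_lessThan_telescope)
  also have "\<dots> = 0" using c(1) by (simp add: e_def)
  finally show ?thesis .
qed

text \<open>The number \<open>c\<close> is the target index where a surviving diagonal starts, the source index
  being 0. The inequality \<open>l \<le> c + k\<close> says that the diagonal reaches the end of the basis of the
  target.\<close>

lemma ext_dim_eq_0_iff:
  assumes k: "k > 0"
  shows "ext_dim r M N = 0 \<longleftrightarrow> \<not> (\<exists>c. c < l \<and> l \<le> c + k \<and> N.pos c = wrap r (i - 1))"
proof
  assume ext: "ext_dim r M N = 0"
  have im: "bdry r M N ` fam r 0 M N = fam r 1 M N"
  proof (rule hvec.subspace_eq_of_dim_le[OF subspace_bdry])
    show "bdry r M N ` fam r 0 M N \<subseteq> fam r 1 M N" using P.bdry_in_fam by blast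
    show "fam r 1 M N \<subseteq> hvec.span (P.unit_map ` P.index_pairs 1)" by (simp add: P.fam_span)
    show "finite (P.unit_map ` P.index_pairs 1)" using P.finite_index_pairs by simp
    show "hvec.dim (fam r 1 M N) \<le> hvec.dim (bdry r M N ` fam r 0 M N)" using ext by (simp add: ext_dim_def)
  qed
  show "\<not> (\<exists>c. c < l \<and> l \<le> c + k \<and> N.pos c = wrap r (i - 1))"
  proof
    assume "\<exists>c. c < l \<and> l \<le> c + k \<and> N.pos c = wrap r (i - 1)"
    then obtain c where c: "c < l" "l \<le> c + k" "N.pos c = wrap r (i - 1)" by blast
    have diag: "(s, s + c) \<in> P.index_pairs 1" if "s < l - c" for s
    proof -
      have "N.pos (s + c) = wrap r (N.pos c + int s)" unfolding wrap_wrap_add by (simp add: algebra_simps)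
      also have "\<dots> = wrap r (i + int s - 1)" unfolding c(3) wrap_wrap_add by (simp add: algebra_simps)
      finally show ?thesis using that c by (auto simp: mem_index_pairs)
    qed
    have 0: "(0, c) \<in> P.index_pairs 1" using diag[of 0] c(1) by simp
    obtain \<phi> where \<phi>: "\<phi> \<in> fam r 0 M N" "P.unit_map (0, c) = bdry r M N \<phi>"
      using im P.unit_map_in_fam[OF 0] by blast
    have "(\<Sum>s<l - c. P.entry (s, s + c) (P.unit_map (0, c))) = (\<Sum>s<l - c. if s = 0 then 1 else 0)"
      using P.entry_unit_map[OF diag 0] by (intro sum.cong) auto
    also have "\<dots> = 1" using c(1) by simp
    finally show False
      using diagonal_sum_bdry[OF c \<phi>(1)] \<phi>(2) by simp
  qed
next
  assume no: "\<not> (\<exists>c. c < l \<and> l \<le> c + k \<and> N.pos c = wrap r (i - 1))"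
  have "P.unit_map p \<in> bdry r M N ` fam r 0 M N" if "p \<in> P.index_pairs 1" for p
  proof -
    obtain s t where p: "p = (s, t)" by (cases p)
    then have st: "s < k" "t < l" "N.pos t = wrap r (i + int s - 1)"
      using that by (auto simp: mem_index_pairs)
    show ?thesis
    proof (cases "t < s")
      case True
      then show ?thesis using unit_map_boundary_left that p by simp
    next
      case False
      have "N.pos (t - s) = wrap r (N.pos t - int s)"
        unfolding wrap_wrap_diff using False by (simp add: algebra_simps of_nat_diff)
      also have "\<dots> = wrap r (i - 1)" unfolding st(3) wrap_wrap_diff by (simp add: algebra_simps)
      finally have "\<not> (t - s < l \<and> l \<le> t - s + k)" using no by blast
      then have "t + k < l + s" using st False by auto
      then show ?thesis using unit_map_boundary_right that p by simp
    qed
  qed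
  then have "fam r 1 M N \<subseteq> bdry r M N ` fam r 0 M N"
    unfolding P.fam_span[of 1] by (intro hvec.span_minimal subspace_bdry image_subsetI)
  then have "bdry r M N ` fam r 0 M N = fam r 1 M N"
    using P.bdry_in_fam by blast
  then show "ext_dim r M N = 0" by (simp add: ext_dim_def)
qed

end

section \<open>Submodules of a direct sum of two uniserial representations\<close>

lemma case_sum_add: "case_sum x y + case_sum x' y' = case_sum (x + x') (y + y')"
  for x x' :: "'b \<Rightarrow> 'd::plus"
  by (auto simp: fun_eq_iff split: sum.splits)

lemma case_sum_comp: "case_sum x y \<circ> Inl = x" "case_sum x y \<circ> Inr = y"
  by (auto simp: fun_eq_iff)

lemma case_sum_expand: "case_sum (z \<circ> Inl) (z \<circ> Inr) = z"
  by (auto simp: fun_eq_iff split: sum.splits)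

lemma comp_add: "(x + y) \<circ> h = (x \<circ> h) + (y \<circ> h)"
  by (auto simp: fun_eq_iff)

lemma comp_cscale: "cscale c x \<circ> h = cscale c (x \<circ> h)"
  by (auto simp: fun_eq_iff cscale_def)

lemma comp_zero: "(0 :: 'a \<Rightarrow> 'd::zero) \<circ> h = 0"
  by (auto simp: fun_eq_iff)

lemma comp_sum: "(\<Sum>i\<in>J. g i) \<circ> h = (\<Sum>i\<in>J. g i \<circ> h)" for g :: "'i \<Rightarrow> 'x \<Rightarrow> 'd::comm_monoid_add"
  by (auto simp: fun_eq_iff sum_fun_apply)

lemma Sp_dsum: "z \<in> Sp (rep_dsum M N) v \<longleftrightarrow> z \<circ> Inl \<in> Sp M v \<and> z \<circ> Inr \<in> Sp N v"
proof
  assume "z \<in> Sp (rep_dsum M N) v"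
  then obtain x y where "z = case_sum x y" "x \<in> Sp M v" "y \<in> Sp N v"
    by (auto simp: rep_dsum_def)
  then show "z \<circ> Inl \<in> Sp M v \<and> z \<circ> Inr \<in> Sp N v" by (simp add: case_sum_comp)
next
  assume "z \<circ> Inl \<in> Sp M v \<and> z \<circ> Inr \<in> Sp N v"
  then show "z \<in> Sp (rep_dsum M N) v"
    using case_sum_expand[of z] unfolding rep_dsum_def by (simp, metis)
qed

lemma Mp_dsum: "Mp (rep_dsum M N) v z \<circ> Inl = Mp M v (z \<circ> Inl)" "Mp (rep_dsum M N) v z \<circ> Inr = Mp N v (z \<circ> Inr)"
  by (simp_all add: rep_dsum_def case_sum_comp)

lemma linear_functional_comp:
  fixes h :: "'a \<Rightarrow> 'c"
  assumes "linear_functional f"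
  shows "linear_functional (\<lambda>z. f (z \<circ> h))"
proof -
  have "continuous_on UNIV (\<lambda>z :: 'c cvec. z \<circ> h)"
    unfolding comp_def by (intro continuous_on_coordinatewise_then_product continuous_on_product_coordinates)
  then have "continuous_on UNIV (\<lambda>z. f (z \<circ> h))"
    using assms continuous_on_compose2[of UNIV f UNIV "\<lambda>z. z \<circ> h"] unfolding linear_functional_def by blast
  then show ?thesis
    using assms unfolding linear_functional_def comp_add comp_cscale by blast
qed

context uniserial_pair
begin

abbreviation "DS \<equiv> rep_dsum M N"

definition dpos :: "nat + nat \<Rightarrow> int"
  where "dpos = case_sum M.pos N.pos"

definition dvec :: "nat + nat \<Rightarrow> ('b + 'c) cvec"
  where "dvec = case_sum (\<lambda>u. case_sum (b u) 0) (\<lambda>u. case_sum 0 (b' u))"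

definition dco :: "nat + nat \<Rightarrow> ('b + 'c) cvec \<Rightarrow> complex"
  where "dco = case_sum (\<lambda>u z. co u (z \<circ> Inl)) (\<lambda>u z. co' u (z \<circ> Inr))"

lemma dsimps [simp]: "dpos (Inl u) = M.pos u" "dpos (Inr u) = N.pos u"
  "dvec (Inl u) = case_sum (b u) 0" "dvec (Inr u) = case_sum 0 (b' u)"
  "dco (Inl u) z = co u (z \<circ> Inl)" "dco (Inr u) z = co' u (z \<circ> Inr)"
  by (simp_all add: dpos_def dvec_def dco_def)

lemma dsum_zero: "0 \<in> Sp M v" "0 \<in> Sp N v" if "v \<in> {1..r}"
  using cvec.subspace_0 M.Sp_subspace[OF that] N.Sp_subspace[OF that] by blast+

lemma dsum_fibre: "{p \<in> {..<k} <+> {..<l}. dpos p = v} = {u \<in> {..<k}. M.pos u = v} <+> {u \<in> {..<l}. N.pos u = v}"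
  by auto

sublocale D: based_rep r DS "{..<k} <+> {..<l}" dpos dvec dco
proof
  show "r \<ge> 1" by (rule M.r_pos)
  show "finite ({..<k} <+> {..<l})" by simp
  show "dpos a \<in> {1..r}" if "a \<in> {..<k} <+> {..<l}" for a
    using wrap_in[OF M.r_pos] by (cases a) simp_all
  show "cvec.subspace (Sp DS v)" if v: "v \<in> {1..r}" for v
    using M.Sp_subspace[OF v] N.Sp_subspace[OF v]
    unfolding cvec.subspace_def by (simp add: Sp_dsum comp_add comp_cscale comp_zero)
  show "dvec a \<in> Sp DS (dpos a)" if "a \<in> {..<k} <+> {..<l}" for a
    using that M.b_in N.b_in dsum_zero[OF wrap_in[OF M.r_pos]] by (auto simp: Sp_dsum case_sum_comp)
  show "linear_functional (dco a)" if "a \<in> {..<k} <+> {..<l}" for a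
    using that linear_functional_comp[OF M.co] linear_functional_comp[OF N.co] by (auto simp: dco_def)
  show "dco a (dvec a') = (if a' = a then 1 else 0)"
    if "a \<in> {..<k} <+> {..<l}" "a' \<in> {..<k} <+> {..<l}" "dpos a' = dpos a" for a a'
    using that M.co_b N.co_b by (auto simp: case_sum_comp split: if_splits)
  fix v z assume v: "v \<in> {1..r}" and z: "z \<in> Sp DS v"
  let ?JM = "{u \<in> {..<k}. M.pos u = v}" and ?JN = "{u \<in> {..<l}. N.pos u = v}"
  have "(\<Sum>a\<in>{p \<in> {..<k} <+> {..<l}. dpos p = v}. cscale (dco a z) (dvec a)) =
      (\<Sum>u\<in>?JM. cscale (co u (z \<circ> Inl)) (case_sum (b u) 0)) + (\<Sum>u\<in>?JN. cscale (co' u (z \<circ> Inr)) (case_sum 0 (b' u)))"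
    unfolding dsum_fibre by (subst sum.Plus) simp_all
  also have "\<dots> = case_sum (\<Sum>u\<in>?JM. cscale (co u (z \<circ> Inl)) (b u)) (\<Sum>u\<in>?JN. cscale (co' u (z \<circ> Inr)) (b' u))"
  proof -
    have 1: "(\<Sum>u\<in>J. cscale (c u) (case_sum (b u) 0)) = case_sum (\<Sum>u\<in>J. cscale (c u) (b u)) 0" for J c
      by (auto simp: fun_eq_iff sum_fun_apply cscale_def split: sum.splits)
    have 2: "(\<Sum>u\<in>J. cscale (c u) (case_sum 0 (b' u))) = case_sum 0 (\<Sum>u\<in>J. cscale (c u) (b' u))" for J c
      by (auto simp: fun_eq_iff sum_fun_apply cscale_def split: sum.splits)
    show ?thesis unfolding 1 2 case_sum_add by simp
  qed
  also have "\<dots> = z"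
    using M.expand[OF v, of "z \<circ> Inl"] N.expand[OF v, of "z \<circ> Inr"] z case_sum_expand[of z]
    by (simp add: Sp_dsum)
  finally show "z = (\<Sum>a\<in>{p \<in> {..<k} <+> {..<l}. dpos p = v}. cscale (dco a z) (dvec a))" by simp
qed

text \<open>This is the sum of the submodules of lengths \<open>a\<close> and \<open>c\<close> of the two summands and of a
  diagonal in the two isomorphic subquotients of length \<open>s\<close> above them, whose slope is the point
  \<open>[\<alpha> : \<beta>]\<close> of the projective line. Equations for the coefficients, rather than generators, make
  it easy to decide membership.\<close>

definition cell :: "nat \<Rightarrow> nat \<Rightarrow> nat \<Rightarrow> complex \<Rightarrow> complex \<Rightarrow> int \<Rightarrow> ('b + 'c) cvec set"
  where "cell a c s \<alpha> \<beta> = (\<lambda>v\<in>{1..r}. {z \<in> Sp DS v.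
     (\<forall>u. a + s \<le> u \<and> u < k \<and> M.pos u = v \<longrightarrow> dco (Inl u) z = 0) \<and>
     (\<forall>u. c + s \<le> u \<and> u < l \<and> N.pos u = v \<longrightarrow> dco (Inr u) z = 0) \<and>
     (\<forall>u<s. M.pos (a + u) = v \<longrightarrow> \<beta> * dco (Inl (a + u)) z = \<alpha> * dco (Inr (c + u)) z)})"

definition cell_ok :: "nat \<Rightarrow> nat \<Rightarrow> nat \<Rightarrow> bool"
  where "cell_ok a c s \<longleftrightarrow> a + s \<le> k \<and> c + s \<le> l \<and> (s = 0 \<or> M.pos a = N.pos c)"

lemma cell_okD: "cell_ok a c s \<Longrightarrow> u < s \<Longrightarrow> M.pos (a + u) = N.pos (c + u)"
proof -
  assume ok: "cell_ok a c s" and u: "u < s"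
  have "M.pos (a + u) = wrap r (M.pos a + int u)" by (simp add: wrap_wrap_add add.assoc)
  also have "\<dots> = wrap r (N.pos c + int u)" using ok u by (simp add: cell_ok_def)
  also have "\<dots> = N.pos (c + u)" by (simp add: wrap_wrap_add add.assoc)
  finally show ?thesis .
qed

lemma mem_cell: "v \<in> {1..r} \<Longrightarrow> z \<in> cell a c s \<alpha> \<beta> v \<longleftrightarrow> z \<in> Sp DS v \<and>
     (\<forall>u. a + s \<le> u \<and> u < k \<and> M.pos u = v \<longrightarrow> dco (Inl u) z = 0) \<and>
     (\<forall>u. c + s \<le> u \<and> u < l \<and> N.pos u = v \<longrightarrow> dco (Inr u) z = 0) \<and>
     (\<forall>u<s. M.pos (a + u) = v \<longrightarrow> \<beta> * dco (Inl (a + u)) z = \<alpha> * dco (Inr (c + u)) z)"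
  by (simp only: cell_def restrict_apply if_True mem_Collect_eq)

lemma cell_undefined: "v \<notin> {1..r} \<Longrightarrow> cell a c s \<alpha> \<beta> v = undefined"
  by (simp only: cell_def restrict_apply if_False)

lemma cell_scale:
  assumes "\<gamma> \<noteq> 0"
  shows "cell a c s (\<gamma> * \<alpha>) (\<gamma> * \<beta>) = cell a c s \<alpha> \<beta>"
  unfolding cell_def using assms by (simp add: mult.assoc)

definition cell_index :: "nat \<Rightarrow> nat \<Rightarrow> nat \<Rightarrow> int \<Rightarrow> (nat + nat) set"
  where "cell_index a c s v = {u. u < a + s \<and> M.pos u = v} <+> {u. u < c \<and> N.pos u = v}"

text \<open>The diagonal basis vectors carry the left index of their first component.\<close>

definition cell_basis :: "nat \<Rightarrow> nat \<Rightarrow> complex \<Rightarrow> complex \<Rightarrow> nat + nat \<Rightarrow> ('b + 'c) cvec"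
  where "cell_basis a c \<alpha> \<beta> = (\<lambda>p. case p of Inl u \<Rightarrow>
      if u < a then dvec (Inl u) else cscale \<alpha> (dvec (Inl u)) + cscale \<beta> (dvec (Inr (c + (u - a))))
    | Inr u \<Rightarrow> dvec (Inr u))"

lemma finite_cell_index: "finite (cell_index a c s v)"
  by (simp add: cell_index_def)

lemma cell_basis_in:
  assumes ok: "cell_ok a c s" and v: "v \<in> {1..r}" and p: "p \<in> cell_index a c s v"
  shows "cell_basis a c \<alpha> \<beta> p \<in> Sp DS v"
proof -
  note add = cvec.subspace_add[OF D.Sp_subspace[OF v]] and scale = cvec.subspace_scale[OF D.Sp_subspace[OF v]]
  have L: "dvec (Inl u) \<in> Sp DS v" if "u < k" "M.pos u = v" for u
    using D.b_in[of "Inl u"] that by auto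
  have R: "dvec (Inr u) \<in> Sp DS v" if "u < l" "N.pos u = v" for u
    using D.b_in[of "Inr u"] that by auto
  consider u where "p = Inl u" "u < a + s" "M.pos u = v" | u where "p = Inr u" "u < c" "N.pos u = v"
    using p by (auto simp: cell_index_def)
  then show ?thesis
  proof cases
    case 1
    have "dvec (Inl u) \<in> Sp DS v" using L[of u] 1 ok by (simp add: cell_ok_def)
    moreover have "dvec (Inr (c + (u - a))) \<in> Sp DS v" if "\<not> u < a"
    proof -
      have "c + (u - a) < l" using 1 that ok by (auto simp: cell_ok_def)
      moreover have "N.pos (c + (u - a)) = v" using cell_okD[OF ok, of "u - a"] 1 that by simp
      ultimately show ?thesis by (rule R)
    qed
    ultimately show ?thesis
      using 1(1) add scale unfolding cell_basis_def by (simp del: dsimps)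
  next
    case 2
    then show ?thesis using R[of u] ok by (simp add: cell_ok_def cell_basis_def)
  qed
qed

text \<open>The coefficients of a combination of the basis of a cell. Both the spanning property and
  linear independence can be read off from them.\<close>

lemma dco_cell_sum:
  assumes ok: "cell_ok a c s" and v: "v \<in> {1..r}"
    and z: "z = (\<Sum>p\<in>cell_index a c s v. cscale (d p) (cell_basis a c \<alpha> \<beta> p))"
  shows "u < k \<Longrightarrow> M.pos u = v \<Longrightarrow>
      dco (Inl u) z = (if u < a then d (Inl u) else if u < a + s then \<alpha> * d (Inl u) else 0)"
    and "u < l \<Longrightarrow> N.pos u = v \<Longrightarrow>
      dco (Inr u) z = (if u < c then d (Inr u) else if u < c + s then \<beta> * d (Inl (a + (u - c))) else 0)"
proof -
  let ?A = "{u. u < a + s \<and> M.pos u = v}" and ?C = "{u. u < c \<and> N.pos u = v}"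
  have ok': "a + s \<le> k" "c + s \<le> l" using ok by (auto simp: cell_ok_def)
  have finA: "finite ?A" by simp
  have dco_z: "dco q z = (\<Sum>w\<in>?A. d (Inl w) * dco q (cell_basis a c \<alpha> \<beta> (Inl w))) +
      (\<Sum>w\<in>?C. d (Inr w) * dco q (cell_basis a c \<alpha> \<beta> (Inr w)))" if "q \<in> {..<k} <+> {..<l}" for q
    unfolding z D.co_sum[OF that] cell_index_def using that
    by (subst sum.Plus) (simp_all del: dsimps)
  have L: "cell_basis a c \<alpha> \<beta> (Inl w) =
      (if w < a then dvec (Inl w) else cscale \<alpha> (dvec (Inl w)) + cscale \<beta> (dvec (Inr (c + (w - a)))))" for w
    by (simp add: cell_basis_def)
  have R: "cell_basis a c \<alpha> \<beta> (Inr w) = dvec (Inr w)" for w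
    by (simp add: cell_basis_def)
  have posA: "N.pos (c + (w - a)) = v" "c + (w - a) < l" if "w \<in> ?A" "\<not> w < a" for w
    using cell_okD[OF ok, of "w - a"] that ok' by auto
  show "dco (Inl u) z = (if u < a then d (Inl u) else if u < a + s then \<alpha> * d (Inl u) else 0)"
    if u: "u < k" "M.pos u = v"
  proof -
    have q: "Inl u \<in> {..<k} <+> {..<l}" using u by auto
    have "dco (Inl u) (cell_basis a c \<alpha> \<beta> (Inl w)) = (if w = u then if u < a then 1 else \<alpha> else 0)"
      if w: "w \<in> ?A" for w
    proof -
      have "Inl w \<in> {..<k} <+> {..<l}" using w ok' by auto
      then have "dco (Inl u) (dvec (Inl w)) = (if w = u then 1 else 0)"
        using D.co_b[OF q, of "Inl w"] w u by simp
      moreover have "dco (Inl u) (dvec (Inr w')) = 0" for w'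
        using u by (simp add: case_sum_comp)
      ultimately show ?thesis
        unfolding L using D.co_add[OF q] D.co_scale[OF q] by (cases "w = u") (simp_all del: dsimps)
    qed
    then have "(\<Sum>w\<in>?A. d (Inl w) * dco (Inl u) (cell_basis a c \<alpha> \<beta> (Inl w))) =
        (\<Sum>w\<in>?A. if w = u then d (Inl u) * (if u < a then 1 else \<alpha>) else 0)"
      by (intro sum.cong) (auto simp del: dsimps)
    moreover have "(\<Sum>w\<in>?C. d (Inr w) * dco (Inl u) (cell_basis a c \<alpha> \<beta> (Inr w))) = 0"
      unfolding R using u by (intro sum.neutral) (simp add: case_sum_comp)
    ultimately show ?thesis
      unfolding dco_z[OF q] using u by simp
  qed
  show "dco (Inr u) z = (if u < c then d (Inr u) else if u < c + s then \<beta> * d (Inl (a + (u - c))) else 0)"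
    if u: "u < l" "N.pos u = v"
  proof -
    have q: "Inr u \<in> {..<k} <+> {..<l}" using u by auto
    have RR: "dco (Inr u) (dvec (Inr w)) = (if w = u then 1 else 0)" if "w < l" "N.pos w = v" for w
    proof -
      have "Inr w \<in> {..<k} <+> {..<l}" using that by auto
      then show ?thesis using D.co_b[OF q, of "Inr w"] u that by simp
    qed
    have RL: "dco (Inr u) (dvec (Inl w)) = 0" for w
      using u by (simp add: case_sum_comp)
    have "dco (Inr u) (cell_basis a c \<alpha> \<beta> (Inl w)) = (if w = a + (u - c) \<and> c \<le> u then \<beta> else 0)"
      if w: "w \<in> ?A" for w
    proof (cases "w < a")
      case True
      then show ?thesis unfolding L using RL by (simp del: dsimps)
    next
      case False
      then have iff: "c + (w - a) = u \<longleftrightarrow> w = a + (u - c) \<and> c \<le> u" by auto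
      have "dco (Inr u) (cell_basis a c \<alpha> \<beta> (Inl w)) =
          \<alpha> * dco (Inr u) (dvec (Inl w)) + \<beta> * dco (Inr u) (dvec (Inr (c + (w - a))))"
        unfolding L D.co_add[OF q] D.co_scale[OF q] if_not_P[OF False] ..
      also have "\<dots> = (if c + (w - a) = u then \<beta> else 0)"
        unfolding RL RR[OF posA(2,1)[OF w False]] by simp
      finally show ?thesis unfolding iff .
    qed
    then have "(\<Sum>w\<in>?A. d (Inl w) * dco (Inr u) (cell_basis a c \<alpha> \<beta> (Inl w))) =
        (\<Sum>w\<in>?A. if w = a + (u - c) then (if c \<le> u then d (Inl (a + (u - c))) * \<beta> else 0) else 0)"
      by (intro sum.cong) (auto simp del: dsimps)
    also have "\<dots> = (if c \<le> u \<and> u < c + s then \<beta> * d (Inl (a + (u - c))) else 0)"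
    proof -
      have "a + (u - c) \<in> ?A \<longleftrightarrow> u < c + s" if "c \<le> u"
        using cell_okD[OF ok, of "u - c"] that u by auto
      then show ?thesis
        unfolding sum.delta[OF finA] by (cases "c \<le> u") (simp_all only: mult.commute if_True if_False simp_thms if_cancel)
    qed
    moreover have "(\<Sum>w\<in>?C. d (Inr w) * dco (Inr u) (cell_basis a c \<alpha> \<beta> (Inr w))) =
        (\<Sum>w\<in>?C. if w = u then d (Inr u) else 0)"
      unfolding R using RR ok' by (intro sum.cong) (auto simp del: dsimps)
    ultimately show ?thesis
      unfolding dco_z[OF q] using u by simp
  qed
qed

lemma cell_span:
  assumes ok: "cell_ok a c s" and v: "v \<in> {1..r}" and nz: "\<alpha> \<noteq> 0 \<or> \<beta> \<noteq> 0"
  shows "cell a c s \<alpha> \<beta> v = cvec.span (cell_basis a c \<alpha> \<beta> ` cell_index a c s v)"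
proof (intro equalityI subsetI)
  let ?z = "\<lambda>d. \<Sum>p\<in>cell_index a c s v. cscale (d p) (cell_basis a c \<alpha> \<beta> p)"
  note sumL = dco_cell_sum(1)[OF ok v refl] and sumR = dco_cell_sum(2)[OF ok v refl]
  have ok': "a + s \<le> k" "c + s \<le> l" using ok by (auto simp: cell_ok_def)
  have zSp: "?z d \<in> Sp DS v" for d
    using cell_basis_in[OF ok v] by (intro cvec.subspace_sum cvec.subspace_scale D.Sp_subspace v)
  {
    fix z assume z: "z \<in> cell a c s \<alpha> \<beta> v"
    define \<gamma> where "\<gamma> u = (if \<alpha> \<noteq> 0 then dco (Inl (a + u)) z / \<alpha> else dco (Inr (c + u)) z / \<beta>)" for u
    have \<gamma>: "dco (Inl (a + u)) z = \<alpha> * \<gamma> u" "dco (Inr (c + u)) z = \<beta> * \<gamma> u" if "u < s" "M.pos (a + u) = v" for u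
    proof -
      have "\<beta> * dco (Inl (a + u)) z = \<alpha> * dco (Inr (c + u)) z"
        using z that unfolding mem_cell[OF v] by blast
      then show "dco (Inl (a + u)) z = \<alpha> * \<gamma> u" "dco (Inr (c + u)) z = \<beta> * \<gamma> u"
        using nz by (auto simp: \<gamma>_def field_simps simp del: dsimps)
    qed
    define d where "d p = (case p of Inl u \<Rightarrow> if u < a then dco (Inl u) z else \<gamma> (u - a) | Inr u \<Rightarrow> dco (Inr u) z)" for p
    have "z = ?z d"
    proof (rule D.Sp_eqI[OF v])
      show "z \<in> Sp DS v" using z unfolding mem_cell[OF v] by blast
      show "?z d \<in> Sp DS v" by (rule zSp)
      fix q assume q: "q \<in> {..<k} <+> {..<l}" "dpos q = v"
      show "dco q z = dco q (?z d)"
      proof (cases q)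
        case (Inl u)
        then have u: "u < k" "M.pos u = v" using q by auto
        have "dco (Inl u) z = 0" if "a + s \<le> u" using z that u unfolding mem_cell[OF v] by blast
        moreover have "dco (Inl u) z = \<alpha> * \<gamma> (u - a)" if "a \<le> u" "u < a + s"
          using \<gamma>(1)[of "u - a"] that u by (simp del: dsimps)
        ultimately show ?thesis
          unfolding Inl sumL[OF u] by (auto simp: d_def simp del: dsimps)
      next
        case (Inr u)
        then have u: "u < l" "N.pos u = v" using q by auto
        have "dco (Inr u) z = 0" if "c + s \<le> u" using z that u unfolding mem_cell[OF v] by blast
        moreover have "dco (Inr u) z = \<beta> * \<gamma> (u - c)" if "c \<le> u" "u < c + s"
          using \<gamma>(2)[of "u - c"] cell_okD[OF ok, of "u - c"] that u by (simp del: dsimps)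
        ultimately show ?thesis
          unfolding Inr sumR[OF u] by (auto simp: d_def simp del: dsimps)
      qed
    qed
    then show "z \<in> cvec.span (cell_basis a c \<alpha> \<beta> ` cell_index a c s v)"
      using cvec.sum_in_span_family by metis
  next
    fix z assume "z \<in> cvec.span (cell_basis a c \<alpha> \<beta> ` cell_index a c s v)"
    then obtain d where d: "z = ?z d"
      by (auto simp: cvec.span_family[OF finite_cell_index])
    show "z \<in> cell a c s \<alpha> \<beta> v"
      unfolding mem_cell[OF v]
    proof (intro conjI allI impI)
      show "z \<in> Sp DS v" unfolding d by (rule zSp)
      show "dco (Inl u) z = 0" if "a + s \<le> u \<and> u < k \<and> M.pos u = v" for u
        unfolding d using that by (subst sumL) auto
      show "dco (Inr u) z = 0" if "c + s \<le> u \<and> u < l \<and> N.pos u = v" for u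
        unfolding d using that by (subst sumR) auto
      fix u assume u: "u < s" "M.pos (a + u) = v"
      have "dco (Inl (a + u)) z = \<alpha> * d (Inl (a + u))"
        unfolding d using u ok' by (subst sumL) auto
      moreover have "dco (Inr (c + u)) z = \<beta> * d (Inl (a + u))"
        unfolding d using u ok' cell_okD[OF ok u(1)] by (subst sumR) auto
      ultimately show "\<beta> * dco (Inl (a + u)) z = \<alpha> * dco (Inr (c + u)) z" by simp
    qed
  }
qed

lemma cell_indep:
  assumes ok: "cell_ok a c s" and v: "v \<in> {1..r}" and nz: "\<alpha> \<noteq> 0 \<or> \<beta> \<noteq> 0"
  shows "cvec.indep_family (cell_index a c s v) (cell_basis a c \<alpha> \<beta>)"
  unfolding cvec.indep_family_def
proof (intro allI impI ballI)
  fix d p assume d: "(\<Sum>p\<in>cell_index a c s v. cscale (d p) (cell_basis a c \<alpha> \<beta> p)) = 0"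
    and p: "p \<in> cell_index a c s v"
  note sumL = dco_cell_sum(1)[OF ok v d[symmetric]] and sumR = dco_cell_sum(2)[OF ok v d[symmetric]]
  have ok': "a + s \<le> k" "c + s \<le> l" using ok by (auto simp: cell_ok_def)
  have z0: "dco (Inl u) 0 = 0" if "u < k" for u using that D.co_zero[of "Inl u"] by blast
  have z0': "dco (Inr u) 0 = 0" if "u < l" for u using that D.co_zero[of "Inr u"] by blast
  consider u where "p = Inl u" "u < a + s" "M.pos u = v" | u where "p = Inr u" "u < c" "N.pos u = v"
    using p by (auto simp: cell_index_def)
  then show "d p = 0"
  proof cases
    case 1
    have uk: "u < k" using 1 ok' by simp
    show ?thesis
    proof (cases "u < a")
      case True
      then show ?thesis using sumL[OF uk 1(3)] z0[OF uk] 1(1) by (simp del: dsimps)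
    next
      case False
      define w where "w = c + (u - a)"
      have w: "w < l" "N.pos w = v" "\<not> w < c" "w < c + s" "a + (w - c) = u"
        using False 1 ok' cell_okD[OF ok, of "u - a"] by (auto simp: w_def)
      have "\<alpha> * d (Inl u) = 0" using sumL[OF uk 1(3)] z0[OF uk] False 1 by (simp del: dsimps)
      moreover have "\<beta> * d (Inl u) = 0" using sumR[OF w(1,2)] z0'[OF w(1)] w(3-5) by (simp del: dsimps)
      ultimately show ?thesis using nz 1(1) by auto
    qed
  next
    case 2
    have "u < l" using 2 ok' by simp
    then show ?thesis using sumR[OF _ 2(3)] z0'[of u] 2 by (simp del: dsimps)
  qed
qed

lemma dim_cell:
  assumes ok: "cell_ok a c s" and v: "v \<in> {1..r}" and nz: "\<alpha> \<noteq> 0 \<or> \<beta> \<noteq> 0"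
  shows "cvec.dim (cell a c s \<alpha> \<beta> v) =
    card {u. u < a + s \<and> M.pos u = v} + card {u. u < c \<and> N.pos u = v}"
  unfolding cell_span[OF assms] cvec.dim_span_family[OF finite_cell_index cell_indep[OF assms]]
  by (simp add: cell_index_def card_Plus)

lemma submodule_cell:
  assumes ok: "cell_ok a c s" and nz: "\<alpha> \<noteq> 0 \<or> \<beta> \<noteq> 0"
  shows "submodule r DS (cell a c s \<alpha> \<beta>)"
  unfolding submodule_def
proof (intro conjI ballI)
  show "cell a c s \<alpha> \<beta> \<in> extensional {1..r}"
    unfolding cell_def by (rule restrict_extensional)
  fix v assume v: "v \<in> {1..r}"
  show "cvec.subspace (cell a c s \<alpha> \<beta> v)"
    unfolding cell_span[OF ok v nz] by (rule cvec.subspace_span)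
  show "cell a c s \<alpha> \<beta> v \<subseteq> Sp DS v"
    using mem_cell[OF v] by blast
  show "Mp DS v ` cell a c s \<alpha> \<beta> v \<subseteq> cell a c s \<alpha> \<beta> (wrap r (v - 1))"
  proof (rule image_subsetI)
    fix z assume z: "z \<in> cell a c s \<alpha> \<beta> v"
    have zS: "z \<circ> Inl \<in> Sp M v" "z \<circ> Inr \<in> Sp N v"
      using z unfolding mem_cell[OF v] Sp_dsum by blast+
    have w: "wrap r (v - 1) \<in> {1..r}" by (rule wrap_in[OF M.r_pos])
    have ok': "a + s \<le> k" "c + s \<le> l" using ok by (auto simp: cell_ok_def)
    have zL: "dco (Inl u) z = 0" if "a + s \<le> u" "u < k" "M.pos u = v" for u
      using z that unfolding mem_cell[OF v] by blast
    have zR: "dco (Inr u) z = 0" if "c + s \<le> u" "u < l" "N.pos u = v" for u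
      using z that unfolding mem_cell[OF v] by blast
    have TL: "dco (Inl u) (Mp DS v z) = (if Suc u < k then dco (Inl (Suc u)) z else 0)"
      if "u < k" "M.pos u = wrap r (v - 1)" for u
      using M.co_Mp[OF v zS(1) that] by (simp add: Mp_dsum)
    have TR: "dco (Inr u) (Mp DS v z) = (if Suc u < l then dco (Inr (Suc u)) z else 0)"
      if "u < l" "N.pos u = wrap r (v - 1)" for u
      using N.co_Mp[OF v zS(2) that] by (simp add: Mp_dsum)
    show "Mp DS v z \<in> cell a c s \<alpha> \<beta> (wrap r (v - 1))"
      unfolding mem_cell[OF w]
    proof (intro conjI allI impI)
      show "Mp DS v z \<in> Sp DS (wrap r (v - 1))"
        using lin_onD(1)[OF M.lin[OF v] zS(1)] lin_onD(1)[OF N.lin[OF v] zS(2)] by (simp add: Sp_dsum Mp_dsum)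
      show "dco (Inl u) (Mp DS v z) = 0" if u: "a + s \<le> u \<and> u < k \<and> M.pos u = wrap r (v - 1)" for u
        using TL[of u] zL[of "Suc u"] M.pos_Suc[OF v, of u] u by (simp del: dsimps)
      show "dco (Inr u) (Mp DS v z) = 0" if u: "c + s \<le> u \<and> u < l \<and> N.pos u = wrap r (v - 1)" for u
        using TR[of u] zR[of "Suc u"] N.pos_Suc[OF v, of u] u by (simp del: dsimps)
      fix u assume u: "u < s" "M.pos (a + u) = wrap r (v - 1)"
      have uN: "N.pos (c + u) = wrap r (v - 1)" using cell_okD[OF ok u(1)] u(2) by simp
      have pv: "M.pos (a + Suc u) = v" "N.pos (c + Suc u) = v"
        using M.pos_Suc[OF v, of "a + u"] N.pos_Suc[OF v, of "c + u"] u(2) uN by simp_all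
      have 1: "dco (Inl (a + u)) (Mp DS v z) = (if Suc u < s then dco (Inl (a + Suc u)) z else 0)"
        using TL[OF _ u(2)] zL[OF _ _ pv(1)] u(1) ok' by (auto simp del: dsimps)
      have 2: "dco (Inr (c + u)) (Mp DS v z) = (if Suc u < s then dco (Inr (c + Suc u)) z else 0)"
        using TR[OF _ uN] zR[OF _ _ pv(2)] u(1) ok' by (auto simp del: dsimps)
      have "Suc u < s \<Longrightarrow> \<beta> * dco (Inl (a + Suc u)) z = \<alpha> * dco (Inr (c + Suc u)) z"
        using z pv(1) unfolding mem_cell[OF v] by blast
      then show "\<beta> * dco (Inl (a + u)) (Mp DS v z) = \<alpha> * dco (Inr (c + u)) (Mp DS v z)"
        unfolding 1 2 by (simp del: dsimps)
    qed
  qed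
qed

end

lemma wrap_inj: "wrap r x = wrap r y \<Longrightarrow> \<bar>x - y\<bar> < r \<Longrightarrow> x = y"
  unfolding wrap_eq_iff mod_eq_dvd_iff using dvd_imp_le_int[of "x - y" r] by fastforce

lemma case_sum_0_right:
  "case_sum 0 0 = (0 :: ('b + 'c) cvec)" "case_sum 0 (y + y') = (case_sum 0 y + case_sum 0 y' :: ('b + 'c) cvec)"
  "case_sum 0 (cscale d y) = cscale d (case_sum 0 y :: ('b + 'c) cvec)"
  by (auto simp: fun_eq_iff cscale_def split: sum.splits)

lemma path_map_dsum:
  "path_map r (rep_dsum M N) m v z \<circ> Inl = path_map r M m v (z \<circ> Inl)"
  "path_map r (rep_dsum M N) m v z \<circ> Inr = path_map r N m v (z \<circ> Inr)"
  by (induction m arbitrary: v z) (simp_all add: Mp_dsum)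

lemma (in uniserial) path_map_b:
  assumes "u + m < n"
  shows "path_map r M m (pos (u + m)) (b (u + m)) = b u"
proof (rule Sp_eqI[of "pos u"])
  have v: "pos (u + m) \<in> {1..r}" "pos u \<in> {1..r}" by (rule wrap_in[OF r_pos])+
  have bin: "b (u + m) \<in> Sp M (pos (u + m))" "b u \<in> Sp M (pos u)"
    using assms b_in[of "u + m"] b_in[of u] by simp_all
  show "pos u \<in> {1..r}" by (rule v(2))
  show "path_map r M m (pos (u + m)) (b (u + m)) \<in> Sp M (pos u)"
    using path_map_in[OF v(1) bin(1), of m] unfolding pos_add .
  show "b u \<in> Sp M (pos u)" by (rule bin(2))
  fix x assume x: "x \<in> {..<n}" "pos x = pos u"
  have "co x (path_map r M m (pos (u + m)) (b (u + m))) = (if x + m < n then co (x + m) (b (u + m)) else 0)"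
    using x by (intro co_path_map[OF v(1) bin(1)]) (simp_all only: pos_add lessThan_iff)
  also have "\<dots> = (if x = u then 1 else 0)"
  proof -
    have "pos (x + m) = wrap r (pos x + int m)" by (simp add: wrap_wrap_add add.assoc)
    also have "\<dots> = pos (u + m)" unfolding x(2) by (simp add: wrap_wrap_add add.assoc)
    finally have "x + m < n \<Longrightarrow> co (x + m) (b (u + m)) = (if u + m = x + m then 1 else 0)"
      using assms by (intro co_b) auto
    then show ?thesis using assms by auto
  qed
  also have "\<dots> = co x (b u)"
    using co_b[of x u] x assms by auto
  finally show "co x (path_map r M m (pos (u + m)) (b (u + m))) = co x (b u)" .
qed

lemma (in uniserial) path_map_b_0:
  assumes "u < n" "u < m"
  shows "path_map r M m (pos u) (b u) = 0"
proof -
  have v: "pos u \<in> {1..r}" by (rule wrap_in[OF r_pos])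
  show ?thesis
  proof (rule path_map_eq_0_mono[OF r_pos lin Sp_subspace v])
    show "Suc u \<le> m" using assms by simp
    have "path_map r M u (pos u) (b u) = b 0" using path_map_b[of 0 u] assms by simp
    moreover have "wrap r (pos u - int u) = pos 0" using pos_add[of 0 u] by simp
    ultimately show "path_map r M (Suc u) (pos u) (b u) = 0"
      unfolding path_map_Suc'[OF v] using Mp_b[of 0] assms by simp
  qed
qed

text \<open>The bound on the length implies that every vertex occurs at most once as a composition
  factor of the first summand, and some vertex not at all.\<close>

locale short_uniserial_pair = uniserial_pair r M i k b co N j l b' co'
  for r :: int and M :: "'b rep" and i :: int and k :: nat and b co
    and N :: "'c rep" and j :: int and l :: nat and b' co' +
  assumes k_less: "int k < r"
begin

text \<open>Let the projection of the submodule \<open>U\<close> to the first summand have length \<open>a1\<close>, and the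
  intersection with the second summand length \<open>c\<close>. A lift \<open>z0\<close> of the top basis vector
  \<open>b (a1 - 1)\<close> generates lifts \<open>h u\<close> of all \<open>b u\<close>. The second component of \<open>z0\<close> matters modulo
  length \<open>c\<close> only, and it has no coefficients from \<open>a1 + c\<close> on, as a path of length \<open>a1\<close> kills
  the first component. As \<open>a1 < r\<close>, at most one index \<open>t\<close> with the right vertex remains in
  between; the coefficient there is the slope.\<close>

lemma lift_generators:
  assumes U: "submodule r DS U" and a1: "a1 \<le> k"
    and Pv: "\<And>v x. v \<in> {1..r} \<Longrightarrow> x \<in> M.Sub a1 v \<longleftrightarrow> (\<exists>z\<in>U v. z \<circ> Inl = x)"
    and c: "c \<le> l" and Qv: "\<And>v y. v \<in> {1..r} \<Longrightarrow> y \<in> N.Sub c v \<longleftrightarrow> case_sum 0 y \<in> U v"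
  obtains s \<gamma> h where "s \<le> a1" "c + s \<le> l" "s = 0 \<or> M.pos (a1 - s) = N.pos c"
    "\<And>u. u < a1 \<Longrightarrow> h u \<in> U (M.pos u)" "\<And>u. u < a1 \<Longrightarrow> h u \<circ> Inl = b u"
    "\<And>u x. u < a1 \<Longrightarrow> c \<le> x \<Longrightarrow> x < l \<Longrightarrow> N.pos x = M.pos u \<Longrightarrow>
       co' x (h u \<circ> Inr) = (if s > 0 \<and> a1 - s + (x - c) = u then \<gamma> else 0)"
proof (cases "a1 = 0")
  case True
  then show thesis using that[of 0] c by simp
next
  case False
  define e where "e = a1 - 1"
  have e: "e < a1" "e < k" "a1 = Suc e" using False a1 by (auto simp: e_def)
  define v where "v = M.pos e"
  have v: "v \<in> {1..r}" unfolding v_def by (rule wrap_in[OF M.r_pos])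
  have "b e \<in> M.Sub a1 v"
    unfolding v_def using M.b_in_Sub[OF e(2)] e(1) by simp
  then obtain z0 where z0: "z0 \<in> U v" "z0 \<circ> Inl = b e" using Pv[OF v] by blast
  have z0N: "z0 \<circ> Inr \<in> Sp N v"
    using submoduleD(2)[OF U v] z0(1) Sp_dsum by blast
  define y where "y t = co' t (z0 \<circ> Inr)" for t
  have y_path: "co' x (path_map r DS m v z0 \<circ> Inr) = (if x + m < l then y (x + m) else 0)"
    if "x < l" "N.pos x = wrap r (v - int m)" for x m
    unfolding path_map_dsum y_def by (rule N.co_path_map[OF v z0N that])
  have y0: "y t = 0" if t: "a1 + c \<le> t" "t < l" "N.pos t = v" for t
  proof -
    let ?w = "wrap r (v - int a1)"
    have w: "?w \<in> {1..r}" by (rule wrap_in[OF M.r_pos])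
    have "path_map r DS a1 v z0 \<in> U ?w" by (rule submodule_path_map[OF M.r_pos U v z0(1)])
    moreover have "path_map r DS a1 v z0 \<circ> Inl = 0"
      unfolding path_map_dsum z0(2) v_def by (rule M.path_map_b_0[OF e(2,1)])
    ultimately have "case_sum 0 (path_map r DS a1 v z0 \<circ> Inr) \<in> U ?w"
      using case_sum_expand[of "path_map r DS a1 v z0"] by simp
    then have "path_map r DS a1 v z0 \<circ> Inr \<in> N.Sub c ?w" using Qv[OF w] by simp
    moreover have px: "N.pos (t - a1) = ?w"
      using N.pos_add[of "t - a1" a1] t by simp
    ultimately have "co' (t - a1) (path_map r DS a1 v z0 \<circ> Inr) = 0"
      using t(1,2) unfolding N.mem_Sub[OF w]
      by (elim conjE allE[of _ "t - a1"] impE) (intro conjI, linarith+)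
    then show ?thesis using y_path[OF _ px] t by simp
  qed
  define T where "T = {t. c \<le> t \<and> t < a1 + c \<and> t < l \<and> N.pos t = v}"
  have T_unique: "t = t'" if "t \<in> T" "t' \<in> T" for t t'
  proof -
    have "wrap r (j + int t) = wrap r (j + int t')" using that by (simp add: T_def)
    moreover have "\<bar>(j + int t) - (j + int t')\<bar> < r"
      using that k_less a1 by (auto simp: T_def)
    ultimately have "j + int t = j + int t'" by (rule wrap_inj)
    then show ?thesis by simp
  qed
  define h where "h u = path_map r DS (e - u) v z0" for u
  have hU: "h u \<in> U (M.pos u)" and hL: "h u \<circ> Inl = b u" if u: "u < a1" for u
  proof -
    have eu: "e = u + (e - u)" using u e by simp
    have "wrap r (v - int (e - u)) = M.pos u"
      unfolding v_def by (subst eu) (rule M.pos_add)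
    then show "h u \<in> U (M.pos u)"
      using submodule_path_map[OF M.r_pos U v z0(1), of "e - u"] by (simp add: h_def)
    show "h u \<circ> Inl = b u"
      unfolding h_def path_map_dsum z0(2) v_def
      using M.path_map_b[of u "e - u"] eu e(2) by simp
  qed
  have hR: "co' x (h u \<circ> Inr) = (if x + (e - u) < l then y (x + (e - u)) else 0)"
    and px: "N.pos (x + (e - u)) = v" if u: "u < a1" "x < l" "N.pos x = M.pos u" for u x
  proof -
    have eu: "e = u + (e - u)" using u e by simp
    have "wrap r (v - int (e - u)) = M.pos u"
      unfolding v_def by (subst eu) (rule M.pos_add)
    then show "co' x (h u \<circ> Inr) = (if x + (e - u) < l then y (x + (e - u)) else 0)"
      unfolding h_def using u by (intro y_path) simp_all
    have "N.pos (x + (e - u)) = wrap r (N.pos x + int (e - u))"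
      by (simp add: wrap_wrap_add add.assoc)
    also have "\<dots> = M.pos (u + (e - u))"
      unfolding u(3) by (simp add: wrap_wrap_add add.assoc)
    finally show "N.pos (x + (e - u)) = v" unfolding v_def eu[symmetric] .
  qed
  show thesis
  proof (cases "T = {}")
    case True
    show thesis
    proof (rule that[of 0 h 0])
      fix u x assume u: "u < a1" "c \<le> x" "x < l" "N.pos x = M.pos u"
      have "y (x + (e - u)) = 0" if "x + (e - u) < l"
      proof (rule y0)
        show "a1 + c \<le> x + (e - u)"
          using True that px[OF u(1,3,4)] u(2) by (force simp: T_def)
      qed (use that px[OF u(1,3,4)] in simp_all)
      then show "co' x (h u \<circ> Inr) = (if 0 < (0::nat) \<and> a1 - 0 + (x - c) = u then 0 else 0)"
        using hR[OF u(1,3,4)] by simp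
    qed (use c hU hL in simp_all)
  next
    case False
    then obtain t where t: "t \<in> T" by blast
    have tT: "c \<le> t" "t < a1 + c" "t < l" "N.pos t = v" using t by (auto simp: T_def)
    define s where "s = Suc (t - c)"
    have s: "s \<le> a1" "c + s \<le> l" "s > 0" using tT by (auto simp: s_def)
    have "N.pos c = wrap r (N.pos t - int (t - c))"
      using N.pos_add[of c "t - c"] tT(1) by simp
    also have "\<dots> = wrap r (M.pos (a1 - s + (t - c)) - int (t - c))"
    proof -
      have "a1 - s + (t - c) = e" using tT s_def e by auto
      then show ?thesis unfolding tT(4) v_def by simp
    qed
    also have "\<dots> = M.pos (a1 - s)" by (rule M.pos_add)
    finally have pos: "M.pos (a1 - s) = N.pos c" by simp
    show thesis
    proof (rule that[of s h "y t"])
      fix u x assume u: "u < a1" "c \<le> x" "x < l" "N.pos x = M.pos u"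
      have eq: "a1 - s + (x - c) = u \<longleftrightarrow> x + (e - u) = t"
        using u e tT s_def by auto
      have "co' x (h u \<circ> Inr) = (if x + (e - u) = t then y t else 0)"
      proof (cases "x + (e - u) < l")
        case True
        have "y (x + (e - u)) = 0" if ne: "x + (e - u) \<noteq> t"
        proof -
          have "x + (e - u) \<notin> T" using T_unique[OF _ t, of "x + (e - u)"] ne by blast
          then have "\<not> x + (e - u) < a1 + c"
            using True px[OF u(1,3,4)] u(2) unfolding T_def by simp
          then show ?thesis using True px[OF u(1,3,4)] by (intro y0) simp_all
        qed
        then show ?thesis
          using hR[OF u(1,3,4)] True by auto
      next
        case False
        then show ?thesis using hR[OF u(1,3,4)] tT by auto
      qed
      then show "co' x (h u \<circ> Inr) = (if s > 0 \<and> a1 - s + (x - c) = u then y t else 0)"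
        unfolding eq using s(3) by simp
    qed (use s pos hU hL in simp_all)
  qed
qed

text \<open>Modulo its intersection with the second summand, a submodule is spanned by the lifts of
  the previous lemma. The value 1 of \<open>\<alpha>\<close> is no restriction: a diagonal with \<open>\<alpha> = 0\<close> lies in the
  second summand and belongs to a cell with \<open>s = 0\<close>.\<close>

lemma submodule_dsum_cases:
  assumes U: "submodule r DS U"
  obtains a c s \<gamma> where "cell_ok a c s" "U = cell a c s 1 \<gamma>"
proof -
  note subU = submoduleD(1)[OF U] and USp = submoduleD(2)[OF U] and MU = submoduleD(4)[OF U]
  have w: "wrap r (v - 1) \<in> {1..r}" for v by (rule wrap_in[OF M.r_pos])
  define P where "P = (\<lambda>v\<in>{1..r}. (\<lambda>z. z \<circ> Inl) ` U v)"
  have P: "P v = (\<lambda>z. z \<circ> Inl) ` U v" if "v \<in> {1..r}" for v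
    using that by (simp only: P_def restrict_apply if_True)
  have "submodule r M P"
    unfolding submodule_def
  proof (intro conjI ballI)
    show "P \<in> extensional {1..r}" unfolding P_def by (rule restrict_extensional)
    fix v assume v: "v \<in> {1..r}"
    show "cvec.subspace (P v)"
      unfolding cvec.subspace_def P[OF v]
    proof (intro conjI ballI allI)
      show "0 \<in> (\<lambda>z. z \<circ> Inl) ` U v"
        using cvec.subspace_0[OF subU[OF v]] comp_zero by (metis image_eqI)
      show "x + y \<in> (\<lambda>z. z \<circ> Inl) ` U v" if "x \<in> (\<lambda>z. z \<circ> Inl) ` U v" "y \<in> (\<lambda>z. z \<circ> Inl) ` U v" for x y
        using that cvec.subspace_add[OF subU[OF v]] by (auto simp flip: comp_add)
      show "cscale d x \<in> (\<lambda>z. z \<circ> Inl) ` U v" if "x \<in> (\<lambda>z. z \<circ> Inl) ` U v" for d x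
        using that cvec.subspace_scale[OF subU[OF v]] by (auto simp flip: comp_cscale)
    qed
    show "P v \<subseteq> Sp M v"
      unfolding P[OF v] using USp[OF v] Sp_dsum by blast
    show "Mp M v ` P v \<subseteq> P (wrap r (v - 1))"
      unfolding P[OF v] P[OF w] image_image
    proof (rule image_subsetI)
      fix z assume "z \<in> U v"
      then show "Mp M v (z \<circ> Inl) \<in> (\<lambda>z. z \<circ> Inl) ` U (wrap r (v - 1))"
        using imageI[OF MU[OF v], of z "\<lambda>z. z \<circ> Inl"] unfolding Mp_dsum by simp
    qed
  qed
  then obtain a1 where a1: "a1 \<le> k" "P = M.Sub a1" using M.submodule_cases by blast
  have Pv: "x \<in> M.Sub a1 v \<longleftrightarrow> (\<exists>z\<in>U v. z \<circ> Inl = x)" if "v \<in> {1..r}" for v x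
    using P[OF that] a1(2) by auto
  define Q where "Q = (\<lambda>v\<in>{1..r}. {y. case_sum 0 y \<in> U v})"
  have Q: "Q v = {y. case_sum 0 y \<in> U v}" if "v \<in> {1..r}" for v
    using that by (simp only: Q_def restrict_apply if_True)
  have "submodule r N Q"
    unfolding submodule_def
  proof (intro conjI ballI)
    show "Q \<in> extensional {1..r}" unfolding Q_def by (rule restrict_extensional)
    fix v assume v: "v \<in> {1..r}"
    show "cvec.subspace (Q v)"
      unfolding cvec.subspace_def Q[OF v] mem_Collect_eq
    proof (intro conjI ballI allI)
      show "case_sum 0 0 \<in> U v"
        unfolding case_sum_0_right by (rule cvec.subspace_0[OF subU[OF v]])
      show "case_sum 0 (x + y) \<in> U v" if "x \<in> {y. case_sum 0 y \<in> U v}" "y \<in> {y. case_sum 0 y \<in> U v}" for x y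
        using that unfolding case_sum_0_right mem_Collect_eq by (rule cvec.subspace_add[OF subU[OF v]])
      show "case_sum 0 (cscale d x) \<in> U v" if "x \<in> {y. case_sum 0 y \<in> U v}" for d x
        using that unfolding case_sum_0_right mem_Collect_eq by (rule cvec.subspace_scale[OF subU[OF v]])
    qed
    show "Q v \<subseteq> Sp N v"
    proof
      fix y assume "y \<in> Q v"
      then have "case_sum 0 y \<in> Sp DS v" using USp[OF v] Q[OF v] by blast
      then show "y \<in> Sp N v" unfolding Sp_dsum case_sum_comp by blast
    qed
    have "Mp M v 0 = 0"
      using lin_onD(3)[OF M.lin[OF v] cvec.subspace_0[OF M.Sp_subspace[OF v]], of 0] by simp
    then have Mp_0: "Mp DS v (case_sum 0 y) = case_sum 0 (Mp N v y)" for y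
      unfolding rep_dsum_def by (simp only: rep.select_convs case_sum_comp)
    show "Mp N v ` Q v \<subseteq> Q (wrap r (v - 1))"
      unfolding Q[OF v] Q[OF w]
    proof (rule image_subsetI)
      fix y assume "y \<in> {y. case_sum 0 y \<in> U v}"
      then have "case_sum 0 (Mp N v y) \<in> U (wrap r (v - 1))"
        unfolding Mp_0[symmetric] mem_Collect_eq by (rule MU[OF v])
      then show "Mp N v y \<in> {y. case_sum 0 y \<in> U (wrap r (v - 1))}" unfolding mem_Collect_eq .
    qed
  qed
  then obtain c where c: "c \<le> l" "Q = N.Sub c" using N.submodule_cases by blast
  have Qv: "y \<in> N.Sub c v \<longleftrightarrow> case_sum 0 y \<in> U v" if "v \<in> {1..r}" for v y
    using Q[OF that] c(2) by auto
  obtain s \<gamma> h where s: "s \<le> a1" "c + s \<le> l" "s = 0 \<or> M.pos (a1 - s) = N.pos c"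
    and hU: "\<And>u. u < a1 \<Longrightarrow> h u \<in> U (M.pos u)" and hL: "\<And>u. u < a1 \<Longrightarrow> h u \<circ> Inl = b u"
    and hR: "\<And>u x. u < a1 \<Longrightarrow> c \<le> x \<Longrightarrow> x < l \<Longrightarrow> N.pos x = M.pos u \<Longrightarrow>
       co' x (h u \<circ> Inr) = (if s > 0 \<and> a1 - s + (x - c) = u then \<gamma> else 0)"
    by (rule lift_generators[OF U a1(1) _ c(1)]) (assumption | rule Pv Qv that)+
  define a where "a = a1 - s"
  have as: "a + s = a1" using s(1) by (simp add: a_def)
  have ok: "cell_ok a c s" using s a1(1) by (simp add: cell_ok_def a_def)
  have iff: "z \<in> U v \<longleftrightarrow> z \<in> cell a c s 1 \<gamma> v"
    if v: "v \<in> {1..r}" and z: "z \<in> Sp DS v" and top: "\<And>u. a1 \<le> u \<Longrightarrow> u < k \<Longrightarrow> M.pos u = v \<Longrightarrow> co u (z \<circ> Inl) = 0"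
    for v z
  proof -
    let ?J = "{u. u < a1 \<and> M.pos u = v}"
    define x where "x = (\<Sum>u\<in>?J. cscale (co u (z \<circ> Inl)) (h u))"
    have xU: "x \<in> U v"
      unfolding x_def
    proof (rule cvec.subspace_sum[OF subU[OF v]])
      fix u assume "u \<in> ?J"
      then have "h u \<in> U v" using hU[of u] by auto
      then show "cscale (co u (z \<circ> Inl)) (h u) \<in> U v" by (rule cvec.subspace_scale[OF subU[OF v]])
    qed
    have "x \<circ> Inl = (\<Sum>u\<in>?J. cscale (co u (z \<circ> Inl)) (b u))"
      unfolding x_def comp_sum comp_cscale using hL by (intro sum.cong) auto
    also have "\<dots> = (\<Sum>u\<in>{u \<in> {..<k}. M.pos u = v}. cscale (co u (z \<circ> Inl)) (b u))"
      using a1(1) top by (intro sum.mono_neutral_left) auto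
    also have "\<dots> = z \<circ> Inl"
      using z M.expand[OF v, of "z \<circ> Inl"] unfolding Sp_dsum by simp
    finally have xL: "x \<circ> Inl = z \<circ> Inl" .
    have diff: "z - x = case_sum 0 ((z \<circ> Inr) - (x \<circ> Inr))"
      using xL by (auto simp: fun_eq_iff split: sum.splits)
    have "z \<in> U v \<longleftrightarrow> z - x \<in> U v"
    proof
      assume "z \<in> U v"
      then show "z - x \<in> U v" using cvec.subspace_diff[OF subU[OF v]] xU by blast
    next
      assume "z - x \<in> U v"
      from cvec.subspace_add[OF subU[OF v] this xU] show "z \<in> U v" by simp
    qed
    also have "\<dots> \<longleftrightarrow> (z \<circ> Inr) - (x \<circ> Inr) \<in> N.Sub c v"
      unfolding diff Qv[OF v] ..
    also have "\<dots> \<longleftrightarrow> (\<forall>t. c \<le> t \<and> t < l \<and> N.pos t = v \<longrightarrow> co' t (z \<circ> Inr) = co' t (x \<circ> Inr))"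
    proof -
      have "x \<in> Sp DS v" using xU USp[OF v] by blast
      then have "(z \<circ> Inr) - (x \<circ> Inr) \<in> Sp N v"
        using z cvec.subspace_diff[OF N.Sp_subspace[OF v]] unfolding Sp_dsum by blast
      then show ?thesis unfolding N.mem_Sub[OF v] by auto
    qed
    also have "\<dots> \<longleftrightarrow> (\<forall>t. c \<le> t \<and> t < l \<and> N.pos t = v \<longrightarrow>
        co' t (z \<circ> Inr) = (if t < c + s then \<gamma> * co (a + (t - c)) (z \<circ> Inl) else 0))"
    proof -
      have "co' t (x \<circ> Inr) = (if t < c + s then \<gamma> * co (a + (t - c)) (z \<circ> Inl) else 0)"
        if t: "c \<le> t" "t < l" "N.pos t = v" for t
      proof -
        have tl: "t \<in> {..<l}" using t by simp
        have "co' t (x \<circ> Inr) = (\<Sum>u\<in>?J. co u (z \<circ> Inl) * co' t (h u \<circ> Inr))"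
          unfolding x_def comp_sum comp_cscale N.co_sum[OF tl] N.co_scale[OF tl] ..
        also have "\<dots> = (\<Sum>u\<in>?J. if u = a + (t - c) then (if s > 0 then \<gamma> * co (a + (t - c)) (z \<circ> Inl) else 0) else 0)"
          using hR[OF _ t(1,2)] t(3) by (intro sum.cong) (auto simp: a_def)
        also have "\<dots> = (if a + (t - c) \<in> ?J then (if s > 0 then \<gamma> * co (a + (t - c)) (z \<circ> Inl) else 0) else 0)"
          by (rule sum.delta) simp
        also have "\<dots> = (if t < c + s then \<gamma> * co (a + (t - c)) (z \<circ> Inl) else 0)"
        proof (cases "t < c + s")
          case True
          then have "M.pos (a + (t - c)) = v" using cell_okD[OF ok, of "t - c"] t by simp
          then have "a + (t - c) \<in> ?J" "s > 0" using True t as by auto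
          then show ?thesis using True by simp
        next
          case False
          then have "a + (t - c) \<notin> ?J" using t as by auto
          then show ?thesis using False by (simp only: if_False)
        qed
        finally show ?thesis .
      qed
      then show ?thesis by auto
    qed
    also have "\<dots> \<longleftrightarrow> z \<in> cell a c s 1 \<gamma> v"
    proof
      assume A: "\<forall>t. c \<le> t \<and> t < l \<and> N.pos t = v \<longrightarrow>
        co' t (z \<circ> Inr) = (if t < c + s then \<gamma> * co (a + (t - c)) (z \<circ> Inl) else 0)"
      show "z \<in> cell a c s 1 \<gamma> v"
        unfolding mem_cell[OF v] dsimps
      proof (intro conjI allI impI)
        show "z \<in> Sp DS v" by (rule z)
        show "co u (z \<circ> Inl) = 0" if "a + s \<le> u \<and> u < k \<and> M.pos u = v" for u
          using top that as by simp
        show "co' t (z \<circ> Inr) = 0" if "c + s \<le> t \<and> t < l \<and> N.pos t = v" for t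
          using A that by auto
        fix u assume u: "u < s" "M.pos (a + u) = v"
        then have "N.pos (c + u) = v" using cell_okD[OF ok] by simp
        then show "\<gamma> * co (a + u) (z \<circ> Inl) = 1 * co' (c + u) (z \<circ> Inr)"
          using A[rule_format, of "c + u"] u s(2) by simp
      qed
    next
      assume C: "z \<in> cell a c s 1 \<gamma> v"
      show "\<forall>t. c \<le> t \<and> t < l \<and> N.pos t = v \<longrightarrow>
        co' t (z \<circ> Inr) = (if t < c + s then \<gamma> * co (a + (t - c)) (z \<circ> Inl) else 0)"
      proof (intro allI impI)
        fix t assume t: "c \<le> t \<and> t < l \<and> N.pos t = v"
        show "co' t (z \<circ> Inr) = (if t < c + s then \<gamma> * co (a + (t - c)) (z \<circ> Inl) else 0)"
        proof (cases "t < c + s")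
          case True
          then have u: "t - c < s" "M.pos (a + (t - c)) = v"
            using cell_okD[OF ok, of "t - c"] t by auto
          have "\<gamma> * dco (Inl (a + (t - c))) z = 1 * dco (Inr (c + (t - c))) z"
            using C u unfolding mem_cell[OF v] by blast
          then show ?thesis using True t by simp
        next
          case False
          then have "c + s \<le> t \<and> t < l \<and> N.pos t = v" using t by simp
          then have "dco (Inr t) z = 0"
            using C unfolding mem_cell[OF v] by blast
          then show ?thesis using False by simp
        qed
      qed
    qed
    finally show ?thesis .
  qed
  have "U v = cell a c s 1 \<gamma> v" for v
  proof (cases "v \<in> {1..r}")
    case True
    show ?thesis
    proof (intro equalityI subsetI)
      fix z assume z: "z \<in> U v"
      then have "z \<circ> Inl \<in> M.Sub a1 v" using Pv[OF True] by blast
      then have "co u (z \<circ> Inl) = 0" if "a1 \<le> u" "u < k" "M.pos u = v" for u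
        using that unfolding M.mem_Sub[OF True] by blast
      then show "z \<in> cell a c s 1 \<gamma> v" using iff[OF True] z USp[OF True] by blast
    next
      fix z assume z: "z \<in> cell a c s 1 \<gamma> v"
      then have "dco (Inl u) z = 0" if "a1 \<le> u" "u < k" "M.pos u = v" for u
        using that unfolding mem_cell[OF True] as by blast
      then show "z \<in> U v" using iff[OF True] z unfolding dsimps mem_cell[OF True] by blast
    qed
  next
    case False
    then show ?thesis using submodule_undefined[OF U] cell_undefined by simp
  qed
  then have "U = cell a c s 1 \<gamma>" by (rule ext)
  then show thesis using that ok by blast
qed

end

section \<open>Dimension vectors of uniserial representations\<close>

text \<open>The dimension vector of the uniserial module with socle \<open>i\<close> and length \<open>t\<close>.\<close>

definition cnt :: "int \<Rightarrow> int \<Rightarrow> nat \<Rightarrow> int \<Rightarrow> nat"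
  where "cnt r i t v = card {u. u < t \<and> wrap r (i + int u) = v}"

lemma cnt_0 [simp]: "cnt r i 0 v = 0"
  by (simp add: cnt_def)

lemma cnt_Suc: "cnt r i (Suc t) v = cnt r i t v + (if wrap r (i + int t) = v then 1 else 0)"
proof -
  have fin: "finite {u. u < t \<and> wrap r (i + int u) = v}" by simp
  show ?thesis
  proof (cases "wrap r (i + int t) = v")
    case True
    have "{u. u < Suc t \<and> wrap r (i + int u) = v} = insert t {u. u < t \<and> wrap r (i + int u) = v}"
      using True by (auto simp: less_Suc_eq)
    then show ?thesis using fin True by (simp add: cnt_def)
  next
    case False
    then have "{u. u < Suc t \<and> wrap r (i + int u) = v} = {u. u < t \<and> wrap r (i + int u) = v}"
      by (auto simp: less_Suc_eq)
    then show ?thesis using False by (simp add: cnt_def)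
  qed
qed

lemma cnt_add: "cnt r i (s + t) v = cnt r i s v + cnt r (i + int s) t v"
  by (induction t) (simp_all add: cnt_Suc add.assoc)

lemma cnt_wrap_cong:
  assumes "wrap r i = wrap r j"
  shows "cnt r i t v = cnt r j t v"
proof -
  have "wrap r (i + int u) = wrap r (j + int u)" for u
    unfolding wrap_wrap_add[of r i, symmetric] assms unfolding wrap_wrap_add ..
  then show ?thesis by (simp only: cnt_def)
qed

lemma sum_cnt: "r \<ge> 1 \<Longrightarrow> (\<Sum>v\<in>{1..r}. cnt r i t v) = t"
proof (induction t)
  case (Suc t)
  have "(\<Sum>v\<in>{1..r}. if wrap r (i + int t) = v then 1 else 0) = (1::nat)"
    using wrap_in[OF Suc.prems, of "i + int t"] by (simp del: atLeastAtMost_iff)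
  then show ?case using Suc by (simp add: cnt_Suc sum.distrib)
qed simp

text \<open>A proper non-empty interval of the cycle is determined by its set of vertices: its first
  vertex is the only one that belongs to it while its predecessor does not.\<close>

lemma cnt_start_unique:
  assumes r: "r \<ge> 1" and s: "0 < s" "int s < r"
    and eq: "\<And>v. v \<in> {1..r} \<Longrightarrow> cnt r x s v = cnt r y s v"
  shows "wrap r x = wrap r y"
proof -
  have pos_iff: "(\<exists>u<s. wrap r (z + int u) = v) \<longleftrightarrow> cnt r z s v > 0" for z v
  proof -
    have "finite {u. u < s \<and> wrap r (z + int u) = v}" by simp
    then show ?thesis unfolding cnt_def card_gt_0_iff by auto
  qed
  have "cnt r x s (wrap r x) > 0"
    unfolding pos_iff[symmetric] using s(1) by (intro exI[of _ 0]) simp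
  then have "cnt r y s (wrap r x) > 0" using eq[OF wrap_in[OF r]] by simp
  then obtain u where u: "u < s" "wrap r (y + int u) = wrap r x" unfolding pos_iff[symmetric] by blast
  show ?thesis
  proof (cases u)
    case 0
    then show ?thesis using u by simp
  next
    case (Suc u')
    have yu: "y + int u' = (y + int u) - 1" using Suc by simp
    have "wrap r (y + int u') = wrap r (wrap r (y + int u) - 1)" unfolding wrap_wrap_diff yu ..
    also have "\<dots> = wrap r (x - 1)" unfolding u(2) by (rule wrap_wrap_diff)
    finally have "cnt r y s (wrap r (x - 1)) > 0"
      unfolding pos_iff[symmetric] using u(1) Suc by (intro exI[of _ u']) simp
    then have "cnt r x s (wrap r (x - 1)) > 0" using eq[OF wrap_in[OF r]] by simp
    then obtain w where w: "w < s" "wrap r (x + int w) = wrap r (x - 1)" unfolding pos_iff[symmetric] by blast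
    have "x + int w = x - 1" using w s by (intro wrap_inj[OF w(2)]) simp
    then show ?thesis by simp
  qed
qed

section \<open>The projective line and the sphere\<close>

text \<open>With \<open>c = cnj \<alpha> * \<beta>\<close>, \<open>n = \<bar>\<alpha>\<bar>\<^sup>2\<close> and \<open>m = \<bar>\<beta>\<bar>\<^sup>2\<close> this is the Hopf map, which identifies
  the projective line with the sphere. It is written in terms of \<open>c\<close>, \<open>n\<close> and \<open>m\<close> since these
  may be summed over several vectors of the same slope without changing the value.\<close>

definition hopf :: "complex \<Rightarrow> real \<Rightarrow> real \<Rightarrow> nat \<Rightarrow> real"
  where "hopf c n m = (\<lambda>i. if i = 0 then 2 * Re c / (n + m) else if i = 1 then 2 * Im c / (n + m)
    else if i = 2 then (n - m) / (n + m) else 0)"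

definition sphere2 :: "(nat \<Rightarrow> real) set"
  where "sphere2 = {p. (p 0)\<^sup>2 + (p 1)\<^sup>2 + (p 2)\<^sup>2 = 1 \<and> (\<forall>i>2. p i = 0)}"

lemma nsphere_sphere2: "nsphere 2 = top_of_set sphere2"
proof -
  have "(\<Sum>i\<le>2. (x i)\<^sup>2) = (x 0)\<^sup>2 + (x 1)\<^sup>2 + (x 2)\<^sup>2" for x :: "nat \<Rightarrow> real"
    by (simp add: numeral_2_eq_2)
  then show ?thesis
    unfolding nsphere sphere2_def euclidean_product_topology by simp
qed

text \<open>Homogeneous coordinates of the point of the projective line that stereographic projection
  assigns to a point of the sphere; the second chart is used at one pole only.\<close>

definition coord :: "(nat \<Rightarrow> real) \<Rightarrow> complex \<times> complex"
  where "coord p = (if p 2 \<noteq> - 1 then (of_real (1 + p 2), Complex (p 0) (p 1))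
    else (Complex (p 0) (- p 1), of_real (1 - p 2)))"

lemma coord_nonzero: "fst (coord p) \<noteq> 0 \<or> snd (coord p) \<noteq> 0"
proof (cases "p 2 = - 1")
  case False
  then have nz: "1 + p 2 \<noteq> 0" by linarith
  have "fst (coord p) = of_real (1 + p 2)"
    using False by (simp only: coord_def if_True not_False_eq_True fst_conv)
  then show ?thesis using nz by (simp only: of_real_eq_0_iff simp_thms)
next
  case True
  have "snd (coord p) = of_real (1 - p 2)"
    by (simp only: coord_def True if_False simp_thms snd_conv)
  then show ?thesis using True by simp
qed

text \<open>The function \<open>coord\<close> is not continuous at the pole with \<open>p 2 = - 1\<close>. Up to scaling it
  agrees there and nearby with the formula of the other chart, so as a point of the projective
  line it is continuous everywhere.\<close>

lemma coord_other_chart: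
  assumes p: "p \<in> sphere2" "p 2 \<noteq> 1"
  obtains \<gamma> where "\<gamma> \<noteq> 0" "fst (coord p) = \<gamma> * Complex (p 0) (- p 1)" "snd (coord p) = \<gamma> * of_real (1 - p 2)"
proof (cases "p 2 = - 1")
  case True
  then show ?thesis using that[of 1] by (simp add: coord_def)
next
  case False
  have s: "(p 0)\<^sup>2 + (p 1)\<^sup>2 = (1 + p 2) * (1 - p 2)"
    using p(1) by (simp add: sphere2_def algebra_simps power2_eq_square)
  have nz: "1 - p 2 \<noteq> 0" using p(2) by simp
  have nz': "1 + p 2 \<noteq> 0" using False by linarith
  have prod: "Complex (p 0) (p 1) * Complex (p 0) (- p 1) = of_real ((1 + p 2) * (1 - p 2))"
    unfolding s[symmetric] by (simp add: complex_eq_iff power2_eq_square)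
  show ?thesis
  proof (rule that[of "Complex (p 0) (p 1) / of_real (1 - p 2)"])
    have "Complex (p 0) (p 1) * Complex (p 0) (- p 1) \<noteq> 0"
      unfolding prod of_real_eq_0_iff using nz nz' by simp
    then have "Complex (p 0) (p 1) \<noteq> 0" by auto
    then show "Complex (p 0) (p 1) / of_real (1 - p 2) \<noteq> 0"
      using nz by (metis divide_eq_0_iff of_real_eq_0_iff)
    have "Complex (p 0) (p 1) / of_real (1 - p 2) * Complex (p 0) (- p 1) = of_real (1 + p 2)"
      using prod nz by (simp add: field_simps)
    then show "fst (coord p) = Complex (p 0) (p 1) / of_real (1 - p 2) * Complex (p 0) (- p 1)"
      using False by (simp add: coord_def)
    have "Complex (p 0) (p 1) / of_real (1 - p 2) * of_real (1 - p 2) = Complex (p 0) (p 1)"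
      using nz by (metis nonzero_eq_divide_eq of_real_eq_0_iff)
    then show "snd (coord p) = Complex (p 0) (p 1) / of_real (1 - p 2) * of_real (1 - p 2)"
      using False by (simp add: coord_def)
  qed
qed

lemma hopf_scale: "t \<noteq> 0 \<Longrightarrow> hopf (of_real t * c) (t * n) (t * m) = hopf c n m"
proof -
  assume t: "t \<noteq> 0"
  have "2 * (t * x) / (t * n + t * m) = 2 * x / (n + m)" for x
    using t by (simp add: mult.left_commute flip: distrib_left)
  moreover have "(t * n - t * m) / (t * n + t * m) = (n - m) / (n + m)"
    using t by (simp flip: distrib_left right_diff_distrib)
  ultimately show ?thesis unfolding hopf_def by (simp add: fun_eq_iff)
qed

lemma hopf_coord:
  assumes p: "p \<in> sphere2" and ab: "coord p = (\<alpha>, \<beta>)"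
  shows "hopf (cnj \<alpha> * \<beta>) ((cmod \<alpha>)\<^sup>2) ((cmod \<beta>)\<^sup>2) = p"
proof
  fix i
  have s: "(p 0)\<^sup>2 + (p 1)\<^sup>2 + (p 2)\<^sup>2 = 1" and i3: "i > 2 \<Longrightarrow> p i = 0"
    using p by (auto simp: sphere2_def)
  have "i = 0 \<or> i = 1 \<or> i = 2 \<or> i > 2" by linarith
  show "hopf (cnj \<alpha> * \<beta>) ((cmod \<alpha>)\<^sup>2) ((cmod \<beta>)\<^sup>2) i = p i"
  proof (cases "p 2 = - 1")
    case False
    have nz: "1 + p 2 \<noteq> 0" using False by linarith
    have ab': "\<alpha> = of_real (1 + p 2)" "\<beta> = Complex (p 0) (p 1)"
      using ab False by (simp_all add: coord_def)
    have n: "(cmod \<alpha>)\<^sup>2 = (1 + p 2) * (1 + p 2)" "(cmod \<beta>)\<^sup>2 = (1 + p 2) * (1 - p 2)"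
      using s unfolding ab' by (simp_all add: cmod_def power2_eq_square algebra_simps flip: power2_eq_square)
    have c: "cnj \<alpha> * \<beta> = of_real (1 + p 2) * Complex (p 0) (p 1)"
      unfolding ab' by simp
    have "hopf (cnj \<alpha> * \<beta>) ((cmod \<alpha>)\<^sup>2) ((cmod \<beta>)\<^sup>2) = hopf (Complex (p 0) (p 1)) (1 + p 2) (1 - p 2)"
      unfolding n c by (rule hopf_scale[OF nz])
    then show ?thesis
      using i3 by (auto simp: hopf_def)
  next
    case True
    then have 0: "p 0 = 0" "p 1 = 0" using s by (auto simp: sum_power2_eq_zero_iff)
    have ab': "\<alpha> = 0" "\<beta> = 2"
      using ab True 0 by (simp_all add: coord_def complex_eq_iff)
    show ?thesis using 0 True i3 unfolding ab' by (auto simp: hopf_def)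
  qed
qed

lemma coord_hopf:
  assumes ab: "\<alpha> \<noteq> 0 \<or> \<beta> \<noteq> 0"
  defines "p \<equiv> hopf (cnj \<alpha> * \<beta>) ((cmod \<alpha>)\<^sup>2) ((cmod \<beta>)\<^sup>2)"
  shows "p \<in> sphere2" "\<exists>\<gamma>. \<gamma> \<noteq> 0 \<and> coord p = (\<gamma> * \<alpha>, \<gamma> * \<beta>)"
proof -
  define n m where "n = (cmod \<alpha>)\<^sup>2" and "m = (cmod \<beta>)\<^sup>2"
  define c where "c = cnj \<alpha> * \<beta>"
  have nm: "n + m > 0" using ab by (auto simp: n_def m_def intro: add_pos_nonneg add_nonneg_pos)
  have c2: "(Re c)\<^sup>2 + (Im c)\<^sup>2 = n * m"
    unfolding cmod_power2[symmetric] c_def n_def m_def by (simp add: norm_mult power_mult_distrib)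
  have p: "p 0 = 2 * Re c / (n + m)" "p 1 = 2 * Im c / (n + m)" "p 2 = (n - m) / (n + m)" "\<forall>i>2. p i = 0"
    by (simp_all add: p_def hopf_def c_def n_def m_def)
  have "(p 0)\<^sup>2 + (p 1)\<^sup>2 + (p 2)\<^sup>2 = (4 * ((Re c)\<^sup>2 + (Im c)\<^sup>2) + (n - m)\<^sup>2) / (n + m)\<^sup>2"
    unfolding p by (simp add: power_divide power_mult_distrib add_divide_distrib)
  also have "4 * ((Re c)\<^sup>2 + (Im c)\<^sup>2) + (n - m)\<^sup>2 = (n + m)\<^sup>2"
    unfolding c2 by (simp add: power2_eq_square algebra_simps)
  finally show "p \<in> sphere2" using nm p(4) by (simp add: sphere2_def)
  have 1: "1 + p 2 = 2 * n / (n + m)" "1 - p 2 = 2 * m / (n + m)"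
    unfolding p using nm by (simp_all add: field_simps)
  show "\<exists>\<gamma>. \<gamma> \<noteq> 0 \<and> coord p = (\<gamma> * \<alpha>, \<gamma> * \<beta>)"
  proof (cases "\<alpha> = 0")
    case False
    then have n0: "n > 0" by (simp add: n_def)
    define g where "g = of_real (2 / (n + m)) * cnj \<alpha>"
    have "2 / (n + m) \<noteq> 0" using nm by simp
    then have g0: "g \<noteq> 0" unfolding g_def mult_eq_0_iff of_real_eq_0_iff using False by simp
    have "p 2 \<noteq> - 1"
    proof
      assume "p 2 = - 1"
      then have "2 * n / (n + m) = 0" using 1(1) by simp
      then show False using n0 nm by simp
    qed
    moreover have "complex_of_real (1 + p 2) = g * \<alpha>"
    proof -
      have "complex_of_real (1 + p 2) = of_real (2 / (n + m)) * of_real n" unfolding 1 by simp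
      moreover have "complex_of_real n = cnj \<alpha> * \<alpha>"
        unfolding n_def complex_norm_square by (rule mult.commute)
      ultimately show ?thesis by (simp only: g_def mult.assoc)
    qed
    moreover have "Complex (p 0) (p 1) = g * \<beta>"
    proof -
      have "Complex (p 0) (p 1) = of_real (2 / (n + m)) * c"
        unfolding p(1,2) by (simp add: complex_eq_iff)
      then show ?thesis by (simp only: g_def c_def mult.assoc)
    qed
    ultimately have "coord p = (g * \<alpha>, g * \<beta>)" by (simp only: coord_def if_True not_False_eq_True)
    then show ?thesis using g0 by blast
  next
    case True
    then have b0: "\<beta> \<noteq> 0" using ab by simp
    have "n = 0" using True by (simp add: n_def)
    then have "p 2 = - 1" using 1(1) by simp
    moreover have "p 0 = 0" "p 1 = 0" using True p by (simp_all add: c_def)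
    ultimately have "coord p = (0, 2)" by (simp add: coord_def complex_eq_iff)
    then show ?thesis
      using b0 True by (intro exI[of _ "2 / \<beta>"]) simp
  qed
qed

section \<open>Quiver Grassmannians of a direct sum\<close>

context short_uniserial_pair
begin

lemma cnt_pos: "card {u. u < t \<and> M.pos u = v} = cnt r i t v" "card {u. u < t \<and> N.pos u = v} = cnt r j t v"
  unfolding cnt_def by (rule refl)+

lemma cell_count:
  assumes "cell_ok a c s"
  shows "cnt r i (a + s) v + cnt r j c v = cnt r i a v + cnt r j (c + s) v"
proof (cases "s = 0")
  case False
  then have "cnt r (i + int a) s v = cnt r (j + int c) s v"
    using assms by (intro cnt_wrap_cong) (simp add: cell_ok_def)
  then show ?thesis by (simp add: cnt_add)
qed simp

lemma card_cell_index: "card (cell_index a c s v) = cnt r i (a + s) v + cnt r j c v"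
  unfolding cell_index_def cnt_def by (rule card_Plus) simp_all

lemma cell_basis_continuous:
  assumes "continuous_on S f" "continuous_on S g"
  shows "continuous_on S (\<lambda>p. cell_basis a c (f p) (g p) q x)"
proof (cases q)
  case (Inl u)
  have cont: "continuous_on S (\<lambda>p. f p * dvec (Inl u) x + g p * dvec (Inr (c + (u - a))) x)"
    using assms by (intro continuous_intros)
  show ?thesis
  proof (cases "u < a")
    case True
    then show ?thesis by (simp add: Inl cell_basis_def)
  next
    case False
    then show ?thesis
      unfolding Inl cell_basis_def sum.case if_not_P[OF False] plus_fun_apply cscale_def by (intro cont)
  qed
next
  case (Inr u)
  show ?thesis unfolding Inr cell_basis_def sum.case by (rule continuous_on_const)
qed

lemma cell_family_continuous:
  assumes ok: "cell_ok a c s" and v: "v \<in> {1..r}" and f: "continuous_on S f" and g: "continuous_on S g"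
    and nz: "\<And>p. p \<in> S \<Longrightarrow> f p \<noteq> 0 \<or> g p \<noteq> 0"
    and n: "cnt r i (a + s) v + cnt r j c v = n"
  shows "continuous_map (top_of_set S) (grass n (Sp DS v)) (\<lambda>p. cell a c s (f p) (g p) v)"
proof -
  have "continuous_map (top_of_set S) (grass n (Sp DS v))
      (\<lambda>p. cvec.span (cell_basis a c (f p) (g p) ` cell_index a c s v))"
  proof (rule continuous_map_into_grass[OF finite_cell_index _ D.Sp_subspace[OF v]])
    show "card (cell_index a c s v) = n" using n by (simp add: card_cell_index)
    show "cell_basis a c (f p) (g p) q \<in> Sp DS v" if "q \<in> cell_index a c s v" for p q
      by (rule cell_basis_in[OF ok v that])
    show "cvec.indep_family (cell_index a c s v) (cell_basis a c (f p) (g p))" if "p \<in> topspace (top_of_set S)" for p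
      using that by (intro cell_indep[OF ok v] nz) simp
    show "continuous_map (top_of_set S) euclidean (\<lambda>p. cell_basis a c (f p) (g p) q x)" for q x
      unfolding continuous_map_iff_continuous by (rule cell_basis_continuous[OF f g])
  qed
  then show ?thesis
    by (rule continuous_map_eq) (use nz cell_span[OF ok v] in simp)
qed

text \<open>The map from the sphere to the Grassmannian sends a point to the cell with this slope. It
  is continuous because in each chart the cell has a continuous basis. Its inverse is continuous
  in the quotient topology because the slope can be recovered from any frame at the vertex where
  the diagonal starts: summing over the frame, \<open>hopf\<close> of the sums of \<open>cnj X * Y\<close>, \<open>\<bar>X\<bar>\<^sup>2\<close> and
  \<open>\<bar>Y\<bar>\<^sup>2\<close> is the point of the sphere, where \<open>X\<close> and \<open>Y\<close> are the two coefficients at the first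
  diagonal basis vector. As frames map openly to subspaces, the map from the sphere is open.\<close>

lemma cells_homeomorphic_sphere:
  assumes ok: "cell_ok a c s" and s: "s > 0"
    and e: "\<And>v. v \<in> {1..r} \<Longrightarrow> cnt r i (a + s) v + cnt r j c v = e v"
    and top: "topspace (quiver_grass r e DS) = {cell a c s \<alpha> \<beta> | \<alpha> \<beta>. \<alpha> \<noteq> 0 \<or> \<beta> \<noteq> 0}"
  shows "nsphere 2 homeomorphic_space quiver_grass r e DS"
proof -
  let ?X = "quiver_grass r e DS"
  define F where "F p = cell a c s (fst (coord p)) (snd (coord p))" for p
  have F_top: "F p \<in> topspace ?X" for p
    unfolding top F_def using coord_nonzero[of p] by blast
  have cont_coord: "continuous_on A (\<lambda>p :: nat \<Rightarrow> real. p i)" for A i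
    by (rule continuous_on_subset[OF continuous_on_product_coordinates subset_UNIV])
  define f1 g1 f2 g2 where "f1 p = complex_of_real (1 + p 2)" and "g1 p = Complex (p 0) (p 1)"
    and "f2 p = Complex (p 0) (- p 1)" and "g2 p = complex_of_real (1 - p 2)" for p :: "nat \<Rightarrow> real"
  have cont: "continuous_on A f1" "continuous_on A g1" "continuous_on A f2" "continuous_on A g2" for A
    unfolding f1_def g1_def f2_def g2_def Complex_eq by (intro continuous_intros cont_coord)+
  have nz1: "f1 p \<noteq> 0 \<or> g1 p \<noteq> 0" if "p 2 \<noteq> - 1" for p
    using coord_nonzero[of p] that by (simp add: coord_def f1_def g1_def)
  have nz2: "f2 p \<noteq> 0 \<or> g2 p \<noteq> 0" if "p 2 \<noteq> 1" for p
  proof -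
    have "1 - p 2 \<noteq> 0" using that by simp
    then show ?thesis unfolding g2_def of_real_eq_0_iff by blast
  qed
  have F1: "F p = cell a c s (f1 p) (g1 p)" if "p 2 \<noteq> - 1" for p
    using that by (simp add: F_def coord_def f1_def g1_def)
  have F2: "F p = cell a c s (f2 p) (g2 p)" if p: "p \<in> sphere2" "p 2 \<noteq> 1" for p
  proof -
    obtain \<gamma> where "\<gamma> \<noteq> 0" "fst (coord p) = \<gamma> * f2 p" "snd (coord p) = \<gamma> * g2 p"
      unfolding f2_def g2_def by (rule coord_other_chart[OF p])
    then show ?thesis by (simp add: F_def cell_scale)
  qed
  have open1: "openin (top_of_set sphere2) {p \<in> sphere2. p 2 \<noteq> t}" for t
    using openin_continuous_map_preimage[of "top_of_set sphere2" euclidean "\<lambda>p. p 2" "- {t}"] cont_coord[of sphere2 2]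
    by (simp add: open_Compl)
  have contF: "continuous_map (top_of_set sphere2) ?X F"
    unfolding quiver_grass_def
  proof (subst continuous_map_in_subtopology, intro conjI)
    show "F \<in> topspace (top_of_set sphere2) \<rightarrow> {U. submodule r DS U}"
      using F_top topspace_quiver_grass[of r DS e] D.Sp_subspace by auto
    show "continuous_map (top_of_set sphere2) (product_topology (\<lambda>v. grass (e v) (Sp DS v)) {1..r}) F"
      unfolding continuous_map_componentwise
    proof (intro conjI ballI)
      show "F ` topspace (top_of_set sphere2) \<subseteq> extensional {1..r}"
        unfolding F_def cell_def by auto
      fix v assume v: "v \<in> {1..r}"
      show "continuous_map (top_of_set sphere2) (grass (e v) (Sp DS v)) (\<lambda>p. F p v)"
      proof (rule pasting_lemma[where I = "{- 1, 1}" and T = "\<lambda>t. {p \<in> sphere2. p 2 \<noteq> t}" and f = "\<lambda>_ p. F p v"])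
        fix t :: real assume t: "t \<in> {- 1, 1}"
        show "openin (top_of_set sphere2) {p \<in> sphere2. p 2 \<noteq> t}" by (rule open1)
        have sub: "subtopology (top_of_set sphere2) {p \<in> sphere2. p 2 \<noteq> t} = top_of_set {p \<in> sphere2. p 2 \<noteq> t}"
          unfolding subtopology_subtopology by (rule arg_cong[where f = top_of_set]) auto
        show "continuous_map (subtopology (top_of_set sphere2) {p \<in> sphere2. p 2 \<noteq> t}) (grass (e v) (Sp DS v)) (\<lambda>p. F p v)"
        proof (cases "t = - 1")
          case True
          have "continuous_map (top_of_set {p \<in> sphere2. p 2 \<noteq> t}) (grass (e v) (Sp DS v)) (\<lambda>p. cell a c s (f1 p) (g1 p) v)"
            by (rule cell_family_continuous[OF ok v cont(1,2) _ e[OF v]]) (use nz1 True in auto)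
          then show ?thesis
            unfolding sub by (rule continuous_map_eq) (use F1 True in auto)
        next
          case False
          then have t1: "t = 1" using t by simp
          have "continuous_map (top_of_set {p \<in> sphere2. p 2 \<noteq> t}) (grass (e v) (Sp DS v)) (\<lambda>p. cell a c s (f2 p) (g2 p) v)"
            by (rule cell_family_continuous[OF ok v cont(3,4) _ e[OF v]]) (use nz2 t1 in auto)
          then show ?thesis
            unfolding sub by (rule continuous_map_eq) (use F2 t1 in auto)
        qed
      next
        fix p assume "p \<in> topspace (top_of_set sphere2)"
        then show "\<exists>t. t \<in> {- 1, 1} \<and> p \<in> {p \<in> sphere2. p 2 \<noteq> t} \<and> F p v = F p v"
          by (intro exI[of _ "if p 2 = 1 then - 1 else 1"]) (simp split: if_split)
      qed simp
    qed
  qed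
  have surj: "F ` topspace (top_of_set sphere2) = topspace ?X"
  proof (intro equalityI subsetI)
    fix U assume "U \<in> topspace ?X"
    then obtain \<alpha> \<beta> where U: "U = cell a c s \<alpha> \<beta>" "\<alpha> \<noteq> 0 \<or> \<beta> \<noteq> 0" unfolding top by blast
    let ?p = "hopf (cnj \<alpha> * \<beta>) ((cmod \<alpha>)\<^sup>2) ((cmod \<beta>)\<^sup>2)"
    obtain \<gamma> where "\<gamma> \<noteq> 0" "coord ?p = (\<gamma> * \<alpha>, \<gamma> * \<beta>)" using coord_hopf(2)[OF U(2)] by blast
    then have "F ?p = U" unfolding F_def U(1) by (simp add: cell_scale)
    then show "U \<in> F ` topspace (top_of_set sphere2)"
      using coord_hopf(1)[OF U(2)] by force
  qed (use F_top in auto)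
  \<comment> \<open>Every frame of the space at the vertex \<open>v0\<close> determines the slope, by a formula that is
    continuous in the frame.\<close>
  define v0 where "v0 = M.pos a"
  have v0: "v0 \<in> {1..r}" unfolding v0_def by (rule wrap_in[OF M.r_pos])
  have ac: "a < k" "c < l" "N.pos c = v0" using ok s by (auto simp: cell_ok_def v0_def)
  define n where "n = e v0"
  define X Y where "X z = dco (Inl a) z" and "Y z = dco (Inr c) z" for z :: "('b + 'c) cvec"
  have XY: "linear_functional X" "linear_functional Y"
  proof -
    have "Inl a \<in> {..<k} <+> {..<l}" "Inr c \<in> {..<k} <+> {..<l}" using ac by auto
    then show "linear_functional X" "linear_functional Y"
      unfolding X_def Y_def using D.co by blast+
  qed
  define cc nn mm where "cc B = (\<Sum>t<n. cnj (X (B t)) * Y (B t))" and "nn B = (\<Sum>t<n. (cmod (X (B t)))\<^sup>2)"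
    and "mm B = (\<Sum>t<n. (cmod (Y (B t)))\<^sup>2)" for B :: "nat \<Rightarrow> ('b + 'c) cvec"
  have slope: "nn B + mm B \<noteq> 0 \<and> hopf (cc B) (nn B) (mm B) = p"
    if p: "p \<in> sphere2" and B: "B \<in> frames n (Sp DS v0)" "cvec.span (B ` {..<n}) = F p v0" for p B
  proof -
    obtain \<alpha> \<beta> where ab: "coord p = (\<alpha>, \<beta>)" by (cases "coord p")
    have nz: "\<alpha> \<noteq> 0 \<or> \<beta> \<noteq> 0" using coord_nonzero[of p] ab by simp
    have Fv: "F p v0 = cell a c s \<alpha> \<beta> v0" by (simp add: F_def ab)
    have "\<exists>\<gamma>. X (B t) = \<gamma> * \<alpha> \<and> Y (B t) = \<gamma> * \<beta>" if t: "t < n" for t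
    proof -
      have "B t \<in> cell a c s \<alpha> \<beta> v0"
        unfolding Fv[symmetric] B(2)[symmetric] using t by (intro cvec.span_base) simp
      then have "\<forall>u<s. M.pos (a + u) = v0 \<longrightarrow> \<beta> * dco (Inl (a + u)) (B t) = \<alpha> * dco (Inr (c + u)) (B t)"
        unfolding mem_cell[OF v0] by (elim conjE)
      from this[rule_format, of 0] have "\<beta> * X (B t) = \<alpha> * Y (B t)"
        using s unfolding X_def Y_def v0_def by simp
      then show ?thesis
        using nz by (cases "\<alpha> = 0") (auto intro!: exI[of _ "if \<alpha> = 0 then Y (B t) / \<beta> else X (B t) / \<alpha>"] simp: field_simps)
    qed
    then obtain \<gamma> where \<gamma>: "\<And>t. t < n \<Longrightarrow> X (B t) = \<gamma> t * \<alpha>" "\<And>t. t < n \<Longrightarrow> Y (B t) = \<gamma> t * \<beta>" by metis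
    define T where "T = (\<Sum>t<n. (cmod (\<gamma> t))\<^sup>2)"
    have cB: "cc B = of_real T * (cnj \<alpha> * \<beta>)"
    proof -
      have "cnj (X (B t)) * Y (B t) = of_real ((cmod (\<gamma> t))\<^sup>2) * (cnj \<alpha> * \<beta>)" if "t < n" for t
        unfolding \<gamma>[OF that] complex_norm_square by (simp add: ac_simps)
      then show ?thesis unfolding cc_def T_def of_real_sum sum_distrib_right by (intro sum.cong) auto
    qed
    have nB: "nn B = T * (cmod \<alpha>)\<^sup>2" "mm B = T * (cmod \<beta>)\<^sup>2"
      unfolding nn_def mm_def T_def sum_distrib_right
      by (intro sum.cong; simp add: \<gamma> norm_mult power_mult_distrib)+
    have T0: "T \<noteq> 0"
    proof
      assume "T = 0"
      then have "\<gamma> t = 0" if "t < n" for t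
        using that unfolding T_def by (subst (asm) sum_nonneg_eq_0_iff) auto
      then have XB: "X (B t) = 0" "Y (B t) = 0" if "t < n" for t using that \<gamma> by simp_all
      have zero: "X z = 0 \<and> Y z = 0" if z: "z \<in> F p v0" for z
      proof -
        obtain d where d: "z = (\<Sum>t<n. cscale (d t) (B t))"
          using z unfolding B(2)[symmetric] cvec.span_family[OF finite_lessThan] by blast
        have "X z = (\<Sum>t<n. d t * X (B t))" "Y z = (\<Sum>t<n. d t * Y (B t))"
          unfolding d linear_functional_sum[OF XY(1)] linear_functional_sum[OF XY(2)]
          using XY unfolding linear_functional_def by simp_all
        then show ?thesis using XB by simp
      qed
      have q: "Inl a \<in> cell_index a c s v0"
        using s by (auto simp: cell_index_def v0_def)
      define z where "z = cell_basis a c \<alpha> \<beta> (Inl a)"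
      have zF: "z \<in> F p v0"
        unfolding Fv cell_span[OF ok v0 nz] z_def using q by (intro cvec.span_base) simp
      have zsum: "z = (\<Sum>q\<in>cell_index a c s v0. cscale (if q = Inl a then 1 else 0) (cell_basis a c \<alpha> \<beta> q))"
      proof -
        have "(\<Sum>q\<in>cell_index a c s v0. cscale (if q = Inl a then 1 else 0) (cell_basis a c \<alpha> \<beta> q)) =
            (\<Sum>q\<in>cell_index a c s v0. if q = Inl a then cell_basis a c \<alpha> \<beta> q else 0)"
          by (intro sum.cong) auto
        also have "\<dots> = z" unfolding z_def using q finite_cell_index by (simp add: sum.delta)
        finally show ?thesis by simp
      qed
      have "X z = \<alpha>" "Y z = \<beta>"
        using dco_cell_sum(1)[OF ok v0 zsum ac(1)] dco_cell_sum(2)[OF ok v0 zsum ac(2,3)] s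
        unfolding X_def Y_def by (simp_all add: v0_def del: dsimps)
      then show False using zero[OF zF] nz by simp
    qed
    have "(cmod \<alpha>)\<^sup>2 + (cmod \<beta>)\<^sup>2 \<noteq> 0" using nz by (simp add: add_nonneg_eq_0_iff)
    then have "nn B + mm B \<noteq> 0" unfolding nB using T0 by (simp flip: distrib_left)
    moreover have "hopf (cc B) (nn B) (mm B) = p"
      unfolding cB nB hopf_scale[OF T0] by (rule hopf_coord[OF p ab])
    ultimately show ?thesis ..
  qed
  have frame: "\<exists>B. B \<in> frames n (Sp DS v0) \<and> cvec.span (B ` {..<n}) = F p v0" for p
  proof -
    have "F p \<in> topspace ?X" by (rule F_top)
    then have sm: "submodule r DS (F p)" and dm: "cvec.dim (F p v0) = n"
      using topspace_quiver_grass[of r DS e] D.Sp_subspace v0 by (auto simp: n_def)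
    have fin: "finite (dvec ` {q \<in> {..<k} <+> {..<l}. dpos q = v0})" by simp
    obtain B where "B \<in> frames n (Sp DS v0)" "cvec.span (B ` {..<n}) = F p v0"
      by (rule ex_frame[OF submoduleD(1,2)[OF sm v0] dm eq_refl[OF D.Sp_span[OF v0]] fin])
    then show ?thesis by blast
  qed
  have inj: "inj_on F (topspace (top_of_set sphere2))"
  proof (rule inj_onI)
    fix p q assume "p \<in> topspace (top_of_set sphere2)" "q \<in> topspace (top_of_set sphere2)" and eq: "F p = F q"
    then have pq: "p \<in> sphere2" "q \<in> sphere2" by simp_all
    obtain B where "B \<in> frames n (Sp DS v0)" "cvec.span (B ` {..<n}) = F p v0" using frame by blast
    then have "hopf (cc B) (nn B) (mm B) = p" "hopf (cc B) (nn B) (mm B) = q"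
      using slope[OF pq(1), of B] slope[OF pq(2), of B] unfolding eq by blast+
    then show "p = q" by (simp only:)
  qed
  have "open_map (top_of_set sphere2) ?X F"
    unfolding open_map_def
  proof (intro allI impI)
    fix O1 assume "openin (top_of_set sphere2) O1"
    then obtain O' where O': "open O'" "O1 = sphere2 \<inter> O'" unfolding openin_open by blast
    define S where "S = {B \<in> frames n (Sp DS v0). nn B + mm B \<noteq> 0}"
    define W where "W = {B \<in> S. hopf (cc B) (nn B) (mm B) \<in> O'}"
    have cXB: "continuous_on A (\<lambda>B. X (B t))" "continuous_on A (\<lambda>B. Y (B t))" for A and t :: nat
    proof -
      have Bt: "continuous_on A (\<lambda>B :: nat \<Rightarrow> ('b + 'c) cvec. B t)"
        by (rule continuous_on_product_then_coordinatewise) auto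
      have "continuous_on UNIV X" "continuous_on UNIV Y"
        using XY unfolding linear_functional_def by blast+
      then show "continuous_on A (\<lambda>B. X (B t))" "continuous_on A (\<lambda>B. Y (B t))"
        by (auto intro: continuous_on_compose2[OF _ Bt subset_UNIV])
    qed
    have contc: "continuous_on A cc" "continuous_on A nn" "continuous_on A mm" for A
      unfolding cc_def nn_def mm_def by (intro continuous_intros cXB)+
    have S_open: "openin (top_of_set (frames n (Sp DS v0))) S"
    proof -
      have "continuous_map (top_of_set (frames n (Sp DS v0))) euclidean (\<lambda>B. nn B + mm B)"
        unfolding continuous_map_iff_continuous by (intro continuous_intros contc)
      from openin_continuous_map_preimage[OF this, of "- {0}"] show ?thesis
        by (simp add: S_def open_Compl)
    qed
    have "continuous_on S (\<lambda>B. hopf (cc B) (nn B) (mm B))"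
    proof (rule continuous_on_coordinatewise_then_product)
      fix i
      show "continuous_on S (\<lambda>B. hopf (cc B) (nn B) (mm B) i)"
        unfolding hopf_def
        by (cases "i = 0"; cases "i = 1"; cases "i = 2")
           (auto intro!: continuous_intros contc simp: S_def)
    qed
    from continuous_openin_preimage_gen[OF this O'(1)] have "openin (top_of_set S) W"
      by (simp add: W_def Int_def vimage_def)
    then have W_open: "openin (top_of_set (frames n (Sp DS v0))) W"
      using S_open openin_trans by blast
    let ?G = "(\<lambda>B. cvec.span (B ` {..<n})) ` W"
    have G: "openin (grass n (Sp DS v0)) ?G"
      by (rule openin_grass_spans[OF D.Sp_subspace[OF v0] W_open])
    have proj: "continuous_map ?X (grass n (Sp DS v0)) (\<lambda>U. U v0)"
      unfolding quiver_grass_def n_def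
      by (rule continuous_map_from_subtopology, rule continuous_map_product_projection[OF v0])
    have "F ` O1 = {U \<in> topspace ?X. U v0 \<in> ?G}"
    proof (intro equalityI subsetI)
      fix U assume "U \<in> F ` O1"
      then obtain p where p: "p \<in> sphere2" "p \<in> O'" "U = F p" using O' by auto
      obtain B where B: "B \<in> frames n (Sp DS v0)" "cvec.span (B ` {..<n}) = F p v0" using frame by blast
      then have "B \<in> W" using slope[OF p(1) B] p(2) by (simp add: W_def S_def)
      then have "U v0 \<in> ?G" unfolding p(3) B(2)[symmetric] by (rule imageI)
      then show "U \<in> {U \<in> topspace ?X. U v0 \<in> ?G}" using p(3) F_top by simp
    next
      fix U assume U: "U \<in> {U \<in> topspace ?X. U v0 \<in> ?G}"
      then have "U \<in> F ` topspace (top_of_set sphere2)" unfolding surj by blast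
      then obtain p where p: "p \<in> sphere2" "U = F p" by auto
      obtain B where B: "B \<in> W" "U v0 = cvec.span (B ` {..<n})" using U by blast
      have "hopf (cc B) (nn B) (mm B) = p" using slope[OF p(1), of B] B p(2) by (simp add: W_def S_def)
      then have "p \<in> O1" using B(1) p(1) by (simp add: W_def O')
      then show "U \<in> F ` O1" using p(2) by simp
    qed
    then show "openin ?X (F ` O1)"
      using openin_continuous_map_preimage[OF proj G] by simp
  qed
  then have "homeomorphic_map (top_of_set sphere2) ?X F"
    by (rule bijective_open_imp_homeomorphic_map[OF contF _ surj inj])
  then show ?thesis
    unfolding nsphere_sphere2 by (rule homeomorphic_map_imp_homeomorphic_space)
qed

text \<open>Pairs of submodules of the two summands, given by their lengths, with dimension vectors of
  sum \<open>e\<close>.\<close>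

definition pairs :: "(int \<Rightarrow> nat) \<Rightarrow> (nat \<times> nat) set"
  where "pairs e = {(a, c). a \<le> k \<and> c \<le> l \<and> (\<forall>v\<in>{1..r}. cnt r i a v + cnt r j c v = e v)}"

lemma pairs_sum:
  assumes "(a, c) \<in> pairs e"
  shows "a + c = (\<Sum>v\<in>{1..r}. e v)"
proof -
  have "(\<Sum>v\<in>{1..r}. e v) = (\<Sum>v\<in>{1..r}. cnt r i a v + cnt r j c v)"
    using assms by (intro sum.cong) (auto simp: pairs_def)
  then show ?thesis
    using sum_cnt[OF M.r_pos, of i a] sum_cnt[OF M.r_pos, of j c] by (simp add: sum.distrib)
qed

text \<open>The difference of two pairs is an interval of the cycle that is a subquotient of both
  summands, and intervals with fewer than \<open>r\<close> elements are determined by their dimension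
  vectors.\<close>

lemma pairs_less:
  assumes 1: "(a, c) \<in> pairs e" and 2: "(a', c') \<in> pairs e" and less: "a < a'"
  shows "c = c' + (a' - a)" "M.pos a = N.pos c'"
proof -
  show c: "c = c' + (a' - a)"
    using pairs_sum[OF 1] pairs_sum[OF 2] less by linarith
  have le: "a' \<le> k" using 2 by (simp add: pairs_def)
  have "cnt r (i + int a) (a' - a) v = cnt r (j + int c') (a' - a) v" if v: "v \<in> {1..r}" for v
  proof -
    have "cnt r i a v + cnt r j c v = cnt r i a' v + cnt r j c' v"
      using 1 2 v unfolding pairs_def by auto
    moreover have "cnt r i a' v = cnt r i a v + cnt r (i + int a) (a' - a) v"
      using cnt_add[of r i a "a' - a" v] less by simp
    moreover have "cnt r j c v = cnt r j c' v + cnt r (j + int c') (a' - a) v"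
      unfolding c by (rule cnt_add)
    ultimately show ?thesis by linarith
  qed
  then show "M.pos a = N.pos c'"
    using less le k_less by (intro cnt_start_unique[OF M.r_pos, of "a' - a"]) auto
qed

text \<open>With three pairs, two different submodules of the first summand would have the same vertex
  above them, which is impossible for a length below \<open>r\<close>.\<close>

lemma pairs_no_three:
  assumes "(a1, c1) \<in> pairs e" "(a2, c2) \<in> pairs e" "(a3, c3) \<in> pairs e" "a1 < a2" "a2 < a3"
  shows False
proof -
  have "M.pos a1 = M.pos a2"
    using pairs_less(2)[OF assms(1,3)] pairs_less(2)[OF assms(2,3,5)] assms(4,5) by simp
  moreover have "a3 \<le> k" using assms(3) by (simp add: pairs_def)
  then have "\<bar>(i + int a1) - (i + int a2)\<bar> < r" using assms(4,5) k_less by linarith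
  ultimately have "i + int a1 = i + int a2" by (rule wrap_inj)
  then show False using assms(4) by simp
qed

lemma cell_split:
  "cell a c 0 \<alpha> \<beta> = cell a c 0 \<alpha>' \<beta>'"
  unfolding cell_def by (intro restrict_ext) simp

text \<open>The two coordinate points of the projective line give the submodules that are direct sums
  of submodules of the summands.\<close>

lemma cell_end_points:
  assumes ok: "cell_ok a c s"
  shows "cell a c s 0 1 = cell a (c + s) 0 \<alpha> \<beta>" "cell a c s 1 0 = cell (a + s) c 0 \<alpha> \<beta>"
proof -
  have ok': "a + s \<le> k" "c + s \<le> l" using ok by (auto simp: cell_ok_def)
  have 1: "z \<in> cell a c s 0 1 v \<longleftrightarrow> z \<in> cell a (c + s) 0 \<alpha> \<beta> v" if v: "v \<in> {1..r}" for v z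
  proof -
    have "(\<forall>u. a \<le> u \<and> u < k \<and> M.pos u = v \<longrightarrow> dco (Inl u) z = 0) \<longleftrightarrow>
        (\<forall>u. a + s \<le> u \<and> u < k \<and> M.pos u = v \<longrightarrow> dco (Inl u) z = 0) \<and>
        (\<forall>u<s. M.pos (a + u) = v \<longrightarrow> dco (Inl (a + u)) z = 0)"
      (is "?L \<longleftrightarrow> ?A \<and> ?B")
    proof
      assume ?L
      then have "dco (Inl (a + u)) z = 0" if "u < s" "M.pos (a + u) = v" for u
        using that ok' by (simp del: dsimps)
      then show "?A \<and> ?B" using \<open>?L\<close> by auto
    next
      assume AB: "?A \<and> ?B"
      show ?L
      proof (intro allI impI)
        fix u assume u: "a \<le> u \<and> u < k \<and> M.pos u = v"
        show "dco (Inl u) z = 0"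
        proof (cases "a + s \<le> u")
          case True
          then show ?thesis using AB u by blast
        next
          case False
          then have "u - a < s" "a + (u - a) = u" using u by auto
          then show ?thesis using conjunct2[OF AB, rule_format, of "u - a"] u by simp
        qed
      qed
    qed
    then show ?thesis unfolding mem_cell[OF v] by (auto simp del: dsimps)
  qed
  have 2: "z \<in> cell a c s 1 0 v \<longleftrightarrow> z \<in> cell (a + s) c 0 \<alpha> \<beta> v" if v: "v \<in> {1..r}" for v z
  proof -
    have "(\<forall>u. c \<le> u \<and> u < l \<and> N.pos u = v \<longrightarrow> dco (Inr u) z = 0) \<longleftrightarrow>
        (\<forall>u. c + s \<le> u \<and> u < l \<and> N.pos u = v \<longrightarrow> dco (Inr u) z = 0) \<and>
        (\<forall>u<s. M.pos (a + u) = v \<longrightarrow> dco (Inr (c + u)) z = 0)"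
      (is "?L \<longleftrightarrow> ?A \<and> ?B")
    proof
      assume ?L
      then have "dco (Inr (c + u)) z = 0" if "u < s" "M.pos (a + u) = v" for u
        using that ok' cell_okD[OF ok that(1)] by (simp del: dsimps)
      then show "?A \<and> ?B" using \<open>?L\<close> by auto
    next
      assume AB: "?A \<and> ?B"
      show ?L
      proof (intro allI impI)
        fix u assume u: "c \<le> u \<and> u < l \<and> N.pos u = v"
        show "dco (Inr u) z = 0"
        proof (cases "c + s \<le> u")
          case True
          then show ?thesis using AB u by blast
        next
          case False
          then have "u - c < s" "c + (u - c) = u" using u by auto
          then show ?thesis
            using conjunct2[OF AB, rule_format, of "u - c"] cell_okD[OF ok, of "u - c"] u by simp
        qed
      qed
    qed
    then show ?thesis unfolding mem_cell[OF v] by (auto simp del: dsimps)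
  qed
  show "cell a c s 0 1 = cell a (c + s) 0 \<alpha> \<beta>"
  proof
    fix v
    show "cell a c s 0 1 v = cell a (c + s) 0 \<alpha> \<beta> v"
    proof (cases "v \<in> {1..r}")
      case True
      show ?thesis by (intro equalityI subsetI) (simp_all only: 1[OF True])
    next
      case False
      show ?thesis by (simp only: cell_undefined[OF False])
    qed
  qed
  show "cell a c s 1 0 = cell (a + s) c 0 \<alpha> \<beta>"
  proof
    fix v
    show "cell a c s 1 0 v = cell (a + s) c 0 \<alpha> \<beta> v"
    proof (cases "v \<in> {1..r}")
      case True
      show ?thesis by (intro equalityI subsetI) (simp_all only: 2[OF True])
    next
      case False
      show ?thesis by (simp only: cell_undefined[OF False])
    qed
  qed
qed

lemma topspace_dsum_grass:
  "topspace (quiver_grass r e DS) = {U. submodule r DS U \<and> (\<forall>v\<in>{1..r}. cvec.dim (U v) = e v)}"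
  by (rule topspace_quiver_grass) (rule D.Sp_subspace)

lemma cell_in_grass_iff:
  assumes ok: "cell_ok a c s" and nz: "\<alpha> \<noteq> 0 \<or> \<beta> \<noteq> 0"
  shows "cell a c s \<alpha> \<beta> \<in> topspace (quiver_grass r e DS) \<longleftrightarrow> (a + s, c) \<in> pairs e"
proof -
  have "a + s \<le> k" "c \<le> l" using ok by (auto simp: cell_ok_def)
  then show ?thesis
    unfolding topspace_dsum_grass pairs_def
    using submodule_cell[OF ok nz] dim_cell[OF ok _ nz] unfolding cnt_pos by simp
qed

lemma pairs_other_end: "cell_ok a c s \<Longrightarrow> (a + s, c) \<in> pairs e \<longleftrightarrow> (a, c + s) \<in> pairs e"
  unfolding pairs_def using cell_count[of a c s] by (auto simp: cell_ok_def)

lemma grass_cases: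
  assumes "U \<in> topspace (quiver_grass r e DS)"
  obtains a c s \<gamma> where "cell_ok a c s" "U = cell a c s 1 \<gamma>" "(a + s, c) \<in> pairs e" "(a, c + s) \<in> pairs e"
proof -
  have "submodule r DS U" using assms unfolding topspace_dsum_grass by blast
  then obtain a c s \<gamma> where U: "cell_ok a c s" "U = cell a c s 1 \<gamma>" using submodule_dsum_cases by blast
  then have "(a + s, c) \<in> pairs e" using assms cell_in_grass_iff[OF U(1), of 1 \<gamma>] by simp
  then show thesis using U pairs_other_end[OF U(1)] that by blast
qed

text \<open>By the classification of submodules every point of the Grassmannian lies on a cell whose
  end points are pairs. Without a pair it is empty, with one pair it is a single point, and two
  pairs span one cell with all its slopes, which is a sphere.\<close>

lemma euler_char_dsum: "euler_char (quiver_grass r e DS) = int (card (pairs e))"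
proof -
  consider "pairs e = {}" | a c where "pairs e = {(a, c)}"
    | a c a' c' where "(a, c) \<in> pairs e" "(a', c') \<in> pairs e" "a < a'"
  proof -
    {
      fix x y assume xy: "x \<in> pairs e" "y \<in> pairs e" "x \<noteq> y"
      obtain a c a' c' where "x = (a, c)" "y = (a', c')" by (cases x, cases y)
      then have "a \<noteq> a'" using xy pairs_sum[of a c e] pairs_sum[of a' c' e] by auto
      then have thesis
        using that(3)[of a c a' c'] that(3)[of a' c' a c] xy \<open>x = (a, c)\<close> \<open>y = (a', c')\<close>
        by (cases "a < a'") auto
    }
    then show thesis using that(1,2) by (metis is_singletonI' is_singleton_def surj_pair)
  qed
  then show ?thesis
  proof cases
    case 1
    then have "topspace (quiver_grass r e DS) = {}" using grass_cases by blast
    then show ?thesis using 1 by (simp add: euler_char_empty)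
  next
    case (2 a c)
    have ok: "cell_ok a c 0"
    proof -
      have "(a, c) \<in> pairs e" using 2 by simp
      then show ?thesis by (simp add: pairs_def cell_ok_def)
    qed
    have "topspace (quiver_grass r e DS) = {cell a c 0 1 0}"
    proof (intro equalityI subsetI)
      fix U assume UT: "U \<in> topspace (quiver_grass r e DS)"
      obtain a' c' s \<gamma> where "cell_ok a' c' s" and U: "U = cell a' c' s 1 \<gamma>" "(a' + s, c') \<in> pairs e" "(a', c' + s) \<in> pairs e"
        by (rule grass_cases[OF UT])
      then have "a' = a" "s = 0" "c' = c" using 2 by auto
      then show "U \<in> {cell a c 0 1 0}" using U(1) cell_split[of a c 1 \<gamma> 1 0] by simp
    qed (use cell_in_grass_iff[OF ok, of 1 0] 2 in simp)
    then show ?thesis using 2 by (simp add: euler_char_point)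
  next
    case (3 a c1 a' c)
    define s where "s = a' - a"
    have s: "s > 0" "a' = a + s" "c1 = c + s" "M.pos a = N.pos c"
      using pairs_less[OF 3] 3(3) by (auto simp: s_def)
    have in1: "(a, c + s) \<in> pairs e" and in2: "(a + s, c) \<in> pairs e" using 3 s by auto
    have ok: "cell_ok a c s" using in1 in2 s by (simp add: cell_ok_def pairs_def)
    have two: "(x, y) = (a, c + s) \<or> (x, y) = (a + s, c)" if xy: "(x, y) \<in> pairs e" for x y
    proof -
      have "x = a \<or> x = a + s"
      proof (rule ccontr)
        assume "\<not> (x = a \<or> x = a + s)"
        then consider "x < a" | "a < x" "x < a + s" | "a + s < x" by linarith
        then show False
          using pairs_no_three[OF xy in1 in2] pairs_no_three[OF in1 xy in2] pairs_no_three[OF in1 in2 xy] s(1)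
          by cases auto
      qed
      then show ?thesis
        using pairs_sum[OF xy] pairs_sum[OF in1] pairs_sum[OF in2] by auto
    qed
    then have pe: "pairs e = {(a, c + s), (a + s, c)}" using in1 in2 by auto
    have "topspace (quiver_grass r e DS) = {cell a c s \<alpha> \<beta> | \<alpha> \<beta>. \<alpha> \<noteq> 0 \<or> \<beta> \<noteq> 0}"
    proof (intro equalityI subsetI)
      fix U assume UT: "U \<in> topspace (quiver_grass r e DS)"
      obtain a0 c0 s0 \<gamma> where "cell_ok a0 c0 s0" and U: "U = cell a0 c0 s0 1 \<gamma>" "(a0 + s0, c0) \<in> pairs e" "(a0, c0 + s0) \<in> pairs e"
        by (rule grass_cases[OF UT])
      have "U = cell a c s 0 1 \<or> U = cell a c s 1 0 \<or> U = cell a c s 1 \<gamma>"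
      proof (cases "s0 = 0")
        case True
        then have "U = cell a (c + s) 0 1 \<gamma> \<or> U = cell (a + s) c 0 1 \<gamma>"
          using two[OF U(2)] U(1) by auto
        then show ?thesis
          unfolding cell_end_points(1)[OF ok, of 1 \<gamma>, symmetric] cell_end_points(2)[OF ok, of 1 \<gamma>, symmetric]
          by blast
      next
        case False
        then have "a0 = a" "s0 = s" "c0 = c" using two[OF U(2)] two[OF U(3)] s(1) by auto
        then show ?thesis using U(1) by simp
      qed
      then show "U \<in> {cell a c s \<alpha> \<beta> | \<alpha> \<beta>. \<alpha> \<noteq> 0 \<or> \<beta> \<noteq> 0}" by force
    next
      fix U assume "U \<in> {cell a c s \<alpha> \<beta> | \<alpha> \<beta>. \<alpha> \<noteq> 0 \<or> \<beta> \<noteq> 0}"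
      then show "U \<in> topspace (quiver_grass r e DS)" using cell_in_grass_iff[OF ok] in2 by blast
    qed
    moreover have "cnt r i (a + s) v + cnt r j c v = e v" if "v \<in> {1..r}" for v
      using in2 that by (simp add: pairs_def)
    ultimately have "nsphere 2 homeomorphic_space quiver_grass r e DS"
      by (intro cells_homeomorphic_sphere[OF ok s(1)])
    moreover have "card (pairs e) = 2" unfolding pe using s(1) by simp
    ultimately show ?thesis by (simp add: euler_char_sphere)
  qed
qed

end

lemma (in uniserial) euler_char_uniserial:
  "euler_char (quiver_grass r e M) = int (card {t. t \<le> n \<and> (\<forall>v\<in>{1..r}. cnt r i t v = e v)})"
proof -
  let ?T = "{t. t \<le> n \<and> (\<forall>v\<in>{1..r}. cnt r i t v = e v)}"
  have top: "topspace (quiver_grass r e M) = {U. submodule r M U \<and> (\<forall>v\<in>{1..r}. cvec.dim (U v) = e v)}"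
    by (rule topspace_quiver_grass) (rule Sp_subspace)
  have dim: "cvec.dim (Sub t v) = cnt r i t v" if "v \<in> {1..r}" "t \<le> n" for t v
    unfolding cnt_def by (rule dim_Sub[OF that])
  have "topspace (quiver_grass r e M) = Sub ` ?T"
  proof (intro equalityI subsetI)
    fix U assume "U \<in> topspace (quiver_grass r e M)"
    then have U: "submodule r M U" "\<forall>v\<in>{1..r}. cvec.dim (U v) = e v" unfolding top by blast+
    obtain t where "t \<le> n" "U = Sub t" using submodule_cases[OF U(1)] by blast
    then have "t \<in> ?T" using U(2) dim by simp
    then show "U \<in> Sub ` ?T" using \<open>U = Sub t\<close> by blast
  next
    fix U assume "U \<in> Sub ` ?T"
    then obtain t where "t \<le> n" "\<forall>v\<in>{1..r}. cnt r i t v = e v" "U = Sub t" by blast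
    then show "U \<in> topspace (quiver_grass r e M)"
      unfolding top using submodule_Sub dim by simp
  qed
  moreover have "t = (\<Sum>v\<in>{1..r}. e v)" if "t \<in> ?T" for t
    using sum_cnt[OF r_pos, of i t] that by (simp del: atLeastAtMost_iff)
  then have "?T = {} \<or> (\<exists>t. ?T = {t})" by blast
  ultimately show ?thesis
    by (auto simp: euler_char_empty euler_char_point simp del: atLeastAtMost_iff)
qed

section \<open>The Caldero-Chapoton map\<close>

lemma xpow_add: "xpow i (m + n) = xpow i m * xpow i n"
  by (simp add: xpow_def single_add mult_single)

lemma xpow_0 [simp]: "xpow i 0 = 1"
  by (simp add: xpow_def)

definition monom :: "int \<Rightarrow> (int \<Rightarrow> int) \<Rightarrow> laurent"
  where "monom r f = (\<Prod>v\<in>{1..r}. xpow v (f v))"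

lemma monom_add: "monom r (\<lambda>v. f v + g v) = monom r f * monom r g"
  by (simp add: monom_def xpow_add prod.distrib)

lemma monom_cong: "(\<And>v. v \<in> {1..r} \<Longrightarrow> f v = g v) \<Longrightarrow> monom r f = monom r g"
  unfolding monom_def by (intro prod.cong) auto

lemma monom_single:
  assumes "r \<ge> 1"
  shows "monom r (\<lambda>v. if wrap r u = v then s else 0) = xpow (wrap r u) s"
proof -
  have "monom r (\<lambda>v. if wrap r u = v then s else 0) = (\<Prod>v\<in>{1..r}. if wrap r u = v then xpow v s else 1)"
    unfolding monom_def by (intro prod.cong) auto
  then show ?thesis using wrap_in[OF assms, of u] by (simp del: atLeastAtMost_iff)
qed

text \<open>The exponent of \<open>x\<^sub>v\<close> in the character, for a submodule of dimension vector \<open>e\<close> in a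
  module of dimension vector \<open>d\<close>, as an expression that is additive in \<open>(e, d)\<close>.\<close>

definition exponent :: "int \<Rightarrow> (int \<Rightarrow> nat) \<Rightarrow> (int \<Rightarrow> nat) \<Rightarrow> int \<Rightarrow> int"
  where "exponent r e d v =
    int (e (wrap r (v + 1))) - int (e (wrap r (v - 1))) - int (d v) + int (d (wrap r (v - 1)))"

lemma dimv_simple_rep:
  assumes "i \<in> {1..r}"
  shows "dimv r (simple_rep r i) v = (if v = i then 1 else 0)"
proof -
  let ?e = "\<lambda>p :: nat. if p = 0 then 1 else (0::complex)"
  have "{x :: nat cvec. \<forall>b>0. x b = 0} = cvec.span {?e}"
  proof (intro equalityI subsetI)
    fix x :: "nat cvec" assume "x \<in> {x. \<forall>b>0. x b = 0}"
    then have "x = cscale (x 0) ?e" by (auto simp: cscale_def fun_eq_iff)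
    then show "x \<in> cvec.span {?e}" unfolding cvec.span_singleton by blast
  next
    fix x assume "x \<in> cvec.span {?e}"
    then show "x \<in> {x. \<forall>b>0. x b = 0}" unfolding cvec.span_singleton by (auto simp: cscale_def)
  qed
  moreover have "?e \<noteq> 0" by (auto simp: fun_eq_iff)
  then have "cvec.dim (cvec.span {?e}) = 1"
    by (subst cvec.dim_span_eq_card_independent) simp_all
  ultimately have "cvec.dim {x :: nat cvec. \<forall>b>0. x b = 0} = 1" by simp
  moreover have "cvec.dim {0 :: nat cvec} = 0"
    using cvec.dim_span[of "{} :: nat cvec set"] cvec.dim_eq_card_independent[OF cvec.independent_empty] by simp
  ultimately show ?thesis
    using assms wrap_id[OF assms] unfolding dimv_def simple_rep_def by simp
qed

lemma CC_exponent:
  assumes r: "r \<ge> 1" and e: "\<And>v. v \<notin> {1..r} \<Longrightarrow> e v = 0" and d: "\<And>v. v \<notin> {1..r} \<Longrightarrow> d v = 0"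
    and le: "\<And>v. e v \<le> d v" and i: "i \<in> {1..r}"
  shows "- euler_form r e (dimv r (simple_rep r i)) - euler_form r (dimv r (simple_rep r i)) (\<lambda>v. d v - e v)
    = exponent r e d i"
proof -
  have S0: "dimv r (simple_rep r i) v = 0" if "v \<notin> {1..r}" for v
    using that i unfolding dimv_simple_rep[OF i] by auto
  have pred: "wrap r (v - 1) = i \<longleftrightarrow> v = wrap r (i + 1)" if "v \<in> {1..r}" for v
  proof
    assume "wrap r (v - 1) = i"
    then have "wrap r (i + 1) = wrap r (wrap r (v - 1) + 1)" by simp
    then show "v = wrap r (i + 1)" using wrap_id[OF that] by (simp add: wrap_wrap_add)
  next
    assume "v = wrap r (i + 1)"
    then show "wrap r (v - 1) = i" using wrap_id[OF i] by (simp add: wrap_wrap_diff)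
  qed
  have w: "wrap r u \<in> {1..r}" for u by (rule wrap_in[OF r])
  have "euler_form r e (dimv r (simple_rep r i)) =
      (\<Sum>v\<in>{1..r}. int (e v) * int (dimv r (simple_rep r i) v)) -
      (\<Sum>v\<in>{1..r}. int (e v) * int (dimv r (simple_rep r i) (wrap r (v - 1))))"
    by (rule euler_form_eq[OF r e S0])
  also have "\<dots> =
      (\<Sum>v\<in>{1..r}. if v = i then int (e v) else 0) - (\<Sum>v\<in>{1..r}. if v = wrap r (i + 1) then int (e v) else 0)"
    unfolding dimv_simple_rep[OF i]
    by (intro arg_cong2[where f = "(-)"] sum.cong) (auto simp: pred simp del: atLeastAtMost_iff)
  also have "\<dots> = int (e i) - int (e (wrap r (i + 1)))"
    using i w by (simp del: atLeastAtMost_iff)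
  finally have 1: "euler_form r e (dimv r (simple_rep r i)) = int (e i) - int (e (wrap r (i + 1)))" .
  have de: "d v - e v = 0" if "v \<notin> {1..r}" for v using d[OF that] by simp
  have "euler_form r (dimv r (simple_rep r i)) (\<lambda>v. d v - e v) =
      (\<Sum>v\<in>{1..r}. int (dimv r (simple_rep r i) v) * int (d v - e v)) -
      (\<Sum>v\<in>{1..r}. int (dimv r (simple_rep r i) v) * int (d (wrap r (v - 1)) - e (wrap r (v - 1))))"
    by (rule euler_form_eq[OF r S0 de])
  also have "\<dots> =
      (\<Sum>v\<in>{1..r}. if v = i then int (d v - e v) else 0) -
      (\<Sum>v\<in>{1..r}. if v = i then int (d (wrap r (v - 1)) - e (wrap r (v - 1))) else 0)"
    unfolding dimv_simple_rep[OF i]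
    by (intro arg_cong2[where f = "(-)"] sum.cong) auto
  also have "\<dots> = int (d i - e i) - int (d (wrap r (i - 1)) - e (wrap r (i - 1)))"
    using i by (simp del: atLeastAtMost_iff)
  finally have 2: "euler_form r (dimv r (simple_rep r i)) (\<lambda>v. d v - e v) =
      int (d i - e i) - int (d (wrap r (i - 1)) - e (wrap r (i - 1)))" .
  show ?thesis
    unfolding 1 2 exponent_def of_nat_diff[OF le] by simp
qed

text \<open>If the Euler characteristics of the Grassmannians count the elements of a finite set by
  their dimension vectors, the character is a sum over this set.\<close>

lemma CC_eq_sum:
  assumes r: "r \<ge> 1" and X: "finite X"
    and le: "\<And>x v. x \<in> X \<Longrightarrow> \<delta> x v \<le> dimv r M v"
    and chi: "\<And>e. euler_char (quiver_grass r e M) = int (card {x \<in> X. \<forall>v\<in>{1..r}. \<delta> x v = e v})"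
  shows "CC r M = (\<Sum>x\<in>X. monom r (exponent r (\<delta> x) (dimv r M)))"
proof -
  let ?d = "dimv r M"
  have d0: "?d v = 0" if "v \<notin> {1..r}" for v using that unfolding dimv_def by (simp only: if_False)
  let ?E = "{e. \<forall>v. e v \<le> ?d v}"
  have e0: "e v = 0" if "e \<in> ?E" "v \<notin> {1..r}" for e v
  proof -
    have "e v \<le> ?d v" using that(1) by blast
    then show ?thesis using d0[OF that(2)] by simp
  qed
  have finE: "finite ?E"
  proof (rule finite_subset)
    show "?E \<subseteq> {f. \<forall>v. (v \<in> {1..r} \<longrightarrow> f v \<in> {..Max (?d ` {1..r})}) \<and> (v \<notin> {1..r} \<longrightarrow> f v = 0)}"
    proof (intro subsetI CollectI allI conjI impI)
      fix f v assume f: "f \<in> ?E"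
      show "f v \<in> {..Max (?d ` {1..r})}" if v: "v \<in> {1..r}"
      proof -
        have "?d v \<le> Max (?d ` {1..r})" using v by (intro Max_ge) auto
        then show ?thesis using f by (auto intro: order_trans)
      qed
      show "f v = 0" if "v \<notin> {1..r}" using e0[OF f that] .
    qed
    show "finite {f. \<forall>v. (v \<in> {1..r} \<longrightarrow> f v \<in> {..Max (?d ` {1..r})}) \<and> (v \<notin> {1..r} \<longrightarrow> f v = 0)}"
      by (rule finite_set_of_finite_funs) simp_all
  qed
  have "CC r M = (\<Sum>e\<in>?E. of_int (euler_char (quiver_grass r e M)) * monom r (exponent r e ?d))"
    unfolding CC_def monom_def
    by (intro sum.cong refl arg_cong2[where f = "(*)"] prod.cong arg_cong[where f = "xpow _"] CC_exponent[OF r])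
      (use d0 e0 in auto)
  also have "\<dots> = (\<Sum>e\<in>?E. \<Sum>x\<in>{x \<in> X. \<delta> x = e}. monom r (exponent r (\<delta> x) ?d))"
  proof (rule sum.cong)
    fix e assume e: "e \<in> ?E"
    have "{x \<in> X. \<forall>v\<in>{1..r}. \<delta> x v = e v} = {x \<in> X. \<delta> x = e}"
    proof (intro Collect_cong conj_cong refl iffI)
      fix x assume x: "x \<in> X" "\<forall>v\<in>{1..r}. \<delta> x v = e v"
      show "\<delta> x = e"
      proof
        fix v show "\<delta> x v = e v"
        proof (cases "v \<in> {1..r}")
          case False
          then show ?thesis using e0[OF e False] le[OF x(1), of v] d0[OF False] by simp
        qed (use x(2) in blast)
      qed
    qed simp
    then show "of_int (euler_char (quiver_grass r e M)) * monom r (exponent r e ?d) =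
        (\<Sum>x\<in>{x \<in> X. \<delta> x = e}. monom r (exponent r (\<delta> x) ?d))"
      by (simp add: chi)
  qed simp
  also have "\<dots> = (\<Sum>x\<in>X. monom r (exponent r (\<delta> x) ?d))"
    using X finE le by (intro sum.group) auto
  finally show ?thesis .
qed

lemma (in uniserial) dimv_uniserial: "dimv r M v = cnt r i n v"
  unfolding dimv_eq cnt_def by simp

lemma cnt_mono: "t \<le> n \<Longrightarrow> cnt r i t v \<le> cnt r i n v"
  unfolding cnt_def by (intro card_mono) auto

definition x_pow :: "int \<Rightarrow> int \<Rightarrow> int \<Rightarrow> laurent"
  where "x_pow r s u = xpow (wrap r u) s"

text \<open>The exponent is a combination of differences between neighbouring vertices, so only the
  two ends of each of the intervals \<open>[i, i + t)\<close> and \<open>[i, i + n)\<close> contribute.\<close>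

lemma exponent_cnt:
  assumes v: "v \<in> {1..r}"
  shows "exponent r (cnt r i t) (cnt r i n) v =
    (if wrap r (i - 1) = v then 1 else 0) + ((if wrap r (i + int n) = v then 1 else 0) +
    ((if wrap r (i + int t - 1) = v then - 1 else 0) + (if wrap r (i + int t) = v then - 1 else 0)))"
proof -
  define ind where "ind u = (if wrap r u = v then 1 else (0::int))" for u
  have down: "(if wrap r u = wrap r (v - 1) then 1 else 0) = ind (u + 1)" for u
  proof -
    have "wrap r u = wrap r (v - 1) \<longleftrightarrow> wrap r (u + 1) = v"
    proof
      assume "wrap r u = wrap r (v - 1)"
      then have "wrap r (wrap r u + 1) = wrap r (wrap r (v - 1) + 1)" by simp
      then show "wrap r (u + 1) = v" unfolding wrap_wrap_add using wrap_id[OF v] by simp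
    next
      assume "wrap r (u + 1) = v"
      then have "wrap r (v - 1) = wrap r (wrap r (u + 1) - 1)" by simp
      then show "wrap r u = wrap r (v - 1)" unfolding wrap_wrap_diff by simp
    qed
    then show ?thesis by (simp add: ind_def)
  qed
  have up: "(if wrap r u = wrap r (v + 1) then 1 else 0) = ind (u - 1)" for u
  proof -
    have "wrap r u = wrap r (v + 1) \<longleftrightarrow> wrap r (u - 1) = v"
    proof
      assume "wrap r u = wrap r (v + 1)"
      then have "wrap r (wrap r u - 1) = wrap r (wrap r (v + 1) - 1)" by simp
      then show "wrap r (u - 1) = v" unfolding wrap_wrap_diff using wrap_id[OF v] by simp
    next
      assume "wrap r (u - 1) = v"
      then have "wrap r (v + 1) = wrap r (wrap r (u - 1) + 1)" by simp
      then show "wrap r u = wrap r (v + 1)" unfolding wrap_wrap_add by simp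
    qed
    then show ?thesis by (simp add: ind_def)
  qed
  have A: "int (cnt r i t (wrap r (v + 1))) - int (cnt r i t (wrap r (v - 1))) =
      ind (i - 1) + ind i - ind (i + int t - 1) - ind (i + int t)" for t
  proof (induction t)
    case (Suc t)
    have "int (cnt r i (Suc t) (wrap r (v + 1))) - int (cnt r i (Suc t) (wrap r (v - 1))) =
        (int (cnt r i t (wrap r (v + 1))) - int (cnt r i t (wrap r (v - 1)))) + (ind (i + int t - 1) - ind (i + int t + 1))"
      unfolding cnt_Suc down[symmetric] up[symmetric] by simp
    then show ?case unfolding Suc.IH by (simp add: algebra_simps)
  qed simp
  have B: "int (cnt r i n (wrap r (v - 1))) - int (cnt r i n v) = ind (i + int n) - ind i" for n
  proof (induction n)
    case (Suc n)
    have "int (cnt r i (Suc n) (wrap r (v - 1))) - int (cnt r i (Suc n) v) =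
        (int (cnt r i n (wrap r (v - 1))) - int (cnt r i n v)) + (ind (i + int n + 1) - ind (i + int n))"
      unfolding cnt_Suc down[symmetric] by (simp add: ind_def)
    then show ?case unfolding Suc.IH by (simp add: algebra_simps)
  qed simp
  have "exponent r (cnt r i t) (cnt r i n) v =
      ind (i - 1) + ind (i + int n) - ind (i + int t - 1) - ind (i + int t)"
    unfolding exponent_def using A[of t] B[of n] by linarith
  then show ?thesis by (simp add: ind_def)
qed

lemma monom_cnt:
  assumes r: "r \<ge> 1"
  shows "monom r (exponent r (cnt r i t) (cnt r i n)) =
    x_pow r 1 (i - 1) * x_pow r 1 (i + int n) * (x_pow r (- 1) (i + int t - 1) * x_pow r (- 1) (i + int t))"
proof -
  have "monom r (exponent r (cnt r i t) (cnt r i n)) =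
    monom r (\<lambda>v. (if wrap r (i - 1) = v then 1 else 0) + ((if wrap r (i + int n) = v then 1 else 0) +
    ((if wrap r (i + int t - 1) = v then - 1 else 0) + (if wrap r (i + int t) = v then - 1 else 0))))"
    by (rule monom_cong) (rule exponent_cnt)
  then show ?thesis
    unfolding monom_add monom_single[OF r] x_pow_def by (simp only: mult.assoc)
qed

lemma (in uniserial) CC_uniserial:
  "CC r M = (\<Sum>t\<le>n. monom r (exponent r (cnt r i t) (cnt r i n)))"
proof -
  have "CC r M = (\<Sum>t\<in>{..n}. monom r (exponent r (cnt r i t) (dimv r M)))"
    by (rule CC_eq_sum[OF r_pos]) (auto simp: dimv_uniserial euler_char_uniserial cnt_mono simp del: atLeastAtMost_iff)
  moreover have "dimv r M = cnt r i n" by (rule ext) (rule dimv_uniserial)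
  ultimately show ?thesis by simp
qed

text \<open>Both sides are sums over the pairs of submodules of the summands, and the exponents are
  additive.\<close>

lemma (in short_uniserial_pair) CC_dsum: "CC r DS = CC r M * CC r N"
proof -
  have dimv: "dimv r DS = (\<lambda>v. cnt r i k v + cnt r j l v)"
  proof
    fix v
    show "dimv r DS v = cnt r i k v + cnt r j l v"
      unfolding D.dimv_eq dsum_fibre cnt_def by (subst card_Plus) simp_all
  qed
  let ?X = "{..k} \<times> {..l}"
  let ?\<delta> = "\<lambda>(a, c) v. cnt r i a v + cnt r j c v"
  have "CC r DS = (\<Sum>x\<in>?X. monom r (exponent r (?\<delta> x) (dimv r DS)))"
  proof (rule CC_eq_sum[OF M.r_pos])
    show "finite ?X" by simp
    show "?\<delta> x v \<le> dimv r DS v" if "x \<in> ?X" for x v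
      using that cnt_mono[of "fst x" k r i v] cnt_mono[of "snd x" l r j v] by (auto simp: dimv intro: add_mono)
    fix e
    have "{x \<in> ?X. \<forall>v\<in>{1..r}. ?\<delta> x v = e v} = pairs e"
      unfolding pairs_def by auto
    then show "euler_char (quiver_grass r e DS) = int (card {x \<in> ?X. \<forall>v\<in>{1..r}. ?\<delta> x v = e v})"
      by (simp only: euler_char_dsum)
  qed
  also have "\<dots> = (\<Sum>(a, c)\<in>?X. monom r (exponent r (cnt r i a) (cnt r i k)) * monom r (exponent r (cnt r j c) (cnt r j l)))"
  proof (rule sum.cong)
    fix x assume "x \<in> ?X"
    obtain a c where x: "x = (a, c)" by (cases x)
    have "exponent r (\<lambda>v. cnt r i a v + cnt r j c v) (\<lambda>v. cnt r i k v + cnt r j l v) =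
        (\<lambda>v. exponent r (cnt r i a) (cnt r i k) v + exponent r (cnt r j c) (cnt r j l) v)"
      by (auto simp: exponent_def)
    then show "monom r (exponent r (?\<delta> x) (dimv r DS)) =
        (case x of (a, c) \<Rightarrow> monom r (exponent r (cnt r i a) (cnt r i k)) * monom r (exponent r (cnt r j c) (cnt r j l)))"
      unfolding x dimv prod.case by (simp only: monom_add)
  qed simp
  also have "\<dots> = CC r M * CC r N"
    unfolding M.CC_uniserial N.CC_uniserial sum_product by (simp add: sum.cartesian_product)
  finally show ?thesis .
qed

section \<open>The multiplication formulas\<close>

text \<open>The monomial \<open>1 / (x\<^sub>u\<^sub>-\<^sub>1 x\<^sub>u)\<close>, with indices read modulo \<open>r\<close>.\<close>

definition edge :: "int \<Rightarrow> int \<Rightarrow> laurent"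
  where "edge r u = x_pow r (- 1) (u - 1) * x_pow r (- 1) u"

lemma XE_eq:
  assumes r: "r \<ge> 1" and n: "n \<ge> 0"
  shows "XE r i n = x_pow r 1 (i - 1) * x_pow r 1 (i + n) * (\<Sum>u\<in>{i..i + n}. edge r u)"
proof -
  obtain b co where U: "uniserial r (indec r i n) i (nat n) b co"
    using uniserial_indec[OF r n] by blast
  have "XE r i n = (\<Sum>t\<le>nat n. x_pow r 1 (i - 1) * x_pow r 1 (i + n) * edge r (i + int t))"
    unfolding XE_def uniserial.CC_uniserial[OF U] monom_cnt[OF r] edge_def using n by simp
  also have "\<dots> = x_pow r 1 (i - 1) * x_pow r 1 (i + n) * (\<Sum>t\<le>nat n. edge r (i + int t))"
    by (simp only: sum_distrib_left)
  also have "(\<Sum>t\<le>nat n. edge r (i + int t)) = (\<Sum>u\<in>{i..i + n}. edge r u)"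
    using n by (intro sum.reindex_bij_witness[of _ "\<lambda>u. nat (u - i)" "\<lambda>t. i + int t"]) auto
  finally show ?thesis .
qed

lemma XE_cong: "wrap r i = wrap r j \<Longrightarrow> XE r i n = XE r j n"
  unfolding XE_def indec_def simple_rep_def by simp

text \<open>With \<open>Q\<close> a primitive of \<open>edge r\<close> and \<open>A\<close>, \<open>B\<close>, \<open>C\<close>, \<open>D\<close> its values at \<open>a\<close>, \<open>b + 1\<close>, \<open>c\<close>,
  \<open>d + 1\<close>, this is the Ptolemy relation \<open>(B - A) (D - C) = (D - A) (B - C) + (C - A) (D - B)\<close>:
  two crossing intervals are replaced by their union and intersection, or by the two parts
  outside of the intersection. All three products carry the same monomial factor.\<close>

lemma XE_ptolemy:
  assumes r: "r \<ge> 1" and ac: "a < c" and cb: "c \<le> b" and bd: "b < d"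
  shows "XE r a (b - a) * XE r c (d - c) =
    XE r a (d - a) * XE r c (b - c) + XE r a (c - 1 - a) * XE r (b + 1) (d - b - 1)"
proof -
  define Q where "Q z = (\<Sum>u\<in>{a..<z}. edge r u)" for z
  have S: "(\<Sum>u\<in>{x..y}. edge r u) = Q (y + 1) - Q x" if "a \<le> x" "x \<le> y + 1" for x y
  proof -
    have "{a..<y + 1} = {a..<x} \<union> {x..y}" using that by auto
    then have "Q (y + 1) = Q x + (\<Sum>u\<in>{x..y}. edge r u)"
      unfolding Q_def by (simp only:) (rule sum.union_disjoint, auto)
    then show ?thesis by simp
  qed
  define X where "X = x_pow r 1"
  have XE: "XE r x (y - x) = X (x - 1) * X y * (Q (y + 1) - Q x)" if "a \<le> x" "x \<le> y" for x y
    using XE_eq[OF r, of "y - x" x] S[of x y] that by (simp add: X_def)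
  have e1: "XE r a (b - a) = X (a - 1) * X b * (Q (b + 1) - Q a)" using ac cb by (intro XE) auto
  have e2: "XE r c (d - c) = X (c - 1) * X d * (Q (d + 1) - Q c)" using ac cb bd by (intro XE) auto
  have e3: "XE r a (d - a) = X (a - 1) * X d * (Q (d + 1) - Q a)" using ac cb bd by (intro XE) auto
  have e4: "XE r c (b - c) = X (c - 1) * X b * (Q (b + 1) - Q c)" using ac cb by (intro XE) auto
  have e5: "XE r a (c - 1 - a) = X (a - 1) * X (c - 1) * (Q c - Q a)"
    using XE[of a "c - 1"] ac by simp
  have e6: "XE r (b + 1) (d - b - 1) = X b * X d * (Q (d + 1) - Q (b + 1))"
    using XE[of "b + 1" d] ac cb bd by (simp add: algebra_simps)
  show ?thesis unfolding e1 e2 e3 e4 e5 e6 by (simp add: algebra_simps)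
qed

lemma wrap_shift: "wrap r (u + q * r) = wrap r u"
  unfolding wrap_eq_iff by simp

lemma wrap_eq_dvd: "wrap r u = wrap r v \<longleftrightarrow> r dvd u - v"
  unfolding wrap_eq_iff by (rule mod_eq_dvd_iff)

lemma no_ext_indec_iff:
  assumes r: "r \<ge> 1" and k: "1 \<le> k" and kn: "k \<le> n"
  shows "no_ext r (indec r i k) (indec r j n) \<longleftrightarrow>
    \<not> (\<exists>c. n - k \<le> c \<and> c < n \<and> r dvd j + c - (i - 1)) \<and> \<not> (\<exists>c. 0 \<le> c \<and> c < k \<and> r dvd i + c - (j - 1))"
proof -
  obtain b co where M: "uniserial r (indec r i k) i (nat k) b co"
    using uniserial_indec[OF r, of k] k by (metis order_trans zero_le_one)
  obtain b' co' where N: "uniserial r (indec r j n) j (nat n) b' co'"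
    using uniserial_indec[OF r, of n] k kn by (metis order_trans zero_le_one)
  interpret MN: uniserial_pair r "indec r i k" i "nat k" b co "indec r j n" j "nat n" b' co'
    by (rule uniserial_pair.intro[OF M N])
  interpret NM: uniserial_pair r "indec r j n" j "nat n" b' co' "indec r i k" i "nat k" b co
    by (rule uniserial_pair.intro[OF N M])
  have ex_nat: "(\<exists>c::nat. P (int c)) \<longleftrightarrow> (\<exists>c::int. 0 \<le> c \<and> P c)" for P
    by (metis nat_int zero_le_imp_eq_int of_nat_0_le_iff)
  have k0: "0 < nat k" and n0: "0 < nat n" using k kn by auto
  have c1: "c < nat n \<and> nat n \<le> c + nat k \<longleftrightarrow> int c < n \<and> n - k \<le> int c" for c
    using k kn by linarith
  have c2: "c < nat k \<and> nat k \<le> c + nat n \<longleftrightarrow> int c < k" for c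
    using k kn by linarith
  have "ext_dim r (indec r i k) (indec r j n) = 0 \<longleftrightarrow>
      \<not> (\<exists>c::nat. (c < nat n \<and> nat n \<le> c + nat k) \<and> r dvd j + int c - (i - 1))"
    unfolding MN.ext_dim_eq_0_iff[OF k0] wrap_eq_dvd by (simp only: conj_assoc)
  also have "\<dots> \<longleftrightarrow> \<not> (\<exists>c::nat. int c < n \<and> n - k \<le> int c \<and> r dvd j + int c - (i - 1))"
    unfolding c1 by (simp only: conj_assoc)
  also have "\<dots> \<longleftrightarrow> \<not> (\<exists>c. n - k \<le> c \<and> c < n \<and> r dvd j + c - (i - 1))"
    using kn by (subst ex_nat[of "\<lambda>c. c < n \<and> n - k \<le> c \<and> r dvd j + c - (i - 1)"]) auto
  finally have 1: "ext_dim r (indec r i k) (indec r j n) = 0 \<longleftrightarrow>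
      \<not> (\<exists>c. n - k \<le> c \<and> c < n \<and> r dvd j + c - (i - 1))" .
  have "ext_dim r (indec r j n) (indec r i k) = 0 \<longleftrightarrow>
      \<not> (\<exists>c::nat. (c < nat k \<and> nat k \<le> c + nat n) \<and> r dvd i + int c - (j - 1))"
    unfolding NM.ext_dim_eq_0_iff[OF n0] wrap_eq_dvd by (simp only: conj_assoc)
  also have "\<dots> \<longleftrightarrow> \<not> (\<exists>c::nat. int c < k \<and> r dvd i + int c - (j - 1))"
    unfolding c2 ..
  also have "\<dots> \<longleftrightarrow> \<not> (\<exists>c. 0 \<le> c \<and> c < k \<and> r dvd i + c - (j - 1))"
    by (subst ex_nat[of "\<lambda>c. c < k \<and> r dvd i + c - (j - 1)"]) auto
  finally show ?thesis using 1 unfolding no_ext_def by blast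
qed

lemma dvd_small: "r dvd z \<Longrightarrow> - r < z \<Longrightarrow> z < r \<Longrightarrow> z = 0" for r z :: int
  using dvd_imp_le_int[of z r] by fastforce

text \<open>There are extensions of \<open>E\<^sub>j[m r + l]\<close> by \<open>E\<^sub>i[k]\<close> iff the least non-negative solution
  \<open>c = r - 1 - i + j\<close> of the congruence is below \<open>k\<close>. Otherwise \<open>k < r\<close>, and the congruence for
  the other direction, in terms of the distance \<open>d\<close> of \<open>c\<close> from the top of the longer module,
  has only the solution \<open>d = l + j - i\<close>, if any.\<close>

lemma no_ext_condition_ge:
  fixes r i j k l m :: int
  assumes "r \<ge> 1" "1 \<le> k" "k \<le> m * r + l" "0 \<le> l" "l \<le> r - 1" "1 \<le> i" "i \<le> r" "1 \<le> j" "j \<le> r" "j \<le> i"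
  shows "no_ext r (indec r i k) (indec r j (m * r + l)) \<longleftrightarrow>
    \<not> (k + i \<ge> r + j) \<and> \<not> (k + i < r + j \<and> i \<le> l + j \<and> l + j \<le> k + i - 1)"
proof -
  let ?n = "m * r + l"
  have E2: "(\<exists>c. 0 \<le> c \<and> c < k \<and> r dvd i + c - (j - 1)) \<longleftrightarrow> k + i \<ge> r + j"
  proof
    assume "\<exists>c. 0 \<le> c \<and> c < k \<and> r dvd i + c - (j - 1)"
    then obtain c where c: "0 \<le> c" "c < k" "r dvd i + c - (j - 1)" by blast
    have "i + c - (j - 1) > 0" using c assms by linarith
    then have "r \<le> i + c - (j - 1)" using zdvd_imp_le[OF c(3)] by simp
    then show "k + i \<ge> r + j" using c by linarith
  next
    assume "k + i \<ge> r + j"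
    then show "\<exists>c. 0 \<le> c \<and> c < k \<and> r dvd i + c - (j - 1)"
      using assms by (intro exI[of _ "r - 1 - i + j"]) auto
  qed
  have E1: "(\<exists>c. ?n - k \<le> c \<and> c < ?n \<and> r dvd j + c - (i - 1)) \<longleftrightarrow> i \<le> l + j \<and> l + j \<le> k + i - 1"
    if lt: "k + i < r + j"
  proof
    assume "\<exists>c. ?n - k \<le> c \<and> c < ?n \<and> r dvd j + c - (i - 1)"
    then obtain c where c: "?n - k \<le> c" "c < ?n" "r dvd j + c - (i - 1)" by blast
    define d where "d = ?n - 1 - c"
    have d: "0 \<le> d" "d < k" using c by (auto simp: d_def)
    have "j + c - (i - 1) = (j + l - i - d) + m * r" by (simp add: d_def)
    then have rd: "r dvd (j + l - i - d)" using c(3) by (metis dvd_add_left_iff dvd_triv_right)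
    have "j + l - i - d = 0" using d assms lt by (intro dvd_small[OF rd]) linarith+
    then show "i \<le> l + j \<and> l + j \<le> k + i - 1" using d by linarith
  next
    assume "i \<le> l + j \<and> l + j \<le> k + i - 1"
    then show "\<exists>c. ?n - k \<le> c \<and> c < ?n \<and> r dvd j + c - (i - 1)"
      by (intro exI[of _ "?n - 1 - (l + j - i)"]) auto
  qed
  show ?thesis
    unfolding no_ext_indec_iff[OF assms(1-3)] E2 using E1 by auto
qed

text \<open>As in the previous lemma, with \<open>j - r\<close> in the place of \<open>j\<close>.\<close>

lemma no_ext_condition_less:
  fixes r i j k l m :: int
  assumes "r \<ge> 1" "1 \<le> k" "k \<le> m * r + l" "0 \<le> l" "l \<le> r - 1" "1 \<le> i" "i \<le> r" "1 \<le> j" "j \<le> r" "i < j"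
  shows "no_ext r (indec r i k) (indec r j (m * r + l)) \<longleftrightarrow>
    \<not> (k \<ge> j - i) \<and> \<not> (k < j - i \<and> i \<le> l + j - r \<and> l + j - r \<le> k + i - 1)"
proof -
  let ?n = "m * r + l"
  have E2: "(\<exists>c. 0 \<le> c \<and> c < k \<and> r dvd i + c - (j - 1)) \<longleftrightarrow> k \<ge> j - i"
  proof
    assume "\<exists>c. 0 \<le> c \<and> c < k \<and> r dvd i + c - (j - 1)"
    then obtain c where c: "0 \<le> c" "c < k" "r dvd i + c - (j - 1)" by blast
    show "k \<ge> j - i"
    proof (rule ccontr)
      assume "\<not> k \<ge> j - i"
      then have "i + c - (j - 1) = 0" using c assms by (intro dvd_small[OF c(3)]) linarith+
      then show False using c \<open>\<not> k \<ge> j - i\<close> by linarith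
    qed
  next
    assume "k \<ge> j - i"
    then show "\<exists>c. 0 \<le> c \<and> c < k \<and> r dvd i + c - (j - 1)"
      using assms by (intro exI[of _ "j - i - 1"]) auto
  qed
  have E1: "(\<exists>c. ?n - k \<le> c \<and> c < ?n \<and> r dvd j + c - (i - 1)) \<longleftrightarrow> i \<le> l + j - r \<and> l + j - r \<le> k + i - 1"
    if lt: "k < j - i"
  proof
    assume "\<exists>c. ?n - k \<le> c \<and> c < ?n \<and> r dvd j + c - (i - 1)"
    then obtain c where c: "?n - k \<le> c" "c < ?n" "r dvd j + c - (i - 1)" by blast
    define d where "d = ?n - 1 - c"
    have d: "0 \<le> d" "d < k" using c by (auto simp: d_def)
    have "j + c - (i - 1) = (j + l - r - i - d) + (m + 1) * r" by (simp add: d_def algebra_simps)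
    then have rd: "r dvd (j + l - r - i - d)" using c(3) by (metis dvd_add_left_iff dvd_triv_right)
    have "j + l - r - i - d = 0" using d assms lt by (intro dvd_small[OF rd]) linarith+
    then show "i \<le> l + j - r \<and> l + j - r \<le> k + i - 1" using d by linarith
  next
    assume A: "i \<le> l + j - r \<and> l + j - r \<le> k + i - 1"
    have "j + (?n - 1 - (l + j - r - i)) - (i - 1) = (m + 1) * r" by (simp add: algebra_simps)
    then have "r dvd j + (?n - 1 - (l + j - r - i)) - (i - 1)" by simp
    then show "\<exists>c. ?n - k \<le> c \<and> c < ?n \<and> r dvd j + c - (i - 1)"
      using A by (intro exI[of _ "?n - 1 - (l + j - r - i)"]) auto
  qed
  show ?thesis
    unfolding no_ext_indec_iff[OF assms(1-3)] E2 using E1 by auto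
qed

lemma CC_dsum_indec:
  assumes r: "r \<ge> 1" and k: "0 \<le> k" "k < r" and n: "n \<ge> 0"
  shows "CC r (rep_dsum (indec r i k) (indec r j n)) = XE r i k * XE r j n"
proof -
  obtain b co where M: "uniserial r (indec r i k) i (nat k) b co"
    using uniserial_indec[OF r k(1)] by blast
  obtain b' co' where N: "uniserial r (indec r j n) j (nat n) b' co'"
    using uniserial_indec[OF r n] by blast
  interpret short_uniserial_pair r "indec r i k" i "nat k" b co "indec r j n" j "nat n" b' co'
    using k by (intro short_uniserial_pair.intro uniserial_pair.intro M N short_uniserial_pair_axioms.intro) simp
  show ?thesis unfolding XE_def by (rule CC_dsum)
qed

theorem theorem3p1:
  fixes r i j k l m :: int
  assumes "r \<ge> 1"
    and "1 \<le> k" "k \<le> m * r + l"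
    and "0 \<le> l" "l \<le> r - 1"
    and "1 \<le> i" "i \<le> r" "1 \<le> j" "j \<le> r"
    and "m \<ge> 0"
  shows
    "(j \<le> i \<longrightarrow>
       (k + i \<ge> r + j \<longrightarrow>
          XE r i k * XE r j (m * r + l) =
            XE r i ((m + 1) * r + l + j - i) * XE r j (k + i - r - j)
            + XE r i (r + j - i - 1) * XE r (k + i + 1) ((m + 1) * r + l + j - k - i - 1)) \<and>
       (k + i < r + j \<and> i \<le> l + j \<and> l + j \<le> k + i - 1 \<longrightarrow>
          XE r i k * XE r j (m * r + l) =
            XE r j (m * r + k + i - j) * XE r i (l + j - i)
            + XE r j (m * r + i - j - 1) * XE r (l + j + 1) (k + i - l - j - 1)) \<and>
       (\<not> (k + i \<ge> r + j) \<and> \<not> (k + i < r + j \<and> i \<le> l + j \<and> l + j \<le> k + i - 1) \<longleftrightarrow>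
          no_ext r (indec r i k) (indec r j (m * r + l))) \<and>
       (\<not> (k + i \<ge> r + j) \<and> \<not> (k + i < r + j \<and> i \<le> l + j \<and> l + j \<le> k + i - 1) \<longrightarrow>
          XE r i k * XE r j (m * r + l) = CC r (rep_dsum (indec r i k) (indec r j (m * r + l))))) \<and>
     (j > i \<longrightarrow>
       (k \<ge> j - i \<longrightarrow>
          XE r i k * XE r j (m * r + l) =
            XE r i (j - i - 1) * XE r (k + i + 1) (m * r + l + j - k - i - 1)
            + XE r i (m * r + l + j - i) * XE r j (k + i - j)) \<and>
       (k < j - i \<and> i \<le> l + j - r \<and> l + j - r \<le> k + i - 1 \<longrightarrow>
          XE r i k * XE r j (m * r + l) =
            XE r j ((m + 1) * r + k + i - j) * XE r i (l + j - r - i)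
            + XE r j ((m + 1) * r + i - j - 1) * XE r (l + j + 1) (k + r + i - l - j - 1)) \<and>
       (\<not> (k \<ge> j - i) \<and> \<not> (k < j - i \<and> i \<le> l + j - r \<and> l + j - r \<le> k + i - 1) \<longleftrightarrow>
          no_ext r (indec r i k) (indec r j (m * r + l))) \<and>
       (\<not> (k \<ge> j - i) \<and> \<not> (k < j - i \<and> i \<le> l + j - r \<and> l + j - r \<le> k + i - 1) \<longrightarrow>
          XE r i k * XE r j (m * r + l) = CC r (rep_dsum (indec r i k) (indec r j (m * r + l)))))"
proof -
  let ?L = "m * r + l"
  have L0: "?L \<ge> 0" using assms by linarith
  have XEj: "XE r (j + r) n = XE r j n" for n
    using wrap_shift[of r j 1] by (intro XE_cong) simp
  have XEi: "XE r (i + q * r) n = XE r i n" for q n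
    by (intro XE_cong wrap_shift)
  have XEl: "XE r (j + ?L + 1) n = XE r (l + j + 1) n" for n
  proof (rule XE_cong)
    have "j + ?L + 1 = (l + j + 1) + m * r" by simp
    then show "wrap r (j + ?L + 1) = wrap r (l + j + 1)" by (simp only: wrap_shift)
  qed
  have 1: "XE r i k * XE r j ?L =
            XE r i ((m + 1) * r + l + j - i) * XE r j (k + i - r - j)
            + XE r i (r + j - i - 1) * XE r (k + i + 1) ((m + 1) * r + l + j - k - i - 1)"
    if "j \<le> i" "k + i \<ge> r + j"
  proof -
    \<comment> \<open>the intervals \<open>[i, i + k]\<close> and \<open>[j + r, j + r + m r + l]\<close> cross\<close>
    have "XE r i (i + k - i) * XE r (j + r) (j + r + ?L - (j + r)) =
        XE r i (j + r + ?L - i) * XE r (j + r) (i + k - (j + r)) +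
        XE r i (j + r - 1 - i) * XE r (i + k + 1) (j + r + ?L - (i + k) - 1)"
      using that assms by (intro XE_ptolemy) linarith+
    then show ?thesis unfolding XEj by (simp add: algebra_simps)
  qed
  have 2: "XE r i k * XE r j ?L =
            XE r j (m * r + k + i - j) * XE r i (l + j - i)
            + XE r j (m * r + i - j - 1) * XE r (l + j + 1) (k + i - l - j - 1)"
    if "j \<le> i" "k + i < r + j" "i \<le> l + j" "l + j \<le> k + i - 1"
  proof -
    have "j < i + m * r"
    proof (cases "m = 0")
      case True
      then show ?thesis using that assms by auto
    next
      case False
      then have "m * r \<ge> 1 * r" using assms by (intro mult_right_mono) auto
      then show ?thesis using that assms by linarith
    qed
    \<comment> \<open>the intervals \<open>[j, j + m r + l]\<close> and \<open>[i + m r, i + m r + k]\<close> cross\<close>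
    then have "XE r j (j + ?L - j) * XE r (i + m * r) (i + m * r + k - (i + m * r)) =
        XE r j (i + m * r + k - j) * XE r (i + m * r) (j + ?L - (i + m * r)) +
        XE r j (i + m * r - 1 - j) * XE r (j + ?L + 1) (i + m * r + k - (j + ?L) - 1)"
      using that assms by (intro XE_ptolemy) linarith+
    then show ?thesis unfolding XEi XEl by (simp add: algebra_simps)
  qed
  have 3: "XE r i k * XE r j ?L =
            XE r i (j - i - 1) * XE r (k + i + 1) (m * r + l + j - k - i - 1)
            + XE r i (m * r + l + j - i) * XE r j (k + i - j)"
    if "i < j" "k \<ge> j - i"
  proof -
    \<comment> \<open>the intervals \<open>[i, i + k]\<close> and \<open>[j, j + m r + l]\<close> cross\<close>
    have "XE r i (i + k - i) * XE r j (j + ?L - j) =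
        XE r i (j + ?L - i) * XE r j (i + k - j) +
        XE r i (j - 1 - i) * XE r (i + k + 1) (j + ?L - (i + k) - 1)"
      using that assms by (intro XE_ptolemy) linarith+
    then show ?thesis by (simp add: algebra_simps)
  qed
  have 4: "XE r i k * XE r j ?L =
            XE r j ((m + 1) * r + k + i - j) * XE r i (l + j - r - i)
            + XE r j ((m + 1) * r + i - j - 1) * XE r (l + j + 1) (k + r + i - l - j - 1)"
    if "i < j" "k < j - i" "i \<le> l + j - r" "l + j - r \<le> k + i - 1"
  proof -
    have mr: "m * r \<ge> 0" using assms by simp
    have e: "(m + 1) * r = m * r + r" by (simp add: algebra_simps)
    \<comment> \<open>the intervals \<open>[j, j + m r + l]\<close> and \<open>[i + (m + 1) r, i + (m + 1) r + k]\<close> cross\<close>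
    have "XE r j (j + ?L - j) * XE r (i + (m + 1) * r) (i + (m + 1) * r + k - (i + (m + 1) * r)) =
        XE r j (i + (m + 1) * r + k - j) * XE r (i + (m + 1) * r) (j + ?L - (i + (m + 1) * r)) +
        XE r j (i + (m + 1) * r - 1 - j) * XE r (j + ?L + 1) (i + (m + 1) * r + k - (j + ?L) - 1)"
      using that assms mr unfolding e by (intro XE_ptolemy) linarith+
    then show ?thesis unfolding XEi XEl by (simp add: algebra_simps)
  qed
  have 5: "XE r i k * XE r j ?L = CC r (rep_dsum (indec r i k) (indec r j ?L))" if "k < r"
    using that assms by (intro CC_dsum_indec[symmetric] L0) auto
  note ne = no_ext_condition_ge[OF assms(1-9)] no_ext_condition_less[OF assms(1-9)]
  show ?thesis
  proof (intro conjI impI)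
    assume "j \<le> i" "k + i \<ge> r + j"
    then show "XE r i k * XE r j ?L =
            XE r i ((m + 1) * r + l + j - i) * XE r j (k + i - r - j)
            + XE r i (r + j - i - 1) * XE r (k + i + 1) ((m + 1) * r + l + j - k - i - 1)" by (rule 1)
  next
    assume "j \<le> i" "k + i < r + j \<and> i \<le> l + j \<and> l + j \<le> k + i - 1"
    then show "XE r i k * XE r j ?L =
            XE r j (m * r + k + i - j) * XE r i (l + j - i)
            + XE r j (m * r + i - j - 1) * XE r (l + j + 1) (k + i - l - j - 1)" by (intro 2) auto
  next
    assume "j \<le> i"
    then show "\<not> (k + i \<ge> r + j) \<and> \<not> (k + i < r + j \<and> i \<le> l + j \<and> l + j \<le> k + i - 1) \<longleftrightarrow>
          no_ext r (indec r i k) (indec r j ?L)" using ne(1) by simp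
  next
    assume "j \<le> i" "\<not> (k + i \<ge> r + j) \<and> \<not> (k + i < r + j \<and> i \<le> l + j \<and> l + j \<le> k + i - 1)"
    then show "XE r i k * XE r j ?L = CC r (rep_dsum (indec r i k) (indec r j ?L))" by (intro 5) linarith
  next
    assume "j > i" "k \<ge> j - i"
    then show "XE r i k * XE r j ?L =
            XE r i (j - i - 1) * XE r (k + i + 1) (m * r + l + j - k - i - 1)
            + XE r i (m * r + l + j - i) * XE r j (k + i - j)" by (rule 3)
  next
    assume "j > i" "k < j - i \<and> i \<le> l + j - r \<and> l + j - r \<le> k + i - 1"
    then show "XE r i k * XE r j ?L =
            XE r j ((m + 1) * r + k + i - j) * XE r i (l + j - r - i)
            + XE r j ((m + 1) * r + i - j - 1) * XE r (l + j + 1) (k + r + i - l - j - 1)" by (intro 4) auto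
  next
    assume "j > i"
    then show "\<not> (k \<ge> j - i) \<and> \<not> (k < j - i \<and> i \<le> l + j - r \<and> l + j - r \<le> k + i - 1) \<longleftrightarrow>
          no_ext r (indec r i k) (indec r j ?L)" using ne(2) by simp
  next
    assume "j > i" "\<not> (k \<ge> j - i) \<and> \<not> (k < j - i \<and> i \<le> l + j - r \<and> l + j - r \<le> k + i - 1)"
    then show "XE r i k * XE r j ?L = CC r (rep_dsum (indec r i k) (indec r j ?L))"
      using assms by (intro 5) linarith
  qed
qed

end
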